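(* Let $s\ge 2$ and let $d_1,\ldots,d_s$ be integers with each $d_i>1$; put $d=\prod_{i=1}^s d_i$. For each prime $p$ let $\mu=\mu_p$ be the Hilbert-Kunz multiplicity of $h=\sum_{i=1}^s x_i^{d_i}\in(\mathbb{Z}/p)[x_1,\ldots,x_s]$. Then, as $p\to\infty$ through the primes, $$\mu\;\longrightarrow\;\frac{d\,2^{1-s}}{(s-1)!}\sum_{\lambda\in\mathbb{Z}}C_\lambda\;=\;\frac{d\,2^{1-s}}{(s-1)!}\Bigl(C_0+2\sum_{\lambda>0}C_\lambda\Bigr).$$
   Context: For a prime $p$, let $A=(\mathbb{Z}/p)[x_1,\ldots,x_s]$ and $h=\sum_{i=1}^s x_i^{d_i}\in A$. For $n\ge 0$ and $q=p^n$, $e_n(h)$ is the colength (the length of the quotient of $A$) of the ideal $(h,x_1^q,\ldots,x_s^q)$. By Hilbert-Kunz theory there is a real $\mu>0$ (depending on $p$) with $e_n(h)=\mu q^{s-1}+O(q^{s-2})$ as $n\to\infty$ for fixed $p$; $\mu=\lim_{n\to\infty}e_n(h)/q^{s-1}$ is the Hilbert-Kunz multiplicity of $h$. For $\lambda\in\mathbb{Z}$, $$C_\lambda=\sum(\epsilon_1\cdots\epsilon_s)\Bigl(\frac{\epsilon_1}{d_1}+\cdots+\frac{\epsilon_s}{d_s}-2\lambda\Bigr)^{s-1},$$ where the sum extends over the $s$-tuples $(\epsilon_1,\ldots,\epsilon_s)$ with each $\epsilon_i\in\{-1,1\}$ and $\frac{\epsilon_1}{d_1}+\cdots+\frac{\epsilon_s}{d_s}>2\lambda$.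 The sums over $\lambda$ are finite, since $C_\lambda=0$ when $|\lambda|\ge s/4$. *)

theory Defs
  imports
    "HOL-Algebra.Indexed_Polynomials"
    "HOL-Algebra.QuotRing"
    "HOL-Number_Theory.Residues"
    "HOL-Library.Extended_Nat"
    "HOL-Library.FuncSet"
    "HOL-Analysis.Infinite_Sum"
begin

text \<open>
  The library has the underlying set of the polynomials with coefficients in \<open>R\<close> and indeterminates
  indexed by \<open>I\<close> (functions from monomials, i.e.\ multisets, to coefficients), with addition and
  multiplication by an indeterminate, but no multiplication and no ring structure. The sum in the
  product runs over all factorizations \<open>m = a + b\<close> of the monomial \<open>m\<close>.
\<close>

definition mpoly_mult ::
  "('a, 'b) ring_scheme \<Rightarrow> ('i multiset \<Rightarrow> 'a) \<Rightarrow> ('i multiset \<Rightarrow> 'a) \<Rightarrow> ('i multiset \<Rightarrow> 'a)"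
  where "mpoly_mult R P Q =
    (\<lambda>m. finsum R (\<lambda>a. P a \<otimes>\<^bsub>R\<^esub> Q (m - a)) {a. a \<subseteq># m})"

definition mpoly_ring :: "('a, 'b) ring_scheme \<Rightarrow> 'i set \<Rightarrow> ('i multiset \<Rightarrow> 'a) ring"
  where "mpoly_ring R I =
    \<lparr>carrier = ring.indexed_pset R I (carrier R),
     monoid.mult = mpoly_mult R,
     one = ring.indexed_const R \<one>\<^bsub>R\<^esub>,
     zero = ring.indexed_const R \<zero>\<^bsub>R\<^esub>,
     add = ring.indexed_padd R\<rparr>"

lemma finite_submultisets: "finite {a. a \<subseteq># (m :: 'i multiset)}"
proof -
  have "{a. a \<subseteq># m} \<subseteq> mset ` {xs. set xs \<subseteq> set_mset m \<and> length xs \<le> size m}"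
  proof
    fix a assume a: "a \<in> {a. a \<subseteq># m}"
    obtain xs where xs: "a = mset xs" by (metis ex_mset)
    show "a \<in> mset ` {xs. set xs \<subseteq> set_mset m \<and> length xs \<le> size m}"
      using a xs size_mset_mono[of a m] set_mset_mono[of a m] by auto
  qed
  then show ?thesis
    using finite_lists_length_le[of "set_mset m" "size m"] finite_surj by blast
qed

context cring
begin

lemma mpoly_mult_closed_coeff:
  "carrier_coeff P \<Longrightarrow> carrier_coeff Q \<Longrightarrow> carrier_coeff (mpoly_mult R P Q)"
  by (auto simp: carrier_coeff_def mpoly_mult_def intro!: finsum_closed)

lemma mpoly_mult_comm:
  fixes P Q :: "'i multiset \<Rightarrow> 'a"
  assumes "carrier_coeff P" "carrier_coeff Q"
  shows "mpoly_mult R P Q = mpoly_mult R Q P"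
proof
  fix m :: "'i multiset"
  have inj: "inj_on (\<lambda>a. m - a) {a. a \<subseteq># m}"
    by (rule inj_on_inverseI[of _ "\<lambda>a. m - a"]) (auto simp: multiset_eq_iff subseteq_mset_def)
  have img: "(\<lambda>a. m - a) ` {a. a \<subseteq># m} = {a. a \<subseteq># m}"
    by (rule endo_inj_surj[OF finite_submultisets _ inj]) auto
  have "mpoly_mult R Q P m = finsum R (\<lambda>a. Q a \<otimes> P (m - a)) ((\<lambda>a. m - a) ` {a. a \<subseteq># m})"
    by (simp add: mpoly_mult_def img)
  also have "\<dots> = finsum R (\<lambda>a. Q (m - a) \<otimes> P (m - (m - a))) {a. a \<subseteq># m}"
    by (rule finsum_reindex) (use assms inj in \<open>auto simp: carrier_coeff_def\<close>)
  also have "\<dots> = mpoly_mult R P Q m"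
    unfolding mpoly_mult_def
  proof (rule finsum_cong')
    fix a assume "a \<in> {a. a \<subseteq># m}"
    then have "m - (m - a) = a"
      by (auto simp: multiset_eq_iff subseteq_mset_def)
    then show "Q (m - a) \<otimes> P (m - (m - a)) = P a \<otimes> Q (m - a)"
      using assms m_comm by (simp add: carrier_coeff_def)
  qed (use assms in \<open>auto simp: carrier_coeff_def\<close>)
  finally show "mpoly_mult R P Q m = mpoly_mult R Q P m" by simp
qed

lemma mpoly_mult_const_left:
  assumes "carrier_coeff P" "k \<in> carrier R"
  shows "mpoly_mult R (indexed_const k) P = (\<lambda>m. k \<otimes> P m)"
proof
  fix m
  have "mpoly_mult R (indexed_const k) P m =
      finsum R (\<lambda>a. if {#} = a then k \<otimes> P (m - a) else \<zero>) {a. a \<subseteq># m}"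
    unfolding mpoly_mult_def
    by (rule finsum_cong') (use assms in \<open>auto simp: carrier_coeff_def indexed_const_def\<close>)
  also have "\<dots> = k \<otimes> P (m - {#})"
    by (rule finsum_singleton) (use assms finite_submultisets in \<open>auto simp: carrier_coeff_def\<close>)
  finally show "mpoly_mult R (indexed_const k) P m = k \<otimes> P m" by simp
qed

lemma mpoly_mult_padd_left:
  assumes "carrier_coeff P" "carrier_coeff P'" "carrier_coeff Q"
  shows "mpoly_mult R (P \<Oplus> P') Q = mpoly_mult R P Q \<Oplus> mpoly_mult R P' Q"
proof
  fix m
  have "mpoly_mult R (P \<Oplus> P') Q m =
      finsum R (\<lambda>a. P a \<otimes> Q (m - a) \<oplus> P' a \<otimes> Q (m - a)) {a. a \<subseteq># m}"
    unfolding mpoly_mult_def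
    by (rule finsum_cong') (use assms in \<open>auto simp: carrier_coeff_def indexed_padd_def l_distr\<close>)
  also have "\<dots> = (mpoly_mult R P Q \<Oplus> mpoly_mult R P' Q) m"
    unfolding mpoly_mult_def indexed_padd_def
    by (rule finsum_addf) (use assms in \<open>auto simp: carrier_coeff_def\<close>)
  finally show "mpoly_mult R (P \<Oplus> P') Q m = (mpoly_mult R P Q \<Oplus> mpoly_mult R P' Q) m" .
qed

lemma mpoly_mult_padd_right:
  assumes "carrier_coeff P" "carrier_coeff Q" "carrier_coeff Q'"
  shows "mpoly_mult R P (Q \<Oplus> Q') = mpoly_mult R P Q \<Oplus> mpoly_mult R P Q'"
  using mpoly_mult_padd_left[OF assms(2,3,1)]
  by (simp add: mpoly_mult_comm[OF assms(1)] assms indexed_padd_in_carrier)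

lemma mpoly_mult_pmult_right:
  assumes "carrier_coeff P" "carrier_coeff Q"
  shows "mpoly_mult R P (Q \<Otimes> i) = mpoly_mult R P Q \<Otimes> i"
proof
  fix m
  show "mpoly_mult R P (Q \<Otimes> i) m = (mpoly_mult R P Q \<Otimes> i) m"
  proof (cases "i \<in># m")
    case False
    then have "mpoly_mult R P (Q \<Otimes> i) m = finsum R (\<lambda>a. \<zero>) {a. a \<subseteq># m}"
      unfolding mpoly_mult_def
      by (intro finsum_cong') (use assms in \<open>auto simp: carrier_coeff_def indexed_pmult_def dest: in_diffD\<close>)
    with False show ?thesis by (simp add: indexed_pmult_def)
  next
    case True
    have sub: "a \<subseteq># m - {#i#} \<longleftrightarrow> a \<subseteq># m \<and> i \<in># m - a" for a
    proof
      assume *: "a \<subseteq># m - {#i#}"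
      then have "count a i \<le> count m i - 1" and "a \<subseteq># m"
        by (auto simp: subseteq_mset_def dest: spec[of _ i] intro: order_trans[OF _ diff_le_self])
      moreover have "count m i > 0" using True by simp
      ultimately have "count a i < count m i" by linarith
      with \<open>a \<subseteq># m\<close> show "a \<subseteq># m \<and> i \<in># m - a"
        by (simp add: in_diff_count)
    next
      assume "a \<subseteq># m \<and> i \<in># m - a"
      then show "a \<subseteq># m - {#i#}"
        by (auto simp: subseteq_mset_def in_diff_count)
    qed
    have "mpoly_mult R P (Q \<Otimes> i) m =
        finsum R (\<lambda>a. P a \<otimes> Q (m - {#i#} - a)) {a. a \<subseteq># m - {#i#}}"
      unfolding mpoly_mult_def
    proof (rule add.finprod_mono_neutral_cong)
      show "finite {a. a \<subseteq># m - {#i#}}" "finite {a. a \<subseteq># m}"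
        by (rule finite_submultisets)+
    qed (use assms sub in
        \<open>auto simp: carrier_coeff_def indexed_pmult_def diff_right_commute\<close>)
    with True show ?thesis by (simp add: indexed_pmult_def mpoly_mult_def)
  qed
qed

lemma mpoly_ring_cring:
  fixes I :: "'i set"
  shows "cring (mpoly_ring R I)"
proof -
  have cc: "carrier_coeff P" if "P \<in> indexed_pset I (carrier R)" for P
    using indexed_pset_in_carrier[OF subset_refl that] .
  have const_closed: "mpoly_mult R (indexed_const k) P \<in> indexed_pset I (carrier R)"
    if "P \<in> indexed_pset I (carrier R)" "k \<in> carrier R" for P k
    using that(1)
  proof induction
    case (indexed_const j)
    have "mpoly_mult R (indexed_const k) (indexed_const j :: 'i multiset \<Rightarrow> 'a) = indexed_const (k \<otimes> j)"
      unfolding mpoly_mult_const_left[OF cc[OF indexed_pset.indexed_const[OF indexed_const]] that(2)]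
      using that(2) indexed_const by (auto simp: indexed_const_def fun_eq_iff)
    then show ?case using that(2) indexed_const by (simp add: indexed_pset.indexed_const)
  next
    case (indexed_padd P Q)
    then show ?case
      by (simp add: mpoly_mult_padd_right cc[OF indexed_pset.indexed_const[OF that(2)]] cc
          indexed_pset.indexed_padd)
  next
    case (indexed_pmult P i)
    then show ?case
      by (simp add: mpoly_mult_pmult_right cc[OF indexed_pset.indexed_const[OF that(2)]] cc
          indexed_pset.indexed_pmult)
  qed
  have mult_closed: "mpoly_mult R P Q \<in> indexed_pset I (carrier R)"
    if "P \<in> indexed_pset I (carrier R)" "Q \<in> indexed_pset I (carrier R)" for P Q
    using that(2)
  proof induction
    case (indexed_const k)
    then show ?case
      using const_closed[OF that(1)]
      by (simp add: mpoly_mult_comm[OF cc[OF that(1)] cc[OF indexed_pset.indexed_const]])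
  next
    case (indexed_padd Q Q')
    then show ?case
      by (simp add: mpoly_mult_padd_right cc[OF that(1)] cc indexed_pset.indexed_padd)
  next
    case (indexed_pmult Q i)
    then show ?case
      by (simp add: mpoly_mult_pmult_right cc[OF that(1)] cc indexed_pset.indexed_pmult)
  qed
  have assoc: "mpoly_mult R (mpoly_mult R P Q) S = mpoly_mult R P (mpoly_mult R Q S)"
    if P: "P \<in> indexed_pset I (carrier R)" and Q: "Q \<in> indexed_pset I (carrier R)" and S: "S \<in> indexed_pset I (carrier R)" for P Q S
    using S
  proof induction
    case (indexed_const k)
    note ck = cc[OF indexed_pset.indexed_const[OF indexed_const]]
    have "mpoly_mult R (mpoly_mult R P Q) (indexed_const k) = (\<lambda>m. k \<otimes> mpoly_mult R P Q m)"
      using mpoly_mult_comm[OF mpoly_mult_closed_coeff[OF cc[OF P] cc[OF Q]] ck]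
        mpoly_mult_const_left[OF mpoly_mult_closed_coeff[OF cc[OF P] cc[OF Q]] indexed_const] by simp
    also have "\<dots> = mpoly_mult R P (\<lambda>m. k \<otimes> Q m)"
    proof
      fix m
      have "k \<otimes> mpoly_mult R P Q m = finsum R (\<lambda>a. k \<otimes> (P a \<otimes> Q (m - a))) {a. a \<subseteq># m}"
        unfolding mpoly_mult_def
        by (rule finsum_rdistr) (use cc[OF P] cc[OF Q] finite_submultisets indexed_const in \<open>auto simp: carrier_coeff_def\<close>)
      also have "\<dots> = mpoly_mult R P (\<lambda>m. k \<otimes> Q m) m"
        unfolding mpoly_mult_def
        by (rule finsum_cong') (use cc[OF P] cc[OF Q] indexed_const in \<open>auto simp: carrier_coeff_def m_lcomm\<close>)
      finally show "k \<otimes> mpoly_mult R P Q m = mpoly_mult R P (\<lambda>m. k \<otimes> Q m) m" .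
    qed
    also have "(\<lambda>m. k \<otimes> Q m) = mpoly_mult R Q (indexed_const k)"
      using mpoly_mult_comm[OF cc[OF Q] ck] mpoly_mult_const_left[OF cc[OF Q] indexed_const] by simp
    finally show ?case .
  next
    case (indexed_padd S S')
    then show ?case
      by (simp add: mpoly_mult_padd_right cc mult_closed P Q)
  next
    case (indexed_pmult S i)
    then show ?case
      by (simp add: mpoly_mult_pmult_right cc mult_closed P Q)
  qed
  have neg: "\<exists>Q \<in> indexed_pset I (carrier R). Q \<Oplus> P = indexed_const \<zero>"
    if P: "P \<in> indexed_pset I (carrier R)" for P
  proof (rule bexI[of _ "mpoly_mult R (indexed_const (\<ominus> \<one>)) P"])
    show "mpoly_mult R (indexed_const (\<ominus> \<one>)) P \<in> indexed_pset I (carrier R)"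
      using const_closed[OF P] by simp
    show "mpoly_mult R (indexed_const (\<ominus> \<one>)) P \<Oplus> P = indexed_const \<zero>"
      using mpoly_mult_const_left[OF cc[OF P], of "\<ominus> \<one>"] cc[OF P]
      by (auto simp: indexed_padd_def indexed_zero_def carrier_coeff_def fun_eq_iff l_minus l_neg)
  qed
  note ccD = cc[unfolded carrier_coeff_def, rule_format]
  show ?thesis
  proof (rule cringI)
    show "abelian_group (mpoly_ring R I)"
    proof (rule abelian_groupI, goal_cases)
      case (1 x y)
      then show ?case by (simp add: mpoly_ring_def indexed_pset.indexed_padd)
    next
      case 2
      then show ?case by (simp add: mpoly_ring_def indexed_pset.indexed_const)
    next
      case (3 x y z)
      then show ?case by (simp add: mpoly_ring_def indexed_padd_def ccD a_assoc)
    next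
      case (4 x y)
      then show ?case by (simp add: mpoly_ring_def indexed_padd_def ccD a_comm)
    next
      case (5 x)
      then show ?case by (simp add: mpoly_ring_def indexed_padd_zero cc)
    next
      case (6 x)
      then show ?case using neg by (simp add: mpoly_ring_def)
    qed
    show "comm_monoid (mpoly_ring R I)"
    proof (rule comm_monoidI, goal_cases)
      case (1 x y)
      then show ?case by (simp add: mpoly_ring_def mult_closed)
    next
      case 2
      then show ?case by (simp add: mpoly_ring_def indexed_pset.indexed_const)
    next
      case (3 x y z)
      then show ?case by (simp add: mpoly_ring_def assoc)
    next
      case (4 x)
      then show ?case by (simp add: mpoly_ring_def mpoly_mult_const_left cc ccD)
    next
      case (5 x y)
      then show ?case by (simp add: mpoly_ring_def mpoly_mult_comm[OF cc cc])
    qed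
    show "(x \<oplus>\<^bsub>mpoly_ring R I\<^esub> y) \<otimes>\<^bsub>mpoly_ring R I\<^esub> z =
        x \<otimes>\<^bsub>mpoly_ring R I\<^esub> z \<oplus>\<^bsub>mpoly_ring R I\<^esub> y \<otimes>\<^bsub>mpoly_ring R I\<^esub> z"
      if "x \<in> carrier (mpoly_ring R I)" "y \<in> carrier (mpoly_ring R I)" "z \<in> carrier (mpoly_ring R I)"
      for x y z
      using that by (simp add: mpoly_ring_def mpoly_mult_padd_left cc)
  qed
qed

end

definition quot_module :: "('a, 'b) ring_scheme \<Rightarrow> 'a set \<Rightarrow> ('a, 'a set) module"
  where "quot_module R I =
    ring.extend (R Quot I)
      (module.fields (\<lambda>r x. (I +>\<^bsub>R\<^esub> r) \<otimes>\<^bsub>R Quot I\<^esub> x))"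

lemma quot_module_module:
  assumes "cring R" and "ideal I R"
  shows "module R (quot_module R I)"
proof -
  interpret R: cring R by fact
  interpret I: ideal I R by fact
  interpret Q: cring "R Quot I" by (rule I.quotient_is_cring) (rule assms)
  have hom: "(+>\<^bsub>R\<^esub>) I \<in> ring_hom R (R Quot I)"
    by (rule I.rcos_ring_hom)
  note homs = ring_hom_closed[OF hom] ring_hom_add[OF hom] ring_hom_mult[OF hom]
    ring_hom_one[OF hom]
  have sel: "carrier (quot_module R I) = carrier (R Quot I)"
    "add (quot_module R I) = add (R Quot I)" "zero (quot_module R I) = zero (R Quot I)"
    "smult (quot_module R I) = (\<lambda>r x. (I +>\<^bsub>R\<^esub> r) \<otimes>\<^bsub>R Quot I\<^esub> x)"
    by (simp_all add: quot_module_def ring.defs module.defs)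
  show ?thesis
  proof (rule moduleI)
    show "abelian_group (quot_module R I)"
      by (rule abelian_groupI)
        (use Q.l_neg in \<open>auto simp only: sel Q.a_ac Q.l_zero Q.r_zero Q.add.m_closed Q.zero_closed intro: Q.a_inv_closed\<close>)
  qed (simp_all add: sel homs Q.l_distr Q.r_distr Q.m_assoc assms)
qed

definition module_length :: "('a, 'b) ring_scheme \<Rightarrow> ('a, 'c, 'd) module_scheme \<Rightarrow> enat"
  where "module_length R M =
    Sup {enat n | n. \<exists>N :: nat \<Rightarrow> 'c set.
      (\<forall>i\<le>n. submodule (N i) R M) \<and> (\<forall>i<n. N i \<subset> N (Suc i))}"

definition colength :: "('a, 'b) ring_scheme \<Rightarrow> 'a set \<Rightarrow> enat"
  where "colength R I = module_length R (quot_module R I)"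

definition poly_Zp :: "nat \<Rightarrow> nat \<Rightarrow> (nat multiset \<Rightarrow> int) ring"
  where "poly_Zp p s = mpoly_ring (residue_ring (int p)) {1..s}"

definition var_Zp :: "nat \<Rightarrow> nat \<Rightarrow> (nat multiset \<Rightarrow> int)"
  where "var_Zp p i = ring.indexed_var (residue_ring (int p)) i"

definition diagonal_form :: "nat \<Rightarrow> nat \<Rightarrow> (nat \<Rightarrow> nat) \<Rightarrow> (nat multiset \<Rightarrow> int)"
  where "diagonal_form p s d =
    finsum (poly_Zp p s) (\<lambda>i. var_Zp p i [^]\<^bsub>poly_Zp p s\<^esub> d i) {1..s}"

text \<open>
  The colength is finite for \<open>p\<close> prime, since the ideal contains a power of each
  indeterminate.
\<close>

definition hk_colength :: "nat \<Rightarrow> nat \<Rightarrow> (nat multiset \<Rightarrow> int) \<Rightarrow> nat \<Rightarrow> nat"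
  where "hk_colength p s h n =
    the_enat (colength (poly_Zp p s)
      (Idl\<^bsub>poly_Zp p s\<^esub>
        (insert h ((\<lambda>i. var_Zp p i [^]\<^bsub>poly_Zp p s\<^esub> (p ^ n)) ` {1..s}))))"

text \<open>
  Hilbert-Kunz theory gives convergence for \<open>p\<close> prime and \<open>h\<close> a nonzero polynomial.
\<close>

definition hk_multiplicity :: "nat \<Rightarrow> nat \<Rightarrow> (nat multiset \<Rightarrow> int) \<Rightarrow> real"
  where "hk_multiplicity p s h =
    lim (\<lambda>n. real (hk_colength p s h n) / real (p ^ n) ^ (s - 1))"

definition C_coeff :: "nat \<Rightarrow> (nat \<Rightarrow> nat) \<Rightarrow> int \<Rightarrow> real"
  where "C_coeff s d l =
    (\<Sum>\<epsilon> | \<epsilon> \<in> {1..s} \<rightarrow>\<^sub>E {-1, 1} \<and> (\<Sum>i=1..s. \<epsilon> i / real (d i)) > 2 * real_of_int l.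
      (\<Prod>i=1..s. \<epsilon> i) * ((\<Sum>i=1..s. \<epsilon> i / real (d i)) - 2 * real_of_int l) ^ (s - 1))"

end

theory Submission
  imports Defs "HOL-Library.Function_Algebras"
begin

text \<open>
  Put \<open>k = \<int>/p\<close> and \<open>q = p^n\<close>. As a module over \<open>k[T]\<close>, with \<open>T\<close> acting by \<open>x^{d_i}\<close>, the ring \<open>k[x]/(x^q)\<close>
  splits according to the exponent modulo \<open>d_i\<close> into \<open>d_i\<close> cyclic modules \<open>k[T]/(T^a)\<close>, with \<open>a\<close> within 1 of \<open>q/d_i\<close>.
  Hence the colength \<open>e_n\<close> is a sum of \<open>d_1 \<cdots> d_s\<close> numbers \<open>D(a_1,...,a_s)\<close>, where \<open>D(a)\<close> is the dimension of
  \<open>k[y_1,...,y_s]/(y_1^{a_1},...,y_s^{a_s}, y_1 + ... + y_s)\<close> (lemmas \<open>log_card_ker_split\<close> and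
  \<open>real_hk_colength\<close>). The theorem is a statement about the numbers \<open>D(a)\<close>, and two facts make it uniform
  in \<open>p\<close>. Changing one coordinate by 1 changes \<open>D\<close> by at most \<open>q^{s-2}\<close> as long as all coordinates are at most
  \<open>q\<close> (\<open>D_lipschitz\<close>), and \<open>D(p a) = p^{s-1} D(a)\<close> because \<open>T^p = \<Sum> y_i^p\<close> in characteristic \<open>p\<close>
  (\<open>D_times_p\<close>). Therefore the numbers \<open>D(\<lfloor>q/d_i\<rfloor>)/q^{s-1}\<close> form a Cauchy sequence in \<open>n\<close> whose limit is within
  \<open>s/p\<close> of its term at \<open>n = 1\<close>, and \<open>\<mu>\<close> is within \<open>O(1/p)\<close> of \<open>d_1 \<cdots> d_s D(\<lfloor>p/d_i\<rfloor>)/p^{s-1}\<close>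
  (\<open>hk_multiplicity_estimate\<close>).

  It remains to know \<open>D(a)\<close> when all \<open>a_i\<close> are at most \<open>p\<close>. In that range it is the number of monomials
  of the box whose degree is congruent modulo \<open>p\<close> to the middle degree \<open>\<lfloor>\<Sum> (a_i - 1) / 2\<rfloor>\<close>
  (\<open>D_eq_central_count\<close>). Both sides satisfy the discrete wave equation
  \<open>D(a+1,b) + D(a-1,b) = D(a,b+1) + D(a,b-1)\<close> for \<open>0 < a, b < p\<close>, which expresses that either side is
  \<open>D(2,a,b)\<close>; they agree when a coordinate is 0 or 1 and when a coordinate is \<open>p\<close>, where \<open>T^p\<close> vanishes. As
  for a vibrating string with fixed ends, these data determine the solution.

  Counting the monomials by inclusion-exclusion, with one term for each degree \<open>middle + \<lambda> p\<close>, gives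
  binomial coefficients that are asymptotic to \<open>2^{1-s} p^{s-1}/(s-1)!\<close> times the \<open>(s-1)\<close>-st powers in the definition of
  \<open>C_\<lambda>\<close> (\<open>central_count_asymptotic\<close>). The second form of the limit is the symmetry \<open>C_{-\<lambda>} = C_\<lambda>\<close>, the vanishing of
  an \<open>s\<close>-fold difference of a polynomial of degree \<open>s - 1\<close> (\<open>C_coeff_uminus\<close>).

  No vector spaces are used: over \<open>\<int>/p\<close> every dimension is the logarithm to base \<open>p\<close> of the number of
  elements. Polynomials are replaced by functions on exponent vectors with values in a group of order \<open>p\<close>, and
  multiplication by \<open>y_i\<close> by the lowering shift in direction \<open>i\<close>. This is Macaulay's inverse system; it has the
  advantage that the shifts act on all functions and preserve those supported in a box.
\<close>

section \<open>Finite additive groups\<close>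

definition add_subgroup :: "'b::ab_group_add set \<Rightarrow> bool"
  where "add_subgroup H \<longleftrightarrow> 0 \<in> H \<and> (\<forall>x\<in>H. \<forall>y\<in>H. x - y \<in> H)"

lemma add_subgroupD:
  assumes "add_subgroup H"
  shows "0 \<in> H" "x \<in> H \<Longrightarrow> y \<in> H \<Longrightarrow> x - y \<in> H" "x \<in> H \<Longrightarrow> - x \<in> H"
    "x \<in> H \<Longrightarrow> y \<in> H \<Longrightarrow> x + y \<in> H"
proof -
  show z: "0 \<in> H" and m: "x \<in> H \<Longrightarrow> y \<in> H \<Longrightarrow> x - y \<in> H" for x y
    using assms by (auto simp: add_subgroup_def)
  show u: "x \<in> H \<Longrightarrow> - x \<in> H" for x using m[OF z, of x] by simp
  show "x \<in> H \<Longrightarrow> y \<in> H \<Longrightarrow> x + y \<in> H" using m[of x "- y"] u[of y] by simp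
qed

text \<open>
  The sets being counted are the cosets of \<open>W\<close> in \<open>V\<close>, so this is Lagrange's theorem. It is phrased for
  subsets of a type of class \<open>ab_group_add\<close> so that all later arguments can calculate in the type.
\<close>

lemma card_cosets_mult_card:
  assumes V: "finite V" "add_subgroup V" and W: "add_subgroup W" "W \<subseteq> V"
  shows "card ((\<lambda>v. {w \<in> V. w - v \<in> W}) ` V) * card W = card V"
proof -
  let ?c = "\<lambda>v. {w \<in> V. w - v \<in> W}"
  note VD = add_subgroupD[OF V(2)] and WD = add_subgroupD[OF W(1)]
  have eq: "?c v = ?c v'" if "v - v' \<in> W" for v v'
  proof -
    have "w - v \<in> W \<longleftrightarrow> w - v' \<in> W" for w
      using WD(4)[of "w - v" "v - v'"] WD(2)[of "w - v'" "v - v'"] that by auto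
    then show ?thesis by simp
  qed
  have "card W * card (?c ` V) = card (\<Union>(?c ` V))"
  proof (rule card_partition)
    show "finite (?c ` V)" "finite (\<Union>(?c ` V))" using V by auto
    show "card c = card W" if "c \<in> ?c ` V" for c
    proof -
      from that obtain v where v: "v \<in> V" "c = ?c v" by auto
      have "bij_betw (\<lambda>w. w - v) c W"
        by (rule bij_betw_byWitness[where f' = "\<lambda>w. w + v"])
          (use v VD W in \<open>auto simp: subset_iff\<close>)
      then show ?thesis by (rule bij_betw_same_card)
    qed
    show "c1 \<inter> c2 = {}" if c: "c1 \<in> ?c ` V" "c2 \<in> ?c ` V" "c1 \<noteq> c2" for c1 c2
    proof (rule ccontr)
      assume "c1 \<inter> c2 \<noteq> {}"
      moreover obtain v1 v2 where v: "c1 = ?c v1" "c2 = ?c v2" using c by auto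
      ultimately obtain w where "w - v1 \<in> W" "w - v2 \<in> W" by auto
      then have "(w - v2) - (w - v1) \<in> W" using WD(2) by blast
      then have "v1 - v2 \<in> W" by simp
      then show False using eq v c(3) by blast
    qed
  qed
  moreover have "\<Union>(?c ` V) = V" using WD(1) by auto
  ultimately show ?thesis by (simp add: mult.commute)
qed

lemma add_subgroup_kernel:
  assumes "add_subgroup V" "\<And>x y. \<phi> (x - y) = \<phi> x - (\<phi> y :: 'c::ab_group_add)"
  shows "add_subgroup {v \<in> V. \<phi> v = 0}"
  using add_subgroupD[OF assms(1)] assms(2)[of 0 0] by (auto simp: add_subgroup_def assms(2))

lemma add_subgroup_image:
  assumes "add_subgroup V" "\<And>x y. \<phi> (x - y) = \<phi> x - (\<phi> y :: 'c::ab_group_add)"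
  shows "add_subgroup (\<phi> ` V)"
  unfolding add_subgroup_def
proof (intro conjI ballI)
  show "0 \<in> \<phi> ` V" using add_subgroupD(1)[OF assms(1)] assms(2)[of 0 0] by (auto simp: image_iff)
  fix x y assume "x \<in> \<phi> ` V" "y \<in> \<phi> ` V"
  then show "x - y \<in> \<phi> ` V" using add_subgroupD(2)[OF assms(1)] assms(2) by (auto simp: image_iff) metis
qed

text \<open>
  Two maps with the same fibres have images of the same size. This compares the residue classes of a
  polynomial ring with cosets in a group of functions.
\<close>

lemma card_same_fibers:
  assumes "\<And>x y. x \<in> A \<Longrightarrow> y \<in> A \<Longrightarrow> F x = F y \<longleftrightarrow> H x = H y"
  shows "card (F ` A) = card (H ` A)"
proof -
  have "bij_betw (\<lambda>y. H (SOME x. x \<in> A \<and> F x = y)) (F ` A) (H ` A)"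
  proof -
    have sel: "(SOME x'. x' \<in> A \<and> F x' = F x) \<in> A \<and> F (SOME x'. x' \<in> A \<and> F x' = F x) = F x"
      if "x \<in> A" for x
      by (rule someI[of "\<lambda>x'. x' \<in> A \<and> F x' = F x"]) (use that in auto)
    then have H: "H (SOME x'. x' \<in> A \<and> F x' = F x) = H x" if "x \<in> A" for x
      using assms that by blast
    show ?thesis
      by (rule bij_betwI') (use assms H in \<open>auto simp: image_iff\<close>)
  qed
  then show ?thesis by (rule bij_betw_same_card)
qed

lemma card_kernel_mult_card_image:
  assumes V: "finite V" "add_subgroup V"
    and \<phi>: "\<And>x y. \<phi> (x - y) = \<phi> x - (\<phi> y :: 'c::ab_group_add)"
  shows "card {v \<in> V. \<phi> v = 0} * card (\<phi> ` V) = card V"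
proof -
  let ?K = "{v \<in> V. \<phi> v = 0}"
  note VD = add_subgroupD[OF V(2)]
  have "card ((\<lambda>v. {w \<in> V. w - v \<in> ?K}) ` V) = card (\<phi> ` V)"
  proof (rule card_same_fibers)
    fix x y assume xy: "x \<in> V" "y \<in> V"
    have c: "{w \<in> V. w - v \<in> ?K} = {w \<in> V. \<phi> w = \<phi> v}" if "v \<in> V" for v
      using that VD by (auto simp: \<phi>)
    show "{w \<in> V. w - x \<in> ?K} = {w \<in> V. w - y \<in> ?K} \<longleftrightarrow> \<phi> x = \<phi> y"
      unfolding c[OF xy(1)] c[OF xy(2)] using xy by auto
  qed
  with card_cosets_mult_card[OF V add_subgroup_kernel[of V \<phi>, OF V(2) \<phi>]] show ?thesis
    by (simp add: mult.commute)
qed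

lemma funpow_additive:
  fixes A :: "'b::ab_group_add \<Rightarrow> 'b"
  assumes "\<And>x y. A (x - y) = A x - A y"
  shows "(A ^^ n) (x - y) = (A ^^ n) x - (A ^^ n) y"
  by (induction n) (auto simp: assms)

text \<open>
  The binomial theorem in the subring of endomorphisms generated by \<open>A\<close> and \<open>B\<close>. Endomorphisms do not
  form a type with a commutative ring structure, so the usual induction with Pascal's rule is repeated.
\<close>

lemma binomial_commuting_endomorphisms:
  fixes A B :: "'b::comm_ring_1 \<Rightarrow> 'b"
  assumes A: "\<And>x y. A (x + y) = A x + A y" and B: "\<And>x y. B (x + y) = B x + B y"
    and AB: "\<And>x. A (B x) = B (A x)"
  shows "((\<lambda>x. A x + B x) ^^ n) x
    = (\<Sum>k\<le>n. of_nat (n choose k) * (A ^^ k) ((B ^^ (n - k)) x))"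
proof (induction n)
  case (Suc n)
  have A0: "A 0 = 0" using A[of 0 0] by simp
  have B0: "B 0 = 0" using B[of 0 0] by simp
  have An: "A (of_nat c * y) = of_nat c * A y" for c y
    by (induction c) (auto simp: A A0 algebra_simps)
  have Bn: "B (of_nat c * y) = of_nat c * B y" for c y
    by (induction c) (auto simp: B B0 algebra_simps)
  have As: "A (sum g S) = (\<Sum>k\<in>S. A (g k))" for g :: "nat \<Rightarrow> 'b" and S
    by (induction S rule: infinite_finite_induct) (auto simp: A A0)
  have Bs: "B (sum g S) = (\<Sum>k\<in>S. B (g k))" for g :: "nat \<Rightarrow> 'b" and S
    by (induction S rule: infinite_finite_induct) (auto simp: B B0)
  have BA: "B ((A ^^ k) y) = (A ^^ k) (B y)" for k y
    by (induction k) (auto simp: AB[symmetric])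
  let ?t = "\<lambda>n k. (A ^^ k) ((B ^^ (n - k)) x)"
  have "((\<lambda>x. A x + B x) ^^ Suc n) x = (\<Sum>k\<le>n. of_nat (n choose k) * ?t (Suc n) (Suc k))
      + (\<Sum>k\<le>n. of_nat (n choose k) * ?t (Suc n) k)"
    by (simp add: Suc.IH As Bs An Bn BA Suc_diff_le)
  also have "(\<Sum>k\<le>n. of_nat (n choose k) * ?t (Suc n) k)
      = (\<Sum>k\<le>Suc n. of_nat (n choose k) * ?t (Suc n) k)"
    by (simp add: binomial_eq_0)
  also have "\<dots> = ?t (Suc n) 0 + (\<Sum>k\<le>n. of_nat (n choose Suc k) * ?t (Suc n) (Suc k))"
    by (subst sum.atMost_Suc_shift) simp
  finally have "((\<lambda>x. A x + B x) ^^ Suc n) x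
      = ?t (Suc n) 0 + (\<Sum>k\<le>n. of_nat (Suc n choose Suc k) * ?t (Suc n) (Suc k))"
    by (simp add: sum.distrib algebra_simps)
  then show ?case by (subst sum.atMost_Suc_shift) simp
qed simp

section \<open>Shift operators on functions with box support\<close>

text \<open>
  On the inverse system this is the action of \<open>\<Sum>\<^sub>i y\<^sub>i^{d\<^sub>i}\<close>: multiplication by \<open>y\<^sub>i\<close> lowers exponents by one, that
  is, it evaluates a function one step further in direction \<open>i\<close>.
\<close>

definition shift_sum :: "('i \<Rightarrow> nat) \<Rightarrow> 'i set \<Rightarrow> (('i \<Rightarrow> nat) \<Rightarrow> 'g::comm_ring_1) \<Rightarrow> ('i \<Rightarrow> nat) \<Rightarrow> 'g"
  where "shift_sum d I f = (\<lambda>m. \<Sum>i\<in>I. f (m(i := m i + d i)))"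

abbreviation unit_shift_sum :: "'i set \<Rightarrow> (('i \<Rightarrow> nat) \<Rightarrow> 'g::comm_ring_1) \<Rightarrow> ('i \<Rightarrow> nat) \<Rightarrow> 'g"
  where "unit_shift_sum \<equiv> shift_sum (\<lambda>_. 1)"

definition box :: "'i set \<Rightarrow> ('i \<Rightarrow> nat) \<Rightarrow> ('i \<Rightarrow> nat) set"
  where "box I a = {m. (\<forall>i\<in>I. m i < a i) \<and> (\<forall>i. i \<notin> I \<longrightarrow> m i = 0)}"

lemma shift_sum_add: "shift_sum d I (f + g) = shift_sum d I f + shift_sum d I g"
  by (auto simp: shift_sum_def sum.distrib)

lemma shift_sum_diff: "shift_sum d I (f - g) = shift_sum d I f - shift_sum d I g"
  by (auto simp: shift_sum_def sum_subtractf)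

lemmas shift_sum_pow_diff = funpow_additive[of "shift_sum d I" for d I, OF shift_sum_diff]

lemma shift_sum_zero: "shift_sum d I 0 = 0"
  using shift_sum_diff[of d I 0 0] by simp

lemma shift_sum_pow_zero: "(shift_sum d I ^^ n) 0 = 0"
  using shift_sum_pow_diff[where x=0 and y=0] by simp

lemma shift_sum_pow_add:
  "(shift_sum d I ^^ n) (f + g) = (shift_sum d I ^^ n) f + (shift_sum d I ^^ n) g"
  by (induction n) (simp_all only: funpow.simps comp_apply id_apply shift_sum_add)

lemma shift_sum_of_nat: "shift_sum d I (of_nat c * f) = of_nat c * shift_sum d I f"
  by (auto simp: shift_sum_def sum_distrib_left)

lemma shift_sum_pow_of_nat:
  "(shift_sum d I ^^ n) (of_nat c * f) = of_nat c * (shift_sum d I ^^ n) f"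
  by (induction n) (simp_all only: funpow.simps comp_apply id_apply shift_sum_of_nat)

lemma bij_box_PiE:
  "bij_betw (\<lambda>m. restrict m I) (box I a) (\<Pi>\<^sub>E i\<in>I. {..<a i})"
  by (rule bij_betw_byWitness[where f' = "\<lambda>m i. if i \<in> I then m i else 0"])
    (auto simp: box_def fun_eq_iff PiE_def extensional_def Pi_def)

lemma card_box: "finite I \<Longrightarrow> card (box I a) = (\<Prod>i\<in>I. a i)"
  using bij_betw_same_card[OF bij_box_PiE[of I a]] by (simp add: card_PiE)

lemma finite_box: "finite I \<Longrightarrow> finite (box I a)"
  using bij_betw_finite[OF bij_box_PiE[of I a]] finite_PiE[of I "\<lambda>i. {..<a i}"] by simp

definition residue_part :: "('i \<Rightarrow> nat) \<Rightarrow> ('i \<Rightarrow> nat) \<Rightarrow> (('i \<Rightarrow> nat) \<Rightarrow> 'g) \<Rightarrow> ('i \<Rightarrow> nat) \<Rightarrow> 'g"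
  where "residue_part d r f = (\<lambda>m. f (\<lambda>i. d i * m i + r i))"

text \<open>
  The number of \<open>j\<close> with \<open>d j + r < b\<close>, namely \<open>(b - r)/d\<close> rounded up; the form is chosen so that truncated
  subtraction is harmless for \<open>r < d\<close>.
\<close>

definition residue_bound :: "('i \<Rightarrow> nat) \<Rightarrow> ('i \<Rightarrow> nat) \<Rightarrow> ('i \<Rightarrow> nat) \<Rightarrow> 'i \<Rightarrow> nat"
  where "residue_bound d b r = (\<lambda>i. (b i + d i - 1 - r i) div d i)"

text \<open>
  The values of the functions. Any group of order \<open>p\<close> would do; it lives inside a commutative ring only so
  that natural numbers can act on it by multiplication.
\<close>

locale prime_torsion =
  fixes p :: nat and G :: "'g::comm_ring_1 set"
  assumes prime: "Factorial_Ring.prime p"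
    and subgroup: "add_subgroup G"
    and card: "card G = p"
    and torsion: "g \<in> G \<Longrightarrow> of_nat p * g = 0"
begin

lemma p_gt_1: "p > 1" using prime prime_gt_1_nat by blast


lemmas G_simps = add_subgroupD[OF subgroup]

lemma G_sum: "(\<And>i. i \<in> I \<Longrightarrow> f i \<in> G) \<Longrightarrow> sum f I \<in> G"
  by (induction I rule: infinite_finite_induct) (auto simp: G_simps)

lemma G_of_nat: "g \<in> G \<Longrightarrow> of_nat c * g \<in> G"
  by (induction c) (auto simp: G_simps algebra_simps)

definition V :: "'i set \<Rightarrow> ('i \<Rightarrow> nat) \<Rightarrow> (('i \<Rightarrow> nat) \<Rightarrow> 'g) set"
  where "V I a = {f. (\<forall>m. f m \<in> G) \<and> (\<forall>m. m \<notin> box I a \<longrightarrow> f m = 0)}"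

lemma V_subgroup: "add_subgroup (V I a)"
  by (auto simp: add_subgroup_def V_def G_simps)

lemma V_of_nat: "f \<in> V I a \<Longrightarrow> of_nat c * f \<in> V I a"
  by (auto simp: V_def G_of_nat)

lemma bij_V_PiE: "bij_betw (\<lambda>f. restrict f (box I a)) (V I a) (box I a \<rightarrow>\<^sub>E G)"
  by (rule bij_betw_byWitness[where f' = "\<lambda>f m. if m \<in> box I a then f m else 0"])
    (auto simp: V_def fun_eq_iff PiE_def extensional_def Pi_def G_simps)

lemma card_V: "finite I \<Longrightarrow> card (V I a) = p ^ (\<Prod>i\<in>I. a i)"
  using bij_betw_same_card[OF bij_V_PiE[of I a]]
  by (simp add: card_PiE finite_box card card_box)

lemma finite_V: "finite I \<Longrightarrow> finite (V I a)"
  using card_V[of I a] p_gt_1 by (simp add: card_ge_0_finite)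

lemma shift_sum_V: "J \<subseteq> I \<Longrightarrow> f \<in> V I a \<Longrightarrow> shift_sum d J f \<in> V I a"
  unfolding V_def shift_sum_def mem_Collect_eq
proof (intro conjI allI impI, goal_cases)
  case (1 m)
  then show ?case by (auto intro: G_sum)
next
  case (2 m)
  have "m(i := m i + d i) \<notin> box I a" if "i \<in> J" for i
  proof
    assume h: "m(i := m i + d i) \<in> box I a"
    have "m \<in> box I a" unfolding box_def mem_Collect_eq
    proof (intro conjI ballI allI impI)
      fix k assume "k \<in> I"
      then have "(m(i := m i + d i)) k < a k" using h by (auto simp: box_def)
      then show "m k < a k" by (auto split: if_splits)
    next
      fix k assume "k \<notin> I"
      moreover have "k \<noteq> i" using calculation that 2 by auto
      ultimately show "m k = 0" using h unfolding box_def by force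
    qed
    with 2 show False by blast
  qed
  with 2 show ?case by (auto intro!: sum.neutral)
qed

lemma shift_sum_pow_V: "J \<subseteq> I \<Longrightarrow> f \<in> V I a \<Longrightarrow> (shift_sum d J ^^ n) f \<in> V I a"
  by (induction n) (auto simp: shift_sum_V)

definition ker_pow :: "('i \<Rightarrow> nat) \<Rightarrow> 'i set \<Rightarrow> ('i \<Rightarrow> nat) \<Rightarrow> nat \<Rightarrow> (('i \<Rightarrow> nat) \<Rightarrow> 'g) set"
  where "ker_pow d I a n = {f \<in> V I a. (shift_sum d I ^^ n) f = 0}"

abbreviation unit_ker_pow :: "'i set \<Rightarrow> ('i \<Rightarrow> nat) \<Rightarrow> nat \<Rightarrow> (('i \<Rightarrow> nat) \<Rightarrow> 'g) set"
  where "unit_ker_pow \<equiv> ker_pow (\<lambda>_. 1)"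

lemma ker_pow_subgroup: "add_subgroup (ker_pow d I a n)"
  unfolding ker_pow_def by (rule add_subgroup_kernel[OF V_subgroup]) (rule shift_sum_pow_diff)

lemma finite_ker_pow: "finite I \<Longrightarrow> finite (ker_pow d I a n)"
  by (simp add: ker_pow_def finite_V)

lemma card_ker_pow_pos: "finite I \<Longrightarrow> card (ker_pow d I a n) > 0"
  using add_subgroupD(1)[OF ker_pow_subgroup, of d I a n] finite_ker_pow[of I d a n]
  by (auto simp: card_gt_0_iff)

lemma V_cong: "(\<And>i. i \<in> I \<Longrightarrow> a i = b i) \<Longrightarrow> V I a = V I b"
  by (simp add: V_def box_def cong: conj_cong ball_cong)

lemma ker_pow_cong: "(\<And>i. i \<in> I \<Longrightarrow> a i = b i) \<Longrightarrow> ker_pow d I a n = ker_pow d I b n"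
  using V_cong[of I a b] by (simp add: ker_pow_def)

lemma box_insert_upd0:
  "m \<in> box (insert j I) a \<longleftrightarrow> m j < a j \<and> m(j := 0) \<in> box I a" if "j \<notin> I"
  using that by (auto simp: box_def)


lemma V_upd_zero: "j \<notin> I \<Longrightarrow> g \<in> V I a \<Longrightarrow> m j \<noteq> 0 \<Longrightarrow> g m = 0"
  by (auto simp: V_def box_def)

lemma shift_sum_insert:
  assumes "finite I" "j \<notin> I"
  shows "shift_sum d (insert j I) f m = f (m(j := m j + d j)) + shift_sum d I f m"
  using assms by (simp add: shift_sum_def)

text \<open>
  Adding a coordinate \<open>j\<close> to the box is tensoring with \<open>k[y]/(y^{a_j})\<close>. A function killed by \<open>y + T\<close> is
  determined by its values at \<open>m j = 0\<close>, since raising \<open>m j\<close> by one amounts to applying \<open>-T\<close>; and it vanishes from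
  \<open>m j = a j\<close> on exactly when \<open>T^{a j}\<close> kills the restriction. So \<open>D\<close> is expressed by the kernels of powers of
  \<open>T\<close> in one variable less, which all the functional equations below exploit.
\<close>

lemma card_ker_insert:
  assumes I: "finite I" "j \<notin> I"
  shows "card (unit_ker_pow (insert j I) a 1) = card (unit_ker_pow I a (a j))"
proof -
  let ?T = "unit_shift_sum I"
  define sl where "sl = (\<lambda>f m. if m j = (0::nat) then f m else (0::'g))"
  define ex where "ex = (\<lambda>g m. (-1) ^ m j * (?T ^^ m j) g (m(j := 0)) :: 'g)"
  have sgn: "(-1) ^ k * x \<in> G" if "x \<in> G" for k :: nat and x
    using that by (induction k) (auto simp: G_simps)
  have Tupd: "?T f (m(j := c)) = (\<Sum>i\<in>I. f (m(i := m i + 1, j := c)))" for f c m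
    unfolding shift_sum_def using I(2) by (intro sum.cong) (auto simp: fun_upd_twist)
  have "bij_betw sl (unit_ker_pow (insert j I) a 1) (unit_ker_pow I a (a j))"
  proof (rule bij_betw_byWitness[where f' = ex])
    have A: "f m = ex (sl f) m" if f: "f \<in> unit_ker_pow (insert j I) a 1" for f m
    proof -
      have rec: "f (m(j := m j + 1)) = - (\<Sum>i\<in>I. f (m(i := m i + 1)))" for m
        using f shift_sum_insert[OF I, of "\<lambda>_. 1" f m]
        by (simp add: ker_pow_def shift_sum_def eq_neg_iff_add_eq_0)
      show ?thesis
        unfolding ex_def
      proof (induction "m j" arbitrary: m)
        case 0
        then have "m(j := 0) = m" by auto
        with 0 show ?case by (simp add: sl_def)
      next
        case (Suc k)
        let ?m = "m(j := k)"
        have "f m = - (\<Sum>i\<in>I. f (?m(i := ?m i + 1)))"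
          using rec[of ?m] Suc(2) by (auto simp: fun_upd_idem)
        also have "(\<Sum>i\<in>I. f (?m(i := ?m i + 1)))
            = (\<Sum>i\<in>I. (-1) ^ k * (?T ^^ k) (sl f) (m(i := m i + 1, j := 0)))"
        proof (rule sum.cong[OF refl], goal_cases)
          case (1 i)
          then have ij: "i \<noteq> j" using I by auto
          have "f (?m(i := ?m i + 1)) = (-1) ^ k * (?T ^^ k) (sl f) ((?m(i := ?m i + 1))(j := 0))"
            using Suc(1)[of "?m(i := ?m i + 1)"] ij by simp
          also have "(?m(i := ?m i + 1))(j := 0) = m(i := m i + 1, j := 0)" using ij by auto
          finally show ?case .
        qed
        also have "- \<dots> = (-1) ^ Suc k * (?T ^^ Suc k) (sl f) (m(j := 0))"
          using Tupd[of "(?T ^^ k) (sl f)" m 0] by (simp add: sum_distrib_left sum_negf)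
        finally show ?case using Suc(2) by simp
      qed
    qed
    then show "\<forall>f\<in>unit_ker_pow (insert j I) a 1. ex (sl f) = f" by auto
    show "\<forall>g\<in>unit_ker_pow I a (a j). sl (ex g) = g"
    proof
      fix g assume g: "g \<in> unit_ker_pow I a (a j)"
      show "sl (ex g) = g"
      proof
        fix m
        show "sl (ex g) m = g m"
        proof (cases "m j = 0")
          case True
          then have "m(j := 0) = m" by auto
          with True show ?thesis by (simp add: sl_def ex_def)
        next
          case False
          then show ?thesis using g I(2) V_upd_zero[of j I g a m] by (simp add: sl_def ker_pow_def)
        qed
      qed
    qed
    show "sl ` unit_ker_pow (insert j I) a 1 \<subseteq> unit_ker_pow I a (a j)"
    proof
      fix g assume "g \<in> sl ` unit_ker_pow (insert j I) a 1"
      then obtain f where f: "f \<in> unit_ker_pow (insert j I) a 1" "g = sl f" by auto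
      have gV: "g \<in> V I a"
        unfolding V_def mem_Collect_eq
      proof (intro conjI allI impI)
        show "g m \<in> G" for m using f by (auto simp: sl_def ker_pow_def V_def G_simps)
        fix m assume m: "m \<notin> box I a"
        show "g m = 0"
        proof (cases "m j = 0")
          case True
          then have "m(j := 0) = m" by auto
          then have "m \<notin> box (insert j I) a" using m box_insert_upd0[OF I(2), of m a] by simp
          then show ?thesis using f by (auto simp: sl_def ker_pow_def V_def)
        qed (use f in \<open>simp add: sl_def\<close>)
      qed
      have "(?T ^^ a j) g m = 0" for m
      proof (cases "m j = 0")
        case True
        have "f (m(j := a j)) = 0" using f by (auto simp: ker_pow_def V_def box_def)
        then have "(-1) ^ a j * (?T ^^ a j) g m = 0"
          using A[OF f(1), of "m(j := a j)"] f(2) True by (simp add: ex_def fun_upd_idem)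
        then have "(-1) ^ a j * ((-1) ^ a j * (?T ^^ a j) g m) = 0" by simp
        then show ?thesis by (simp flip: mult.assoc power_add mult_2)
      next
        case False
        then show ?thesis using V_upd_zero[OF I(2) shift_sum_pow_V[OF subset_refl gV]] by blast
      qed
      then show "g \<in> unit_ker_pow I a (a j)" using gV by (auto simp: ker_pow_def)
    qed
    show "ex ` unit_ker_pow I a (a j) \<subseteq> unit_ker_pow (insert j I) a 1"
    proof
      fix f assume "f \<in> ex ` unit_ker_pow I a (a j)"
      then obtain g where g: "g \<in> unit_ker_pow I a (a j)" "f = ex g" by auto
      then have gV: "g \<in> V I a" by (simp add: ker_pow_def)
      have TV: "(?T ^^ k) g \<in> V I a" for k by (rule shift_sum_pow_V[OF subset_refl gV])
      have "f \<in> V (insert j I) a"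
        unfolding V_def mem_Collect_eq
      proof (intro conjI allI impI)
        show "f m \<in> G" for m using TV by (auto simp: g(2) ex_def V_def intro!: sgn)
        fix m assume "m \<notin> box (insert j I) a"
        then consider "m(j := 0) \<notin> box I a" | "m j \<ge> a j"
          using box_insert_upd0[OF I(2), of m a] by force
        then show "f m = 0"
        proof cases
          case 1
          then show ?thesis using TV[of "m j"] by (simp add: g(2) ex_def V_def)
        next
          case 2
          then have "(?T ^^ m j) g = (?T ^^ (m j - a j)) ((?T ^^ a j) g)"
            by (metis comp_apply funpow_add le_add_diff_inverse2)
          also have "\<dots> = 0" using g by (simp add: ker_pow_def shift_sum_pow_zero)
          finally show ?thesis by (simp add: g(2) ex_def)
        qed
      qed
      moreover have "unit_shift_sum (insert j I) f m = 0" for m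
      proof -
        have "(\<Sum>i\<in>I. f (m(i := m i + 1)))
            = (\<Sum>i\<in>I. (-1) ^ m j * (?T ^^ m j) g (m(i := m i + 1, j := 0)))"
          by (rule sum.cong[OF refl]) (use I in \<open>auto simp: g(2) ex_def\<close>)
        also have "\<dots> = (-1) ^ m j * (?T ^^ Suc (m j)) g (m(j := 0))"
          using Tupd[of "(?T ^^ m j) g" m 0] by (simp add: sum_distrib_left)
        also have "\<dots> = - f (m(j := m j + 1))" by (simp add: g(2) ex_def)
        finally show ?thesis using shift_sum_insert[OF I, of "\<lambda>_. 1" f m] by (simp add: shift_sum_def)
      qed
      ultimately show "f \<in> unit_ker_pow (insert j I) a 1" by (auto simp: ker_pow_def)
    qed
  qed
  then show ?thesis by (rule bij_betw_same_card)
qed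


text \<open>
  This is the decomposition of \<open>k[T]/(T^2) \<otimes> k[T]/(T^n)\<close> into \<open>k[T]/(T^{n-1})\<close> and \<open>k[T]/(T^{n+1})\<close>, valid
  for \<open>p\<close> not dividing \<open>n\<close>, in terms of kernels. On pairs \<open>(u, v)\<close> the operator \<open>(y + T)^n\<close> with \<open>y^2 = 0\<close> is
  \<open>(T^n u + n T^{n-1} v, T^n v)\<close>. In the variables \<open>w = T u + n v\<close> and \<open>u\<close> its kernel is given by the independent
  conditions \<open>T^{n-1} w = 0\<close> and \<open>T^{n+1} u = 0\<close>, and \<open>v\<close> is recovered from \<open>w\<close> and \<open>u\<close> because \<open>n\<close> is invertible
  modulo \<open>p\<close>.
\<close>

lemma card_ker_insert_two:
  assumes I: "finite I" "j \<notin> I" and n: "n > 0" "\<not> p dvd n"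
  shows "card (unit_ker_pow (insert j I) (a(j := 2)) n)
    = card (unit_ker_pow I a (n - 1)) * card (unit_ker_pow I a (n + 1))"
proof -
  let ?T = "unit_shift_sum I" and ?T' = "unit_shift_sum (insert j I)"
  define comb :: "(('a \<Rightarrow> nat) \<Rightarrow> 'g) \<Rightarrow> (('a \<Rightarrow> nat) \<Rightarrow> 'g) \<Rightarrow> ('a \<Rightarrow> nat) \<Rightarrow> 'g"
    where "comb = (\<lambda>u v m. if m j = 0 then u m else if m j = 1 then v (m(j := 0)) else 0)"
  have Tupd: "?T f (m(j := c)) = (\<Sum>i\<in>I. f (m(i := m i + 1, j := c)))" for f c m
    unfolding shift_sum_def using I(2) by (intro sum.cong) (auto simp: fun_upd_twist)
  have T_comb: "?T' (comb u v) = comb (?T u + v) (?T v)" for u v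
  proof
    fix m
    have *: "?T' (comb u v) m = comb u v (m(j := m j + 1)) + (\<Sum>i\<in>I. comb u v (m(i := m i + 1)))"
      using shift_sum_insert[OF I, of "\<lambda>_. 1" "comb u v" m] by (simp add: shift_sum_def)
    consider "m j = 0" | "m j = 1" | "m j > 1" by linarith
    then show "?T' (comb u v) m = comb (?T u + v) (?T v) m"
    proof cases
      case 1
      then have "m(j := 0) = m" by auto
      moreover have "(\<Sum>i\<in>I. comb u v (m(i := m i + 1))) = ?T u m"
        unfolding shift_sum_def by (rule sum.cong) (use 1 I in \<open>auto simp: comb_def\<close>)
      ultimately show ?thesis unfolding * using 1 by (simp add: comb_def)
    next
      case 2
      moreover have "(\<Sum>i\<in>I. comb u v (m(i := m i + 1))) = ?T v (m(j := 0))"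
        unfolding Tupd by (rule sum.cong) (use 2 I in \<open>auto simp: comb_def\<close>)
      ultimately show ?thesis unfolding * by (simp add: comb_def)
    next
      case 3
      moreover have "(\<Sum>i\<in>I. comb u v (m(i := m i + 1))) = 0"
        by (rule sum.neutral) (use 3 I in \<open>auto simp: comb_def\<close>)
      ultimately show ?thesis unfolding * by (simp add: comb_def)
    qed
  qed
  have Tn_comb: "(?T' ^^ n) (comb u v) = comb ((?T ^^ n) u + of_nat n * (?T ^^ (n - 1)) v) ((?T ^^ n) v)"
    for u v n
  proof (induction n)
    case (Suc n)
    have "of_nat n * ?T ((?T ^^ (n - 1)) v) = of_nat n * (?T ^^ n) v" by (cases n) auto
    then have "?T ((?T ^^ n) u + of_nat n * (?T ^^ (n - 1)) v) + (?T ^^ n) v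
        = (?T ^^ Suc n) u + of_nat (Suc n) * (?T ^^ n) v"
      unfolding shift_sum_add shift_sum_of_nat by (simp add: algebra_simps)
    then show ?case by (simp only: funpow.simps comp_apply Suc T_comb diff_Suc_1)
  qed simp
  have comb_0: "comb u v = 0 \<longleftrightarrow> u = 0 \<and> v = 0" if "u \<in> V I a" "v \<in> V I a" for u v
  proof
    assume c: "comb u v = 0"
    have "u m = 0" for m
      using V_upd_zero[OF I(2) that(1), of m] fun_cong[OF c, of m] by (auto simp: comb_def split: if_splits)
    moreover have "v m = 0" for m
    proof (cases "m j = 0")
      case True
      then have "m(j := 0) = m" by auto
      then show ?thesis using fun_cong[OF c, of "m(j := 1)"] by (simp add: comb_def)
    qed (use V_upd_zero[OF I(2) that(2), of m] in auto)
    ultimately show "u = 0 \<and> v = 0" by auto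
  qed (auto simp: comb_def)
  have comb_diff: "comb u v - comb u' v' = comb (u - u') (v - v')" for u v u' v'
    by (auto simp: comb_def)
  have comb_V: "comb u v \<in> V (insert j I) (a(j := 2))" if "u \<in> V I a" "v \<in> V I a" for u v
  proof -
    have "comb u v m = 0" if m: "m \<notin> box (insert j I) (a(j := 2))" for m
    proof -
      consider "m j \<ge> 2" | "m j < 2" "m(j := 0) \<notin> box I a"
        using m box_insert_upd0[OF I(2), of m "a(j := 2)"] I(2) by (fastforce simp: box_def)
      then show ?thesis
      proof cases
        case 2
        have "m(j := 0) = m" if "m j = 0" using that by auto
        then show ?thesis using 2 \<open>u \<in> V I a\<close> \<open>v \<in> V I a\<close> by (auto simp: comb_def V_def)
      qed (simp add: comb_def)
    qed
    moreover have "comb u v m \<in> G" for m using that by (auto simp: comb_def V_def G_simps)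
    ultimately show ?thesis by (simp add: V_def)
  qed
  define S where "S = {(u, v). u \<in> V I a \<and> v \<in> V I a
      \<and> (?T ^^ n) u + of_nat n * (?T ^^ (n - 1)) v = 0 \<and> (?T ^^ n) v = 0}"
  have TV: "(?T ^^ k) u \<in> V I a" if "u \<in> V I a" for u k
    by (rule shift_sum_pow_V[OF subset_refl that])
  note VD = add_subgroupD[OF V_subgroup[of I a]] V_of_nat[of _ I a]
  have "bij_betw (\<lambda>(u, v). comb u v) S (unit_ker_pow (insert j I) (a(j := 2)) n)"
  proof (rule bij_betwI')
    fix x y assume xy: "x \<in> S" "y \<in> S"
    obtain u v u' v' where uv: "x = (u, v)" "y = (u', v')" by (cases x, cases y) auto
    have "comb u v - comb u' v' = 0 \<longleftrightarrow> u - u' = 0 \<and> v - v' = 0"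
      unfolding comb_diff by (rule comb_0) (use xy uv VD in \<open>auto simp: S_def\<close>)
    then show "(case x of (u, v) \<Rightarrow> comb u v) = (case y of (u, v) \<Rightarrow> comb u v) \<longleftrightarrow> x = y"
      unfolding uv by simp
  next
    fix x assume "x \<in> S"
    then obtain u v where x: "x = (u, v)" "u \<in> V I a" "v \<in> V I a"
        "(?T ^^ n) u + of_nat n * (?T ^^ (n - 1)) v = 0" "(?T ^^ n) v = 0" by (auto simp: S_def)
    show "(case x of (u, v) \<Rightarrow> comb u v) \<in> unit_ker_pow (insert j I) (a(j := 2)) n"
      unfolding x(1) ker_pow_def using comb_V[OF x(2,3)] Tn_comb[of n u v]
        comb_0[OF VD(1) VD(1)] by (simp only: x(4,5)) simp
  next
    fix f assume f: "f \<in> unit_ker_pow (insert j I) (a(j := 2)) n"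
    then have fV: "f \<in> V (insert j I) (a(j := 2))" by (simp add: ker_pow_def)
    define u where "u = (\<lambda>m. if m j = 0 then f m else 0)"
    define v where "v = (\<lambda>m. if m j = 0 then f (m(j := 1)) else 0)"
    have a: "box I (a(j := 2)) = box I a" using I(2) by (auto simp: box_def)
    have uV: "u \<in> V I a"
      unfolding V_def mem_Collect_eq
    proof (intro conjI allI impI)
      show "u m \<in> G" for m using fV by (simp add: u_def V_def G_simps)
      fix m assume m: "m \<notin> box I a"
      have "m(j := 0) = m" if "m j = 0" using that by auto
      then show "u m = 0" using m fV box_insert_upd0[OF I(2), of m "a(j := 2)"] a
        by (auto simp: u_def V_def)
    qed
    have vV: "v \<in> V I a"
      unfolding V_def mem_Collect_eq
    proof (intro conjI allI impI)
      show "v m \<in> G" for m using fV by (simp add: v_def V_def G_simps)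
      fix m assume m: "m \<notin> box I a"
      have "m(j := 0) = m" if "m j = 0" using that by auto
      then show "v m = 0" using m fV box_insert_upd0[OF I(2), of "m(j := 1)" "a(j := 2)"] a
        by (auto simp: v_def V_def)
    qed
    have fc: "f = comb u v"
    proof
      fix m
      have "f m = 0" if "m j > 1" using fV that by (auto simp: V_def box_def)
      moreover have "m(j := 1) = m" if "m j = 1" using that by auto
      ultimately show "f m = comb u v m" by (auto simp: comb_def u_def v_def)
    qed
    have V1: "(?T ^^ n) u + of_nat n * (?T ^^ (n - 1)) v \<in> V I a" "(?T ^^ n) v \<in> V I a"
      by (intro VD TV uV vV)+
    have "(?T' ^^ n) (comb u v) = 0" using f unfolding fc[symmetric] by (simp add: ker_pow_def)
    then have "comb ((?T ^^ n) u + of_nat n * (?T ^^ (n - 1)) v) ((?T ^^ n) v) = 0"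
      unfolding Tn_comb .
    then have "(u, v) \<in> S" using uV vV comb_0[OF V1] by (simp add: S_def)
    moreover have "f = (case (u, v) of (u, v) \<Rightarrow> comb u v)" using fc by simp
    ultimately show "\<exists>x\<in>S. f = (case x of (u, v) \<Rightarrow> comb u v)" by blast
  qed
  then have c1: "card (unit_ker_pow (insert j I) (a(j := 2)) n) = card S"
    by (simp add: bij_betw_same_card)
  have "coprime n p" using n prime by (metis coprime_commute prime_imp_coprime)
  \<comment> \<open>Multiplication by \<open>b\<close> inverts multiplication by \<open>n\<close> on all values.\<close>
  then obtain b where "[n * b = 1] (mod p)" using cong_solve_coprime_nat by auto
  then have "n * b mod p = 1" using p_gt_1 by (simp add: cong_def)
  then have nb: "n * b = (n * b div p) * p + 1" by (metis div_mult_mod_eq)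
  have inv_nat: "of_nat n * (of_nat b * x) = x" if "x \<in> V I a" for x
  proof
    fix m
    have "of_nat p * x m = 0" using that torsion by (simp add: V_def)
    moreover have "(of_nat (n * b) :: 'g) = of_nat (n * b div p) * of_nat p + 1"
      by (metis nb of_nat_add of_nat_mult of_nat_1)
    ultimately have "of_nat (n * b) * x m = x m" by (simp add: distrib_right mult.assoc)
    then show "(of_nat n * (of_nat b * x)) m = x m" by (simp add: mult.assoc)
  qed
  have inv_nat': "of_nat b * (of_nat n * x) = x" if "x \<in> V I a" for x
    using inv_nat[OF that] by (metis mult.left_commute)
  have Tn: "?T ((?T ^^ (n - 1)) x) = (?T ^^ n) x" "(?T ^^ (n - 1)) (?T x) = (?T ^^ n) x"
    "?T ((?T ^^ n) x) = (?T ^^ (n + 1)) x" "(?T ^^ n) (?T x) = (?T ^^ (n + 1)) x" for x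
  proof -
    obtain k where "n = Suc k" using n by (cases n) auto
    then show "?T ((?T ^^ (n - 1)) x) = (?T ^^ n) x" "(?T ^^ (n - 1)) (?T x) = (?T ^^ n) x"
      by (auto simp: funpow_swap1)
  qed (auto simp: funpow_swap1)
  have "bij_betw (\<lambda>(u, v). (?T u + of_nat n * v, u)) S
      (unit_ker_pow I a (n - 1) \<times> unit_ker_pow I a (n + 1))"
  proof (rule bij_betw_byWitness[where f' = "\<lambda>(w, u). (u, of_nat b * (w - ?T u))"])
    show "\<forall>x\<in>S. (case case x of (u, v) \<Rightarrow> (?T u + of_nat n * v, u) of (w, u) \<Rightarrow> (u, of_nat b * (w - ?T u))) = x"
      by (auto simp only: S_def split: prod.splits) (simp add: inv_nat')
    show "\<forall>x\<in>unit_ker_pow I a (n - 1) \<times> unit_ker_pow I a (n + 1).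
        (case case x of (w, u) \<Rightarrow> (u, of_nat b * (w - ?T u)) of (u, v) \<Rightarrow> (?T u + of_nat n * v, u)) = x"
    proof (rule ballI)
      fix x assume "x \<in> unit_ker_pow I a (n - 1) \<times> unit_ker_pow I a (n + 1)"
      then obtain w u where x: "x = (w, u)" "w \<in> V I a" "u \<in> V I a" by (auto simp: ker_pow_def)
      have "w - ?T u \<in> V I a" using VD TV[of u 1] x by simp
      then show "(case case x of (w, u) \<Rightarrow> (u, of_nat b * (w - ?T u)) of (u, v) \<Rightarrow> (?T u + of_nat n * v, u)) = x"
        using inv_nat[of "w - ?T u"] x(1) by simp
    qed
    show "(\<lambda>(u, v). (?T u + of_nat n * v, u)) ` S \<subseteq> unit_ker_pow I a (n - 1) \<times> unit_ker_pow I a (n + 1)"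
    proof clarify
      fix u v assume "(u, v) \<in> S"
      then have uv: "u \<in> V I a" "v \<in> V I a" "(?T ^^ n) u + of_nat n * (?T ^^ (n - 1)) v = 0"
        "(?T ^^ n) v = 0" by (auto simp: S_def)
      have "(?T ^^ (n - 1)) (?T u + of_nat n * v) = 0"
        unfolding shift_sum_pow_add shift_sum_pow_of_nat Tn using uv by simp
      moreover have "?T ((?T ^^ n) u + of_nat n * (?T ^^ (n - 1)) v) = 0"
        unfolding uv(3) by (rule shift_sum_zero)
      then have "(?T ^^ (n + 1)) u = 0"
        unfolding shift_sum_add shift_sum_of_nat Tn uv(4) by simp
      moreover have "?T u + of_nat n * v \<in> V I a" by (intro VD(4,5) uv) (use TV[OF uv(1), of 1] in simp)
      ultimately show "?T u + of_nat n * v \<in> unit_ker_pow I a (n - 1) \<and> u \<in> unit_ker_pow I a (n + 1)"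
        using uv by (simp add: ker_pow_def)
    qed
    show "(\<lambda>(w, u). (u, of_nat b * (w - ?T u))) ` (unit_ker_pow I a (n - 1) \<times> unit_ker_pow I a (n + 1)) \<subseteq> S"
    proof clarify
      fix w u assume "w \<in> unit_ker_pow I a (n - 1)" "u \<in> unit_ker_pow I a (n + 1)"
      then have wu: "w \<in> V I a" "u \<in> V I a" "(?T ^^ (n - 1)) w = 0" "(?T ^^ (n + 1)) u = 0"
        by (auto simp: ker_pow_def)
      have D: "w - ?T u \<in> V I a" using VD TV[of u 1] wu by simp
      have "(?T ^^ n) w = 0" using Tn(1)[of w] wu(3) by (simp add: shift_sum_zero)
      then have "(?T ^^ n) (of_nat b * (w - ?T u)) = 0"
        unfolding shift_sum_pow_of_nat shift_sum_pow_diff Tn wu(4) by simp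
      moreover have "(?T ^^ n) u + of_nat n * (?T ^^ (n - 1)) (of_nat b * (w - ?T u)) = 0"
        unfolding shift_sum_pow_of_nat inv_nat[OF TV[OF D]]
        unfolding shift_sum_pow_diff Tn wu(3) by simp
      ultimately show "(u, of_nat b * (w - ?T u)) \<in> S" using wu(2) VD(5)[OF D] by (simp add: S_def)
    qed
  qed
  then have "card S = card (unit_ker_pow I a (n - 1)) * card (unit_ker_pow I a (n + 1))"
    by (simp add: bij_betw_same_card card_cartesian_product)
  with c1 show ?thesis by simp
qed


section \<open>The logarithmic kernel size and its functional equations\<close>

text \<open>
  The dimension of \<open>k[y\<^sub>i | i \<in> I]/(y\<^sub>i^{a\<^sub>i}, \<Sum>\<^sub>i y\<^sub>i)\<close>, equivalently the number of Jordan blocks of the nilpotent operator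
  \<open>\<Sum>\<^sub>i y\<^sub>i\<close> on the algebra without the last relation.
\<close>

definition D :: "'i set \<Rightarrow> ('i \<Rightarrow> nat) \<Rightarrow> real"
  where "D I a = log p (card (unit_ker_pow I a 1))"

lemma D_cong: "(\<And>i. i \<in> I \<Longrightarrow> a i = b i) \<Longrightarrow> D I a = D I b"
  using ker_pow_cong[of I a b] by (simp add: D_def)

lemma D_insert:
  "finite I \<Longrightarrow> j \<notin> I \<Longrightarrow> D (insert j I) a = log p (card (unit_ker_pow I a (a j)))"
  by (simp only: D_def card_ker_insert not_False_eq_True)

lemma log_p_power: "log (real p) (real (p ^ n)) = real n"
  using p_gt_1 by (simp add: log_nat_power)

lemma D_empty: "D {} a = 1"
proof -
  have "unit_ker_pow {} a 1 = V {} a" by (auto simp: ker_pow_def shift_sum_def)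
  then show ?thesis using log_p_power[of 1] by (simp add: D_def card_V)
qed

lemma D_insert_zero: "finite I \<Longrightarrow> j \<notin> I \<Longrightarrow> a j = 0 \<Longrightarrow> D (insert j I) a = 0"
proof -
  assume "finite I" "j \<notin> I" "a j = 0"
  moreover have "unit_ker_pow I a 0 = {0}"
    using add_subgroupD(1)[OF V_subgroup] by (auto simp: ker_pow_def)
  ultimately show ?thesis by (simp add: D_insert)
qed

lemma D_insert_one: "finite I \<Longrightarrow> j \<notin> I \<Longrightarrow> a j = 1 \<Longrightarrow> D (insert j I) a = D I a"
  by (simp add: D_insert) (simp add: D_def)

lemma D_insert_succ_add_pred:
  assumes "finite I" "j \<notin> I" "l \<notin> insert j I" "n > 0" "\<not> p dvd n"
  shows "D (insert j I) (a(j := n + 1)) + D (insert j I) (a(j := n - 1))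
    = D (insert l (insert j I)) (a(l := 2, j := n))"
proof -
  have lI: "l \<notin> I" and jl: "j \<notin> insert l I" using assms by auto
  have c: "unit_ker_pow I (a(j := x)) y = unit_ker_pow I a y" for x y
    by (rule ker_pow_cong) (use assms in auto)
  have c': "unit_ker_pow (insert l I) (a(l := 2, j := x)) y = unit_ker_pow (insert l I) (a(l := 2)) y" for x y
    by (rule ker_pow_cong) (use assms in auto)
  have "D (insert l (insert j I)) (a(l := 2, j := n))
      = log p (card (unit_ker_pow (insert l I) (a(l := 2)) n))"
    using D_insert[of "insert l I" j "a(l := 2, j := n)"] assms jl c' by (simp add: insert_commute)
  also have "\<dots> = log p (card (unit_ker_pow I a (n - 1))) + log p (card (unit_ker_pow I a (n + 1)))"
    unfolding card_ker_insert_two[OF assms(1) lI assms(4,5)]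
    using card_ker_pow_pos[OF assms(1)] p_gt_1 by (simp add: log_mult)
  finally show ?thesis using assms by (simp add: D_insert c del: One_nat_def)
qed

text \<open>
  Both sides equal the value of \<open>D\<close> on the box with an additional side of length 2, and that value is
  symmetric in the two coordinates. The additional side needs a fresh index, hence an infinite index type.
\<close>

lemma D_discrete_wave_equation:
  assumes I: "finite I" "infinite (UNIV :: 'i set)" "(j::'i) \<notin> I" "k \<notin> I" "j \<noteq> k"
    and xy: "0 < x" "x < p" "0 < y" "y < p"
  shows "D (insert j (insert k I)) (a(j := x + 1, k := y)) + D (insert j (insert k I)) (a(j := x - 1, k := y))
    = D (insert j (insert k I)) (a(j := x, k := y + 1)) + D (insert j (insert k I)) (a(j := x, k := y - 1))"
proof -
  obtain l where l: "l \<notin> insert j (insert k I)"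
    using ex_new_if_finite[OF I(2), of "insert j (insert k I)"] I(1) by auto
  have nd: "\<not> p dvd x" "\<not> p dvd y" using xy by (auto dest: dvd_imp_le)
  have "D (insert j (insert k I)) (a(j := x + 1, k := y)) + D (insert j (insert k I)) (a(j := x - 1, k := y))
    = D (insert l (insert j (insert k I))) (a(k := y, l := 2, j := x))"
    using D_insert_succ_add_pred[of "insert k I" j l x "a(k := y)"] I l xy nd
    by (simp add: fun_upd_twist)
  also have "\<dots> = D (insert l (insert k (insert j I))) (a(j := x, l := 2, k := y))"
    using I l by (simp add: insert_commute fun_upd_twist)
  also have "\<dots> = D (insert j (insert k I)) (a(j := x, k := y + 1)) + D (insert j (insert k I)) (a(j := x, k := y - 1))"
    using D_insert_succ_add_pred[of "insert j I" k l y "a(j := x)"] I l xy nd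
    by (simp add: insert_commute)
  finally show ?thesis .
qed

lemma shift_sum_pow_single: "(shift_sum d {j} ^^ n) f m = f (m(j := m j + n * d j))"
  by (induction n arbitrary: m) (auto simp: shift_sum_def add.assoc)

text \<open>
  The Frobenius identity \<open>(\<Sum>\<^sub>i y\<^sub>i)^p = \<Sum>\<^sub>i y\<^sub>i^p\<close>: the inner binomial coefficients are divisible by \<open>p\<close>, which kills all
  values.
\<close>

lemma shift_sum_frobenius:
  assumes "finite I" "\<And>m. f m \<in> G"
  shows "(unit_shift_sum I ^^ p) f = shift_sum (\<lambda>_. p) I f"
  using assms(1)
proof (induction I)
  case empty
  have "(unit_shift_sum {} ^^ Suc n) f = 0" for n by (simp add: shift_sum_def fun_eq_iff)
  from this[of "p - 1"] have "(unit_shift_sum {} ^^ p) f = 0" using p_gt_1 by simp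
  moreover have "shift_sum (\<lambda>_. p) {} f = 0" by (simp add: shift_sum_def fun_eq_iff)
  ultimately show ?case by simp
next
  case (insert j I)
  let ?A = "unit_shift_sum {j}" and ?B = "unit_shift_sum I"
  have AB: "?A (?B h) = ?B (?A h)" for h :: "('a \<Rightarrow> nat) \<Rightarrow> 'g"
    using insert(2) by (auto simp: shift_sum_def fun_eq_iff fun_upd_twist intro!: sum.cong)
  have Gpow: "(shift_sum d J ^^ n) h m \<in> G" if "\<And>m. h m \<in> G" for d J n h and m :: "'a \<Rightarrow> nat"
    using that by (induction n arbitrary: m) (auto simp: shift_sum_def intro!: G_sum)
  have "unit_shift_sum (insert j I) = (\<lambda>h :: ('a \<Rightarrow> nat) \<Rightarrow> 'g. ?A h + ?B h)"
    using insert(1,2) by (auto simp: shift_sum_def fun_eq_iff)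
  then have "(unit_shift_sum (insert j I) ^^ p) f = ((\<lambda>h. ?A h + ?B h) ^^ p) f" by (simp only:)
  also have "\<dots> = (\<Sum>k\<le>p. of_nat (p choose k) * (?A ^^ k) ((?B ^^ (p - k)) f))"
    by (rule binomial_commuting_endomorphisms) (rule shift_sum_add AB)+
  also have "\<dots> = (\<Sum>k\<in>{0, p}. of_nat (p choose k) * (?A ^^ k) ((?B ^^ (p - k)) f))"
  proof (rule sum.mono_neutral_right)
    show "\<forall>k\<in>{..p} - {0, p}. of_nat (p choose k) * (?A ^^ k) ((?B ^^ (p - k)) f) = 0"
    proof
      fix k assume k: "k \<in> {..p} - {0, p}"
      then have "p dvd (p choose k)" using prime by (intro dvd_choose_prime) auto
      then obtain c where c: "p choose k = c * p" by (metis dvd_def mult.commute)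
      have "(?A ^^ k) ((?B ^^ (p - k)) f) m \<in> G" for m by (intro Gpow assms)
      then have "of_nat (p choose k) * (?A ^^ k) ((?B ^^ (p - k)) f) m = 0" for m
        unfolding c using torsion by (simp add: mult.assoc)
      then show "of_nat (p choose k) * (?A ^^ k) ((?B ^^ (p - k)) f) = 0" by auto
    qed
  qed auto
  also have "\<dots> = shift_sum (\<lambda>_. p) I f + (?A ^^ p) f"
    using p_gt_1 insert.IH by simp
  also have "\<dots> = shift_sum (\<lambda>_. p) (insert j I) f"
    using insert(1,2) shift_sum_insert[OF insert(1,2), of "\<lambda>_. p" f] shift_sum_pow_single[where d = "\<lambda>_. 1" and n = p and f = f]
    by (auto simp: fun_eq_iff)
  finally show ?case .
qed

text \<open>
  On a box with sides at most \<open>p\<close> every \<open>y\<^sub>i^p\<close> is zero, hence so is \<open>T^p\<close> by the Frobenius identity, and the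
  kernel of \<open>T^p\<close> is everything.
\<close>

lemma D_insert_prime:
  assumes "finite I" "j \<notin> I" "a j = p" "\<And>i. i \<in> I \<Longrightarrow> a i \<le> p"
  shows "D (insert j I) a = real (\<Prod>i\<in>I. a i)"
proof -
  have "(unit_shift_sum I ^^ p) f = 0" if f: "f \<in> V I a" for f
  proof -
    have "f (m(i := m i + p)) = 0" if "i \<in> I" for m i
    proof -
      have "m(i := m i + p) \<notin> box I a"
        using assms(4)[OF that] that by (auto simp: box_def intro!: bexI[of _ i])
      then show ?thesis using f by (simp add: V_def)
    qed
    then have "shift_sum (\<lambda>_. p) I f = 0" by (auto simp: shift_sum_def)
    moreover have "f m \<in> G" for m using f by (auto simp: V_def)
    ultimately show ?thesis using shift_sum_frobenius[OF assms(1)] by metis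
  qed
  then have "unit_ker_pow I a p = V I a" by (auto simp: ker_pow_def)
  then show ?thesis using assms log_p_power by (simp add: D_insert card_V)
qed

text \<open>
  The second bound holds because \<open>T^n\<close> maps the kernel of \<open>T^{n+1}\<close> into the kernel of \<open>T\<close>, with kernel
  that of \<open>T^n\<close>.
\<close>

lemma D_mono_insert:
  assumes "finite I" "j \<notin> I"
  shows "D (insert j I) (a(j := n)) \<le> D (insert j I) (a(j := n + 1))"
    and "D (insert j I) (a(j := n + 1)) \<le> D (insert j I) (a(j := n)) + D I a"
proof -
  let ?T = "unit_shift_sum I"
  let ?c = "\<lambda>n. card (unit_ker_pow I a n)"
  have c: "unit_ker_pow I (a(j := x)) y = unit_ker_pow I a y" for x y
    by (rule ker_pow_cong) (use assms in auto)
  note pos = card_ker_pow_pos[OF assms(1)]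
  have sub: "unit_ker_pow I a n \<subseteq> unit_ker_pow I a (n + 1)"
    by (auto simp: ker_pow_def shift_sum_zero)
  have "?c n \<le> ?c (n + 1)"
    by (rule card_mono[OF finite_ker_pow[OF assms(1)] sub])
  then show "D (insert j I) (a(j := n)) \<le> D (insert j I) (a(j := n + 1))"
    using assms p_gt_1 pos by (simp add: D_insert c log_le_cancel_iff del: One_nat_def)
  have ker: "{f \<in> unit_ker_pow I a (n + 1). (?T ^^ n) f = 0} = unit_ker_pow I a n"
    using sub by (auto simp: ker_pow_def)
  have "(?T ^^ n) ` unit_ker_pow I a (n + 1) \<subseteq> unit_ker_pow I a 1"
    using shift_sum_pow_V[OF subset_refl] by (auto simp: ker_pow_def)
  then have "card ((?T ^^ n) ` unit_ker_pow I a (n + 1)) \<le> ?c 1"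
    by (rule card_mono[OF finite_ker_pow[OF assms(1)]])
  moreover have "?c (n + 1) = ?c n * card ((?T ^^ n) ` unit_ker_pow I a (n + 1))"
    using card_kernel_mult_card_image[of "unit_ker_pow I a (n + 1)" "?T ^^ n",
        OF finite_ker_pow[OF assms(1)] ker_pow_subgroup shift_sum_pow_diff] unfolding ker by simp
  ultimately have "?c (n + 1) \<le> ?c n * ?c 1" by simp
  then have "real (?c (n + 1)) \<le> real (?c n) * real (?c 1)"
    by (metis of_nat_le_iff of_nat_mult)
  then have "log p (?c (n + 1)) \<le> log p (real (?c n) * real (?c 1))"
    using p_gt_1 pos by (subst log_le_cancel_iff) auto
  then show "D (insert j I) (a(j := n + 1)) \<le> D (insert j I) (a(j := n)) + D I a"
    using assms p_gt_1 pos by (simp add: D_insert c log_mult del: One_nat_def) (simp add: D_def)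
qed


lemma D_insert_le_prod:
  assumes "finite I" "j \<notin> I"
  shows "D (insert j I) a \<le> real (\<Prod>i\<in>I. a i)"
proof -
  have "card (unit_ker_pow I a (a j)) \<le> p ^ (\<Prod>i\<in>I. a i)"
    unfolding card_V[OF assms(1), symmetric]
    by (rule card_mono) (use finite_V[OF assms(1)] in \<open>auto simp: ker_pow_def\<close>)
  then have "log p (card (unit_ker_pow I a (a j))) \<le> log p (p ^ (\<Prod>i\<in>I. a i))"
    using card_ker_pow_pos[OF assms(1)] p_gt_1 by (subst log_le_cancel_iff) (auto simp flip: of_nat_power)
  then show ?thesis using assms log_p_power[of "\<Prod>i\<in>I. a i"] by (simp add: D_insert)
qed

lemma D_single_step:
  assumes "finite I" "j \<notin> I"
  shows "\<bar>D (insert j I) (a(j := x)) - D (insert j I) (a(j := y))\<bar> \<le> \<bar>real x - real y\<bar> * D I a"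
proof -
  define g where "g n = D (insert j I) (a(j := n))" for n
  have step: "g n \<le> g (Suc n)" "g (Suc n) \<le> g n + D I a" for n
    using D_mono_insert[OF assms, of a n] by (simp_all add: g_def)
  have up: "g n \<le> g (n + k) \<and> g (n + k) \<le> g n + real k * D I a" for n k
  proof (induction k)
    case (Suc k)
    then show ?case using step[of "n + k"] by (simp add: distrib_right)
  qed simp
  have "\<bar>g x - g y\<bar> \<le> \<bar>real x - real y\<bar> * D I a"
  proof (cases "x \<le> y")
    case True
    then show ?thesis using up[of x "y - x"] by (simp add: of_nat_diff)
  next
    case False
    then show ?thesis using up[of y "x - y"] by (simp add: of_nat_diff)
  qed
  then show ?thesis by (simp only: g_def)
qed

text \<open>
  A change of the coordinate \<open>j\<close> by one costs at most \<open>D\<close> of the remaining coordinates, and that is at most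
  the product of all but one of them, hence at most \<open>q^{s-2}\<close>. The coordinates are changed one after the other.
\<close>

lemma D_lipschitz:
  assumes I: "finite I" "card I \<ge> 2" and ab: "\<And>i. i \<in> I \<Longrightarrow> a i \<le> q" "\<And>i. i \<in> I \<Longrightarrow> b i \<le> q"
  shows "\<bar>D I a - D I b\<bar> \<le> real q ^ (card I - 2) * (\<Sum>i\<in>I. \<bar>real (a i) - real (b i)\<bar>)"
proof -
  have bound: "D (I - {j}) c \<le> real q ^ (card I - 2)" if "j \<in> I" "\<And>i. i \<in> I \<Longrightarrow> c i \<le> q" for j c
  proof -
    have "card (I - {j}) = card I - 1" using that I by simp
    then have "I - {j} \<noteq> {}" using I by (metis One_nat_def card.empty diff_is_0_eq not_less_eq_eq numeral_2_eq_2)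
    then obtain k where k: "k \<in> I - {j}" by blast
    have fin: "finite (I - {j} - {k})" using I by simp
    have "D (insert k (I - {j} - {k})) c \<le> real (\<Prod>i\<in>I - {j} - {k}. c i)"
      by (rule D_insert_le_prod[OF fin]) simp
    also have "(\<Prod>i\<in>I - {j} - {k}. c i) \<le> q ^ card (I - {j} - {k})"
      using prod_mono[of "I - {j} - {k}" c "\<lambda>_. q"] that by simp
    also have "card (I - {j} - {k}) = card I - 2" using k I that by simp
    finally show ?thesis using k by (simp add: insert_absorb)
  qed
  have "\<bar>D I a - D I (\<lambda>i. if i \<in> J then b i else a i)\<bar>
      \<le> real q ^ (card I - 2) * (\<Sum>i\<in>J. \<bar>real (a i) - real (b i)\<bar>)" if "finite J" "J \<subseteq> I" for J
    using that
  proof (induction J)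
    case (insert j J)
    let ?c = "\<lambda>i. if i \<in> J then b i else a i"
    have ins: "insert j (I - {j}) = I" using insert by auto
    have c: "?c = ?c(j := a j)" "(\<lambda>i. if i \<in> insert j J then b i else a i) = ?c(j := b j)"
      using insert by (auto simp: fun_eq_iff)
    have "\<bar>D I ?c - D I (\<lambda>i. if i \<in> insert j J then b i else a i)\<bar>
        \<le> \<bar>real (a j) - real (b j)\<bar> * D (I - {j}) ?c"
      using D_single_step[of "I - {j}" j ?c "a j" "b j"] I(1) unfolding ins c(1)[symmetric] c(2)[symmetric] by simp
    also have "\<dots> \<le> \<bar>real (a j) - real (b j)\<bar> * real q ^ (card I - 2)"
      by (intro mult_left_mono bound) (use insert ab in auto)
    finally have 1: "\<bar>D I ?c - D I (\<lambda>i. if i \<in> insert j J then b i else a i)\<bar>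
        \<le> real q ^ (card I - 2) * \<bar>real (a j) - real (b j)\<bar>" by (simp add: mult.commute)
    have "\<bar>D I a - D I ?c\<bar> \<le> real q ^ (card I - 2) * (\<Sum>i\<in>J. \<bar>real (a i) - real (b i)\<bar>)"
      using insert by simp
    with 1 show ?case using insert(1,2) by (simp add: distrib_left)
  qed simp
  from this[OF I(1) subset_refl] show ?thesis
    using D_cong[of I "\<lambda>i. if i \<in> I then b i else a i" b] by simp
qed

section \<open>Splitting into residue classes\<close>

text \<open>
  An operator that shifts the coordinate \<open>i\<close> by \<open>d i\<close> does not mix the residue classes of the exponents modulo
  \<open>d\<close>, and acts on each class as the unit shifts do. Setting \<open>d i = 1\<close> outside \<open>I\<close> makes \<open>div\<close> and \<open>mod\<close> by \<open>d\<close>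
  meaningful in every coordinate.
\<close>

lemma card_ker_split:
  assumes I: "finite I" and d: "\<And>i. d i > 0" "\<And>i. i \<notin> I \<Longrightarrow> d i = 1"
  shows "card (ker_pow d I b n) = (\<Prod>r\<in>box I d. card (unit_ker_pow I (residue_bound d b r) n))"
proof -
  have box_iff: "(\<lambda>i. d i * m i + r i) \<in> box I b \<longleftrightarrow> m \<in> box I (residue_bound d b r)"
    if r: "r \<in> box I d" for m r
  proof -
    have "d i * m i + r i < b i \<longleftrightarrow> m i < residue_bound d b r i" if "i \<in> I" for i
    proof -
      have "r i < d i" using r that by (auto simp: box_def)
      then show ?thesis
        using less_eq_div_iff_mult_less_eq[OF d(1)[of i], of "Suc (m i)" "b i + d i - 1 - r i"]
        by (auto simp: residue_bound_def Suc_le_eq algebra_simps)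
    qed
    moreover have "d i * m i + r i = 0 \<longleftrightarrow> m i = 0" if "i \<notin> I" for i
      using r that d by (auto simp: box_def)
    ultimately show ?thesis by (auto simp: box_def)
  qed
  have mod_box: "(\<lambda>i. m i mod d i) \<in> box I d" for m :: "'a \<Rightarrow> nat"
    using d by (auto simp: box_def)
  have recon: "(\<lambda>i. d i * (m i div d i) + m i mod d i) = m" for m :: "'a \<Rightarrow> nat"
    by auto
  have divmod: "(\<lambda>i. (d i * m i + r i) div d i) = m" "(\<lambda>i. (d i * m i + r i) mod d i) = r"
    if "r \<in> box I d" for m r :: "'a \<Rightarrow> nat"
  proof -
    have lt: "r i < d i" for i using that d by (cases "i \<in> I") (auto simp: box_def)
    show "(\<lambda>i. (d i * m i + r i) mod d i) = r" using lt by simp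
    show "(\<lambda>i. (d i * m i + r i) div d i) = m" using lt d(1) by (simp add: fun_eq_iff)
  qed
  have part_shift: "residue_part d r (shift_sum d I f) = unit_shift_sum I (residue_part d r f)" for r f
  proof -
    have "(\<lambda>i. d i * m i + r i)(k := d k * m k + r k + d k) = (\<lambda>i. d i * (m(k := m k + 1)) i + r i)" for m k
      by (auto simp: fun_eq_iff)
    then show ?thesis by (simp only: residue_part_def shift_sum_def)
  qed
  have part_pow: "residue_part d r ((shift_sum d I ^^ n) f) = (unit_shift_sum I ^^ n) (residue_part d r f)" for r f
    by (induction n) (auto simp: part_shift)
  \<comment> \<open>Every exponent vector lies in one of the classes.\<close>
  have part_zero: "f = 0 \<longleftrightarrow> (\<forall>r\<in>box I d. residue_part d r f = 0)" for f
  proof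
    assume z: "\<forall>r\<in>box I d. residue_part d r f = 0"
    show "f = 0"
    proof
      fix m
      have "residue_part d (\<lambda>i. m i mod d i) f (\<lambda>i. m i div d i) = 0" using z mod_box by auto
      then show "f m = 0 m" by (simp add: residue_part_def)
    qed
  qed (auto simp: residue_part_def)
  have "bij_betw (\<lambda>f. \<lambda>r\<in>box I d. residue_part d r f) (ker_pow d I b n)
      (\<Pi>\<^sub>E r\<in>box I d. unit_ker_pow I (residue_bound d b r) n)"
  proof (rule bij_betw_byWitness[where f' = "\<lambda>F m. F (\<lambda>i. m i mod d i) (\<lambda>i. m i div d i)"])
    show "\<forall>f\<in>ker_pow d I b n. (\<lambda>m. (\<lambda>r\<in>box I d. residue_part d r f) (\<lambda>i. m i mod d i) (\<lambda>i. m i div d i)) = f"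
      using mod_box by (auto simp: residue_part_def)
    show "\<forall>F\<in>\<Pi>\<^sub>E r\<in>box I d. unit_ker_pow I (residue_bound d b r) n.
       (\<lambda>r\<in>box I d. residue_part d r (\<lambda>m. F (\<lambda>i. m i mod d i) (\<lambda>i. m i div d i))) = F"
    proof
      fix F assume F: "F \<in> (\<Pi>\<^sub>E r\<in>box I d. unit_ker_pow I (residue_bound d b r) n)"
      show "(\<lambda>r\<in>box I d. residue_part d r (\<lambda>m. F (\<lambda>i. m i mod d i) (\<lambda>i. m i div d i))) = F"
      proof
        fix r
        show "(\<lambda>r\<in>box I d. residue_part d r (\<lambda>m. F (\<lambda>i. m i mod d i) (\<lambda>i. m i div d i))) r = F r"
        proof (cases "r \<in> box I d")
          case True
          then show ?thesis by (simp only: restrict_apply' residue_part_def divmod[OF True])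
        qed (use PiE_arb[OF F, of r] in simp)
      qed
    qed
    show "(\<lambda>f. \<lambda>r\<in>box I d. residue_part d r f) ` ker_pow d I b n
        \<subseteq> (\<Pi>\<^sub>E r\<in>box I d. unit_ker_pow I (residue_bound d b r) n)"
    proof (intro image_subsetI PiE_I)
      fix f r assume f: "f \<in> ker_pow d I b n" and r: "r \<in> box I d"
      have "residue_part d r f \<in> V I (residue_bound d b r)"
        using f box_iff[OF r] by (auto simp: V_def ker_pow_def residue_part_def)
      moreover have "(unit_shift_sum I ^^ n) (residue_part d r f) = 0"
        unfolding part_pow[symmetric] using f by (simp add: ker_pow_def residue_part_def zero_fun_def)
      ultimately show "(\<lambda>r\<in>box I d. residue_part d r f) r \<in> unit_ker_pow I (residue_bound d b r) n"
        using r by (simp add: ker_pow_def)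
    qed auto
    show "(\<lambda>F m. F (\<lambda>i. m i mod d i) (\<lambda>i. m i div d i)) ` (\<Pi>\<^sub>E r\<in>box I d. unit_ker_pow I (residue_bound d b r) n)
        \<subseteq> ker_pow d I b n"
    proof (rule image_subsetI)
      fix F assume F: "F \<in> (\<Pi>\<^sub>E r\<in>box I d. unit_ker_pow I (residue_bound d b r) n)"
      let ?f = "\<lambda>m. F (\<lambda>i. m i mod d i) (\<lambda>i. m i div d i)"
      have Fr: "F r \<in> unit_ker_pow I (residue_bound d b r) n" if "r \<in> box I d" for r
        using F that by auto
      have "residue_part d r ?f = F r" if "r \<in> box I d" for r
        using divmod[OF that] by (simp add: residue_part_def)
      then have "(shift_sum d I ^^ n) ?f = 0"
        unfolding part_zero[of "(shift_sum d I ^^ n) ?f"] part_pow using Fr by (simp add: ker_pow_def)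
      moreover have "?f m = 0" if "m \<notin> box I b" for m
      proof -
        have "(\<lambda>i. m i div d i) \<notin> box I (residue_bound d b (\<lambda>i. m i mod d i))"
          using box_iff[OF mod_box, of "\<lambda>i. m i div d i" m] that unfolding recon by simp
        then show ?thesis using Fr[OF mod_box, of m] by (simp add: ker_pow_def V_def)
      qed
      moreover have "?f m \<in> G" for m using Fr[OF mod_box, of m] by (simp add: ker_pow_def V_def)
      ultimately show "?f \<in> ker_pow d I b n" by (simp add: ker_pow_def V_def)
    qed
  qed
  then show ?thesis by (simp add: bij_betw_same_card card_PiE finite_box[OF I])
qed

lemma log_card_ker_split:
  assumes I: "finite I" and d: "\<And>i. d i > 0" "\<And>i. i \<notin> I \<Longrightarrow> d i = 1"
  shows "log p (card (ker_pow d I b 1)) = (\<Sum>r\<in>box I d. D I (residue_bound d b r))"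
proof -
  have "log p (\<Prod>r\<in>box I d. real (card (unit_ker_pow I (residue_bound d b r) 1)))
      = (\<Sum>r\<in>box I d. log p (card (unit_ker_pow I (residue_bound d b r) 1)))"
    unfolding log_def sum_divide_distrib[symmetric] using card_ker_pow_pos[OF I]
    by (subst ln_prod) (auto simp: finite_box[OF I])
  then show ?thesis using card_ker_split[OF assms, where b = b and n = 1] by (simp add: D_def)
qed

text \<open>
  Write \<open>I = J \<union> {j}\<close>. Then \<open>D\<close> is the dimension of the kernel of \<open>T^{p a_j} = (\<Sum> y_i^p)^{a_j}\<close> on the box over
  \<open>J\<close> with sides \<open>p a_i\<close>, which splits into \<open>p^{s-1}\<close> copies of the kernel of \<open>T^{a_j}\<close> on the box with sides \<open>a_i\<close>.
\<close>

lemma D_times_p: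
  assumes I: "finite I" "I \<noteq> {}"
  shows "D I (\<lambda>i. p * a i) = real p ^ (card I - 1) * D I a"
proof -
  obtain j J where IJ: "I = insert j J" "j \<notin> J" using I by (meson Set.set_insert ex_in_conv)
  have J: "finite J" using I IJ by simp
  let ?d = "\<lambda>i. if i \<in> J then p else 1"
  have pow: "(unit_shift_sum J ^^ (p * n)) f = (shift_sum ?d J ^^ n) f" if "f \<in> V J b" for f b n
  proof (induction n)
    case (Suc n)
    have "(shift_sum ?d J ^^ n) f \<in> V J b" by (rule shift_sum_pow_V[OF subset_refl that])
    then have "(unit_shift_sum J ^^ p) ((shift_sum ?d J ^^ n) f) = shift_sum (\<lambda>_. p) J ((shift_sum ?d J ^^ n) f)"
      by (intro shift_sum_frobenius[OF J]) (auto simp: V_def)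
    also have "\<dots> = shift_sum ?d J ((shift_sum ?d J ^^ n) f)"
      by (simp add: shift_sum_def cong: sum.cong)
    finally show ?case using Suc by (simp add: funpow_add)
  qed simp
  have "residue_bound ?d (\<lambda>i. p * a i) r i = a i" if "r \<in> box J ?d" "i \<in> J" for r i
  proof -
    have "r i < p" using that by (auto simp: box_def)
    then have "p * a i + p - 1 - r i = a i * p + (p - 1 - r i)" "p - 1 - r i < p"
      by (auto simp: mult.commute)
    then show ?thesis using that by (simp add: residue_bound_def)
  qed
  then have "unit_ker_pow J (residue_bound ?d (\<lambda>i. p * a i) r) n = unit_ker_pow J a n" if "r \<in> box J ?d" for r n
    by (rule ker_pow_cong) (use that in auto)
  then have "card (ker_pow ?d J (\<lambda>i. p * a i) n) = card (unit_ker_pow J a n) ^ (p ^ card J)" for n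
    using card_ker_split[OF J, of ?d "\<lambda>i. p * a i" n] p_gt_1
    by (simp add: card_box[OF J] cong: prod.cong)
  moreover have "ker_pow ?d J (\<lambda>i. p * a i) n = unit_ker_pow J (\<lambda>i. p * a i) (p * n)" for n
    using pow by (auto simp: ker_pow_def)
  ultimately have "card (unit_ker_pow J (\<lambda>i. p * a i) (p * a j)) = card (unit_ker_pow J a (a j)) ^ (p ^ card J)"
    by metis
  then show ?thesis using IJ J card_ker_pow_pos[OF J]
    by (simp add: D_insert log_nat_power)
qed

lemma D_times_p_pow:
  assumes I: "finite I" "I \<noteq> {}"
  shows "D I (\<lambda>i. p ^ k * a i) = real (p ^ k) ^ (card I - 1) * D I a"
proof (induction k)
  case (Suc k)
  have "D I (\<lambda>i. p * (p ^ k * a i)) = real p ^ (card I - 1) * D I (\<lambda>i. p ^ k * a i)"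
    by (rule D_times_p[OF I])
  then show ?case using Suc by (simp add: power_mult_distrib mult.assoc)
qed simp

end

section \<open>Counting lattice points of a box by residue of the coordinate sum\<close>

definition box_sum :: "'i set \<Rightarrow> ('i \<Rightarrow> nat) \<Rightarrow> (int \<Rightarrow> real) \<Rightarrow> real"
  where "box_sum I a w = (\<Sum>m\<in>box I a. w (int (\<Sum>i\<in>I. m i)))"

lemma box_sum_empty: "box_sum {} a w = w 0"
proof -
  have "box {} a = {\<lambda>_. 0}" by (auto simp: box_def)
  then show ?thesis by (simp add: box_sum_def)
qed

lemma box_sum_insert:
  assumes "finite I" "j \<notin> I"
  shows "box_sum (insert j I) a w = (\<Sum>u<a j. box_sum I a (\<lambda>x. w (x + int u)))"
proof -
  have "bij_betw (\<lambda>(u, m). m(j := u)) ({..<a j} \<times> box I a) (box (insert j I) a)"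
    by (rule bij_betw_byWitness[where f' = "\<lambda>m. (m j, m(j := 0))"])
      (use assms(2) in \<open>auto simp: box_def fun_eq_iff\<close>)
  then have "box_sum (insert j I) a w
      = (\<Sum>(u, m)\<in>{..<a j} \<times> box I a. w (int (\<Sum>i\<in>insert j I. (m(j := u)) i)))"
    unfolding box_sum_def
    using sum.reindex_bij_betw[of _ _ _ "\<lambda>m. w (int (\<Sum>i\<in>insert j I. m i))", symmetric]
    by (simp only: case_prod_unfold)
  also have "\<dots> = (\<Sum>(u, m)\<in>{..<a j} \<times> box I a. w (int (\<Sum>i\<in>I. m i) + int u))"
  proof (rule sum.cong[OF refl], clarify)
    fix u :: nat and m
    have "(\<Sum>i\<in>I. (m(j := u)) i) = (\<Sum>i\<in>I. m i)"
      by (rule sum.cong) (use assms(2) in auto)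
    then have "int (\<Sum>i\<in>insert j I. (m(j := u)) i) = int (\<Sum>i\<in>I. m i) + int u"
      using assms by simp
    then show "w (int (\<Sum>i\<in>insert j I. (m(j := u)) i)) = w (int (\<Sum>i\<in>I. m i) + int u)"
      by (rule arg_cong)
  qed
  finally show ?thesis by (simp add: box_sum_def sum.cartesian_product)
qed

lemma box_cong: "(\<And>i. i \<in> I \<Longrightarrow> a i = b i) \<Longrightarrow> box I a = box I b"
  by (auto simp: box_def)

lemma box_sum_cong: "(\<And>i. i \<in> I \<Longrightarrow> a i = b i) \<Longrightarrow> box_sum I a w = box_sum I b w"
  using box_cong[of I a b] by (simp add: box_sum_def)

definition mod_ind :: "nat \<Rightarrow> int \<Rightarrow> int \<Rightarrow> real"
  where "mod_ind p c x = (if int p dvd x - c then 1 else 0)"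

lemma mod_ind_shift: "mod_ind p c (x + u) = mod_ind p (c - u) x"
  by (simp add: mod_ind_def algebra_simps)

text \<open>
  The middle degree \<open>\<lfloor>\<Sum>(a_i - 1)/2\<rfloor>\<close> of the box.
\<close>

definition box_center :: "'i set \<Rightarrow> ('i \<Rightarrow> nat) \<Rightarrow> int"
  where "box_center I a = (int (\<Sum>i\<in>I. a i) - int (card I)) div 2"

definition central_count :: "nat \<Rightarrow> 'i set \<Rightarrow> ('i \<Rightarrow> nat) \<Rightarrow> real"
  where "central_count p I a = box_sum I a (mod_ind p (box_center I a))"


lemma central_count_empty: "central_count p {} a = 1"
  by (simp add: central_count_def box_sum_empty box_center_def mod_ind_def)

lemma central_count_insert_zero:
  "finite I \<Longrightarrow> j \<notin> I \<Longrightarrow> a j = 0 \<Longrightarrow> central_count p (insert j I) a = 0"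
  by (simp add: central_count_def box_sum_insert)

lemma central_count_insert_one:
  "finite I \<Longrightarrow> j \<notin> I \<Longrightarrow> a j = 1 \<Longrightarrow> central_count p (insert j I) a = central_count p I a"
  by (simp add: central_count_def box_sum_insert box_center_def)

text \<open>
  Each residue class modulo \<open>p\<close> occurs once among \<open>p\<close> consecutive integers.
\<close>

lemma sum_mod_ind_period:
  assumes "p > 0"
  shows "(\<Sum>u<p. mod_ind p c (x + int u)) = 1"
proof -
  have "(int p dvd x + int u - c) \<longleftrightarrow> u = nat ((c - x) mod int p)" if "u < p" for u
  proof -
    have "int p dvd x + int u - c \<longleftrightarrow> int u mod int p = (c - x) mod int p"
      by (simp add: mod_eq_dvd_iff algebra_simps)
    also have "\<dots> \<longleftrightarrow> int u = (c - x) mod int p" using that by simp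
    also have "\<dots> \<longleftrightarrow> u = nat ((c - x) mod int p)" using assms by auto
    finally show ?thesis .
  qed
  then have "(\<Sum>u<p. mod_ind p c (x + int u)) = (\<Sum>u<p. if u = nat ((c - x) mod int p) then 1 else 0)"
    by (intro sum.cong) (auto simp: mod_ind_def)
  also have "\<dots> = 1"
    using assms by (simp add: nat_less_iff)
  finally show ?thesis .
qed

lemma central_count_insert_period:
  assumes "finite I" "j \<notin> I" "a j = p" "p > 0"
  shows "central_count p (insert j I) a = real (\<Prod>i\<in>I. a i)"
proof -
  have "central_count p (insert j I) a
      = (\<Sum>m\<in>box I a. \<Sum>u<p. mod_ind p (box_center (insert j I) a) (int (\<Sum>i\<in>I. m i) + int u))"
    using assms by (simp add: central_count_def box_sum_insert) (simp add: box_sum_def sum.swap[of _ "{..<p}"])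
  also have "\<dots> = real (card (box I a))" using sum_mod_ind_period[OF assms(4)] by simp
  finally show ?thesis using assms by (simp add: card_box)
qed

text \<open>
  In terms of generating functions in a variable \<open>t\<close> marking the degree, with \<open>[a] = 1 + t + ... + t^{a-1}\<close>,
  this is \<open>[x+1] [y] + t [x-1] [y] = (1 + t) [x] [y]\<close>. The factor \<open>t\<close> matches the shift of the middle degree by one
  between the two boxes. The right-hand side is symmetric in \<open>x\<close> and \<open>y\<close>.
\<close>

lemma central_count_wave_aux:
  fixes I :: "'i set" and j k :: 'i and x p y :: nat and a :: "'i \<Rightarrow> nat"
  assumes I: "finite I" "j \<notin> I" "k \<notin> I" "j \<noteq> k" and x: "0 < x"
  defines "h \<equiv> \<lambda>c. box_sum I a (mod_ind p c)"
    and "c0 \<equiv> (int (\<Sum>i\<in>I. a i) - int (card I) + int x + int y - 1) div 2"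
  shows "central_count p (insert j (insert k I)) (a(j := x + 1, k := y))
      + central_count p (insert j (insert k I)) (a(j := x - 1, k := y))
    = (\<Sum>u<x. \<Sum>v<y. h (c0 - int u - int v) + h (c0 - 1 - int u - int v))"
proof -
  have S: "(\<Sum>i\<in>insert j (insert k I). (a(j := z, k := y)) i) = (\<Sum>i\<in>I. a i) + z + y" for z
  proof -
    have "(\<Sum>i\<in>I. (a(j := z, k := y)) i) = (\<Sum>i\<in>I. a i)"
      by (rule sum.cong) (use I in auto)
    then show ?thesis using I by simp
  qed
  have cc: "central_count p (insert j (insert k I)) (a(j := z, k := y))
      = (\<Sum>u<z. \<Sum>v<y. h ((int (\<Sum>i\<in>I. a i) - int (card I) + int z + int y - 2) div 2 - int u - int v))" for z
  proof -
    have "box_center (insert j (insert k I)) (a(j := z, k := y))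
        = (int (\<Sum>i\<in>I. a i) - int (card I) + int z + int y - 2) div 2" (is "_ = ?c")
      unfolding box_center_def S using I by (simp add: algebra_simps)
    moreover have "box_sum I (a(j := z, k := y)) w = box_sum I a w" for w
      by (rule box_sum_cong) (use I in auto)
    ultimately show ?thesis using I
      by (simp add: central_count_def box_sum_insert mod_ind_shift h_def)
  qed
  define H where "H u = (\<Sum>v<y. h (c0 - int u - int v))" for u :: nat
  obtain x' where x': "x = Suc x'" using x by (cases x) auto
  have c1: "(int (\<Sum>i\<in>I. a i) - int (card I) + int (x + 1) + int y - 2) div 2 = c0"
    unfolding c0_def by (rule arg_cong[where f = "\<lambda>z. z div 2"]) simp
  have "int (\<Sum>i\<in>I. a i) - int (card I) + int (x - 1) + int y - 2
      = int (\<Sum>i\<in>I. a i) - int (card I) + int x + int y - 1 + (-1) * 2"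
    using x by (simp add: of_nat_diff)
  then have c2: "(int (\<Sum>i\<in>I. a i) - int (card I) + int (x - 1) + int y - 2) div 2 = c0 - 1"
    unfolding c0_def by (simp only: div_mult_self1)
  have "central_count p (insert j (insert k I)) (a(j := x + 1, k := y)) = (\<Sum>u<x + 1. H u)"
    unfolding cc c1 H_def ..
  moreover have "central_count p (insert j (insert k I)) (a(j := x - 1, k := y)) = (\<Sum>u<x - 1. H (Suc u))"
    unfolding cc c2 H_def by (simp add: algebra_simps)
  moreover have "(\<Sum>u<x + 1. H u) + (\<Sum>u<x - 1. H (Suc u)) = (\<Sum>u<x. H u) + (\<Sum>u<x. H (Suc u))"
    by (simp add: x')
  moreover have "(\<Sum>u<x. \<Sum>v<y. h (c0 - int u - int v) + h (c0 - 1 - int u - int v))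
      = (\<Sum>u<x. H u) + (\<Sum>u<x. H (Suc u))"
    by (simp add: H_def sum.distrib algebra_simps)
  ultimately show ?thesis by simp
qed

lemma central_count_wave_equation:
  assumes I: "finite I" "j \<notin> I" "k \<notin> I" "j \<noteq> k" and xy: "0 < x" "0 < y"
  shows "central_count p (insert j (insert k I)) (a(j := x + 1, k := y))
      + central_count p (insert j (insert k I)) (a(j := x - 1, k := y))
    = central_count p (insert j (insert k I)) (a(j := x, k := y + 1))
      + central_count p (insert j (insert k I)) (a(j := x, k := y - 1))"
proof -
  define h where "h c = box_sum I a (mod_ind p c)" for c
  define c0 where "c0 = (int (\<Sum>i\<in>I. a i) - int (card I) + int x + int y - 1) div 2"
  define c' where "c' = (int (\<Sum>i\<in>I. a i) - int (card I) + int y + int x - 1) div 2"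
  have "central_count p (insert j (insert k I)) (a(j := x, k := y + 1))
      + central_count p (insert j (insert k I)) (a(j := x, k := y - 1))
    = central_count p (insert k (insert j I)) (a(k := y + 1, j := x))
      + central_count p (insert k (insert j I)) (a(k := y - 1, j := x))"
    using I by (simp add: insert_commute fun_upd_twist)
  also have "\<dots> = (\<Sum>u<y. \<Sum>v<x. h (c' - int u - int v) + h (c' - 1 - int u - int v))"
    unfolding h_def c'_def by (rule central_count_wave_aux) (use I xy in auto)
  also have "\<dots> = (\<Sum>u<x. \<Sum>v<y. h (c' - int u - int v) + h (c' - 1 - int u - int v))"
    by (subst sum.swap, intro sum.cong refl arg_cong2[where f = "(+)"] arg_cong[where f = h]) auto
  also have "c' = c0" unfolding c'_def c0_def by (simp add: add_ac)
  also have "(\<Sum>u<x. \<Sum>v<y. h (c0 - int u - int v) + h (c0 - 1 - int u - int v))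
    = central_count p (insert j (insert k I)) (a(j := x + 1, k := y))
      + central_count p (insert j (insert k I)) (a(j := x - 1, k := y))"
    unfolding h_def c0_def by (rule central_count_wave_aux[symmetric]) (use I xy in auto)
  finally show ?thesis by (rule sym)
qed

context prime_torsion
begin

text \<open>
  By induction on the number of coordinates. With two coordinates \<open>x\<close>, \<open>y\<close> singled out, the difference \<open>E x y\<close>
  of the two sides satisfies the wave equation, vanishes for \<open>x = 0\<close>, for \<open>x = 1\<close> (where a coordinate drops out and
  the induction hypothesis applies), for \<open>y = 0\<close> and for \<open>y = p\<close>. The wave equation then propagates the zeros from
  the columns \<open>x - 1\<close> and \<open>x\<close> to the column \<open>x + 1\<close>.
\<close>

lemma D_eq_central_count:
  assumes "finite I" "infinite (UNIV :: 'i set)" "\<And>i::'i. i \<in> I \<Longrightarrow> a i \<le> p"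
  shows "D I a = central_count p I a"
  using assms(1,3)
proof (induction I arbitrary: a)
  case empty
  show ?case by (simp add: D_empty central_count_empty)
next
  case (insert j I)
  have p: "p > 0" using p_gt_1 by simp
  show ?case
  proof (cases "I = {}")
    case True
    show ?thesis
    proof (cases "a j = 0")
      case True
      then show ?thesis using insert(1,2) by (simp add: D_insert_zero central_count_insert_zero)
    next
      case False
      have "(unit_shift_sum {} ^^ n) f = 0" if "n > 0" for f :: "('i \<Rightarrow> nat) \<Rightarrow> 'g" and n
        using that by (cases n) (auto simp: shift_sum_def)
      then have "unit_ker_pow {} a (a j) = V {} a" using False by (auto simp: ker_pow_def)
      then have "D (insert j I) a = 1"
        using True log_p_power[of 1] by (simp add: D_insert card_V)
      moreover have "central_count p (insert j I) a = 1"
      proof -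
        have "int p dvd int u - (int (a j) - 1) div 2 \<longleftrightarrow> u = nat ((int (a j) - 1) div 2)" if "u < a j" for u
        proof
          assume d: "int p dvd int u - (int (a j) - 1) div 2"
          have "\<bar>int u - (int (a j) - 1) div 2\<bar> < int p" using that insert(4)[of j] by simp
          then have "int u - (int (a j) - 1) div 2 = 0"
            using d zdvd_imp_le by (metis abs_dvd_iff dvd_abs_iff linorder_not_less zdvd_not_zless zero_less_abs_iff)
          then show "u = nat ((int (a j) - 1) div 2)" by simp
        next
          assume "u = nat ((int (a j) - 1) div 2)"
          then have "int u = (int (a j) - 1) div 2" using False by simp
          then show "int p dvd int u - (int (a j) - 1) div 2" by simp
        qed
        then have "central_count p (insert j I) a
            = (\<Sum>u<a j. if u = nat ((int (a j) - 1) div 2) then 1 else 0)"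
          using True by (auto simp: central_count_def box_sum_insert box_sum_empty box_center_def mod_ind_def
              intro!: sum.cong)
        also have "\<dots> = 1" using False by simp
        finally show ?thesis .
      qed
      ultimately show ?thesis by simp
    qed
  next
    case False
    then obtain k J where kJ: "I = insert k J" "k \<notin> J" by (meson Set.set_insert ex_in_conv)
    have J: "finite J" "j \<notin> J" "j \<noteq> k" "k \<notin> J" using insert kJ by auto
    define E where "E x y = D (insert j I) (a(j := x, k := y)) - central_count p (insert j I) (a(j := x, k := y))"
      for x y
    have le: "i \<in> insert k J \<Longrightarrow> (a(j := x, k := y)) i \<le> p" if "y \<le> p" for i x y
      using insert(4)[of i] that kJ J by auto
    have E0: "E 0 y = 0" for y
      using insert(1,2) J(3) by (simp add: E_def D_insert_zero central_count_insert_zero)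
    have E1: "E 1 y = 0" if "y \<le> p" for y
    proof -
      have "D I (a(j := 1, k := y)) = central_count p I (a(j := 1, k := y))"
        by (rule insert.IH) (use le[OF that] kJ in auto)
      then show ?thesis
        using insert(1,2) J(3) by (simp add: E_def D_insert_one central_count_insert_one)
    qed
    have swap: "insert j I = insert k (insert j J)" using kJ by auto
    have Ey0: "E x 0 = 0" for x
      unfolding E_def swap using J by (simp add: D_insert_zero central_count_insert_zero)
    have Eyp: "E x p = 0" if "x \<le> p" for x
    proof -
      have "D (insert k (insert j J)) (a(j := x, k := p)) = real (\<Prod>i\<in>insert j J. (a(j := x, k := p)) i)"
        by (rule D_insert_prime) (use J that insert(4) kJ in auto)
      moreover have "central_count p (insert k (insert j J)) (a(j := x, k := p))
          = real (\<Prod>i\<in>insert j J. (a(j := x, k := p)) i)"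
        by (rule central_count_insert_period) (use J p in auto)
      ultimately show ?thesis unfolding E_def swap by simp
    qed
    have wave: "E (x + 1) y + E (x - 1) y = E x (y + 1) + E x (y - 1)"
      if "0 < x" "x < p" "0 < y" "y < p" for x y
      using D_discrete_wave_equation[OF J(1) assms(2) J(2,4,3) that, of a]
        central_count_wave_equation[OF J(1,2,4,3) that(1,3), of p a]
      unfolding E_def kJ(1) by linarith
    have "x + 1 \<le> p \<longrightarrow> (\<forall>y\<le>p. E x y = 0 \<and> E (x + 1) y = 0)" for x
    proof (induction x)
      case 0
      then show ?case using E0 E1 by simp
    next
      case (Suc x)
      show ?case
      proof (intro impI allI)
        fix y assume x: "Suc x + 1 \<le> p" and y: "y \<le> p"
        have IH: "E x z = 0" "E (Suc x) z = 0" if "z \<le> p" for z using Suc x that by auto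
        have "E (Suc x + 1) y = 0"
        proof (cases "y = 0 \<or> y = p")
          case True
          then show ?thesis using Ey0 Eyp x by auto
        next
          case False
          then show ?thesis using wave[of "Suc x" y] IH[of y] IH[of "y + 1"] IH[of "y - 1"] x y by simp
        qed
        then show "E (Suc x) y = 0 \<and> E (Suc x + 1) y = 0" using IH y by simp
      qed
    qed
    from this[of "a j - 1"] have "E (a j) (a k) = 0"
      using E0 insert(4)[of j] insert(4)[of k] kJ by (cases "a j") auto
    then show ?thesis by (simp add: E_def)
  qed
qed

end

section \<open>Asymptotics of the central count\<close>

text \<open>
  The number of vectors in \<open>\<nat>^{k+1}\<close> with coordinate sum \<open>M\<close>.
\<close>

definition simplex_count :: "nat \<Rightarrow> int \<Rightarrow> real"
  where "simplex_count k M = (if M < 0 then 0 else real ((nat M + k) choose k))"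

lemma sum_simplex_count:
  "(\<Sum>u<n. simplex_count k (M - int u)) = simplex_count (Suc k) M - simplex_count (Suc k) (M - int n)"
proof (induction n)
  case (Suc n)
  have pascal: "simplex_count k M + simplex_count (Suc k) (M - 1) = simplex_count (Suc k) M" for M
  proof -
    consider "M < 0" | "M = 0" | m where "M = int (Suc m)"
      by (metis int_cases3 linorder_neqE_linordered_idom not_less_iff_gr_or_eq of_nat_0_less_iff zero_less_imp_eq_int gr0_conv_Suc)
    then show ?thesis
    proof cases
      case 3
      have "nat (int (Suc m)) = Suc m" "nat (int (Suc m) - 1) = m" by auto
      then show ?thesis unfolding 3 by (simp add: simplex_count_def del: of_nat_Suc flip: of_nat_add)
    qed (auto simp: simplex_count_def)
  qed
  have eq: "M - int n - 1 = M - int (Suc n)" by simp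
  show ?case
    unfolding sum.lessThan_Suc Suc using pascal[of "M - int n"] unfolding eq by linarith
qed simp

abbreviation signs :: "'i set \<Rightarrow> ('i \<Rightarrow> real) set"
  where "signs I \<equiv> I \<rightarrow>\<^sub>E {-1, 1}"

text \<open>
  Sums over sign vectors replace the sums over subsets of an inclusion-exclusion argument, since \<open>C_\<lambda>\<close> is
  given in this form.
\<close>

lemma sum_signs_insert:
  assumes "finite I" "j \<notin> I"
  shows "(\<Sum>\<epsilon>\<in>signs (insert j I). F \<epsilon>) = (\<Sum>\<epsilon>\<in>signs I. F (\<epsilon>(j := 1)) + F (\<epsilon>(j := -1)))"
proof -
  have "(\<Sum>\<epsilon>\<in>signs (insert j I). F \<epsilon>)
      = (\<Sum>x\<in>{-1, 1} \<times> signs I. F ((\<lambda>(y, g). g(j := y)) x))"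
    unfolding PiE_insert_eq by (rule sum.reindex[unfolded comp_def]) (rule inj_combinator[OF assms(2)])
  also have "\<dots> = (\<Sum>y\<in>{-1, 1}. \<Sum>\<epsilon>\<in>signs I. F (\<epsilon>(j := y)))"
    by (simp add: sum.cartesian_product case_prod_unfold)
  finally show ?thesis by (simp add: sum.distrib add.commute)
qed

definition level_count :: "'i set \<Rightarrow> ('i \<Rightarrow> nat) \<Rightarrow> int \<Rightarrow> real"
  where "level_count I a M = box_sum I a (\<lambda>x. if x = M then 1 else 0)"

text \<open>
  The amount subtracted from the degree in the inclusion-exclusion term in which the coordinates with sign
  \<open>-1\<close> are forced to be at least \<open>a i\<close>.
\<close>

definition removed :: "'i set \<Rightarrow> ('i \<Rightarrow> nat) \<Rightarrow> ('i \<Rightarrow> real) \<Rightarrow> int"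
  where "removed I a \<epsilon> = (\<Sum>i\<in>I. if \<epsilon> i = -1 then int (a i) else 0)"

lemma level_count_inclusion_exclusion:
  assumes "finite I" "I \<noteq> {}"
  shows "level_count I a M
    = (\<Sum>\<epsilon>\<in>signs I. (\<Prod>i\<in>I. \<epsilon> i) * simplex_count (card I - 1) (M - removed I a \<epsilon>))"
  using assms
proof (induction I arbitrary: M rule: finite_ne_induct)
  case (singleton j)
  have "(\<Sum>u<n. simplex_count 0 (M - int u) - simplex_count 0 (M - int u - 1))
      = simplex_count 0 M - simplex_count 0 (M - int n)" for n
  proof (induction n)
    case (Suc n)
    have "M - int n - 1 = M - int (Suc n)" by simp
    then show ?case unfolding sum.lessThan_Suc Suc by (simp only:)
  qed simp
  moreover have "(if 0 + int u = M then 1 else 0) = simplex_count 0 (M - int u) - simplex_count 0 (M - int u - 1)" for u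
    by (auto simp: simplex_count_def)
  ultimately have "level_count {j} a M = simplex_count 0 M - simplex_count 0 (M - int (a j))"
    using box_sum_insert[of "{}" j a] by (simp add: level_count_def box_sum_empty)
  then show ?case
    using sum_signs_insert[of "{}" j "\<lambda>\<epsilon>. (\<Prod>i\<in>{j}. \<epsilon> i) * simplex_count (card {j} - 1) (M - removed {j} a \<epsilon>)"]
    by (simp add: removed_def)
next
  case (insert j I)
  have card: "card (insert j I) - 1 = Suc (card I - 1)" using insert by (simp add: card_gt_0_iff)
  have lc: "level_count (insert j I) a M = (\<Sum>u<a j. level_count I a (M - int u))"
  proof -
    have "(\<lambda>x. if x + int u = M then 1 else 0) = (\<lambda>x. if x = M - int u then 1 else (0::real))" for u
      by (auto simp: fun_eq_iff)
    then show ?thesis unfolding level_count_def box_sum_insert[OF insert(1,3)] by simp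
  qed
  have upd: "(\<Prod>i\<in>I. (\<epsilon>(j := c)) i) = (\<Prod>i\<in>I. \<epsilon> i)" "removed I a (\<epsilon>(j := c)) = removed I a \<epsilon>" for \<epsilon> c
    unfolding removed_def by (rule prod.cong sum.cong; use insert(3) in auto)+
  have rem: "removed (insert j I) a \<epsilon> = (if \<epsilon> j = -1 then int (a j) else 0) + removed I a \<epsilon>" for \<epsilon>
    using insert by (simp add: removed_def)
  have "(\<Sum>\<epsilon>\<in>signs (insert j I). (\<Prod>i\<in>insert j I. \<epsilon> i) * simplex_count (card (insert j I) - 1) (M - removed (insert j I) a \<epsilon>))
     = (\<Sum>\<epsilon>\<in>signs I. (\<Prod>i\<in>I. \<epsilon> i) * (simplex_count (Suc (card I - 1)) (M - removed I a \<epsilon>)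
        - simplex_count (Suc (card I - 1)) (M - removed I a \<epsilon> - int (a j))))"
    unfolding sum_signs_insert[OF insert(1,3)] card rem prod.insert[OF insert(1,3)] upd
    by (simp add: algebra_simps)
  also have "\<dots> = (\<Sum>\<epsilon>\<in>signs I. (\<Prod>i\<in>I. \<epsilon> i) * (\<Sum>u<a j. simplex_count (card I - 1) (M - removed I a \<epsilon> - int u)))"
    by (simp only: sum_simplex_count)
  also have "\<dots> = (\<Sum>u<a j. level_count I a (M - int u))"
    unfolding insert.IH sum_distrib_left by (subst sum.swap) (simp add: algebra_simps)
  finally show ?case using lc by simp
qed

text \<open>
  The product form has no case distinction and is continuous in \<open>M\<close>, which makes its asymptotics immediate. For
  negative \<open>M\<close> the factor with \<open>i = 1\<close> is zero.
\<close>

lemma simplex_count_eq_prod: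
  assumes "k > 0"
  shows "simplex_count k M = (\<Prod>i=1..k. max (real_of_int M + real i) 0) / fact k"
proof (cases "M < 0")
  case True
  then have "max (real_of_int M + real 1) 0 = 0" by simp
  then have "(\<Prod>i=1..k. max (real_of_int M + real i) 0) = 0"
    using assms by (intro prod_zero[OF _ bexI[of _ 1]]) auto
  then show ?thesis using True by (simp add: simplex_count_def)
next
  case False
  then have M: "real_of_int M = real (nat M)" by simp
  have "real ((nat M + k) choose k) = (\<Prod>i=1..k. (real (nat M) + real i)) / fact k"
  proof -
    have "(\<Prod>i=1..k. (real (nat M) + real i)) = fact (nat M + k) / fact (nat M)"
      by (induction k) (auto simp: algebra_simps)
    then show ?thesis by (simp add: binomial_fact mult.commute)
  qed
  then show ?thesis using False unfolding simplex_count_def M by (simp add: max_def)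
qed

lemma simplex_count_asymptotic:
  assumes k: "k > 0" and z: "((\<lambda>n. real_of_int (z n) / real n) \<longlongrightarrow> \<zeta>) at_top"
  shows "((\<lambda>n. simplex_count k (z n) / real n ^ k) \<longlongrightarrow> max \<zeta> 0 ^ k / fact k) at_top"
proof -
  have "((\<lambda>n. (\<Prod>i=1..k. max (real_of_int (z n) / real n + real i / real n) 0) / fact k)
      \<longlongrightarrow> (\<Prod>i=1..k. max (\<zeta> + 0) 0) / fact k) at_top"
    by (intro tendsto_intros z lim_const_over_n) auto
  moreover have "\<forall>\<^sub>F n in at_top. (\<Prod>i=1..k. max (real_of_int (z n) / real n + real i / real n) 0) / fact k
      = simplex_count k (z n) / real n ^ k"
    using eventually_gt_at_top[of 0]
  proof eventually_elim
    case (elim n)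
    have "max (real_of_int (z n) / real n + real i / real n) 0 = max (real_of_int (z n) + real i) 0 / real n" for i
      using elim by (simp add: max_def add_divide_distrib[symmetric] divide_le_0_iff)
    then show ?case unfolding simplex_count_eq_prod[OF k] by (simp add: prod_dividef)
  qed
  ultimately show ?thesis by (simp add: tendsto_cong)
qed

text \<open>
  Only the levels \<open>middle + l p\<close> with \<open>\<bar>l\<bar> \<le> s\<close> meet the box, since all sides are at most \<open>p\<close>.
\<close>

lemma central_count_eq_sum_level_count:
  assumes I: "finite I" and a: "\<And>i. i \<in> I \<Longrightarrow> a i \<le> p" and p: "p > 0"
  shows "central_count p I a
    = (\<Sum>l\<in>{- int (card I)..int (card I)}. level_count I a (box_center I a + l * int p))"
proof -
  have "mod_ind p (box_center I a) (int (\<Sum>i\<in>I. m i))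
      = (\<Sum>l\<in>{- int (card I)..int (card I)}. if int (\<Sum>i\<in>I. m i) = box_center I a + l * int p then 1 else 0)"
    if m: "m \<in> box I a" for m
  proof -
    let ?x = "int (\<Sum>i\<in>I. m i)" and ?c = "box_center I a" and ?n = "int (card I)"
    have "(\<Sum>i\<in>I. m i) + card I \<le> (\<Sum>i\<in>I. a i)"
    proof -
      have "(\<Sum>i\<in>I. m i + 1) \<le> (\<Sum>i\<in>I. a i)" by (rule sum_mono) (use m in \<open>auto simp: box_def Suc_le_eq\<close>)
      then show ?thesis unfolding sum.distrib by simp
    qed
    moreover have "(\<Sum>i\<in>I. a i) \<le> card I * p" using sum_mono[of I a "\<lambda>_. p"] a by simp
    ultimately have *: "0 \<le> ?x" "?x + ?n \<le> int (\<Sum>i\<in>I. a i)" "int (\<Sum>i\<in>I. a i) \<le> ?n * int p"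
      by (auto simp flip: of_nat_mult of_nat_add simp del: of_nat_sum)
    have abs: "\<bar>?x - ?c\<bar> \<le> ?n * int p" using * unfolding box_center_def by linarith
    show ?thesis
    proof (cases "int p dvd ?x - ?c")
      case True
      then obtain l where l: "?x - ?c = int p * l" by blast
      have "\<bar>l\<bar> * int p \<le> ?n * int p" using abs unfolding l by (simp add: abs_mult mult.commute)
      then have "\<bar>l\<bar> \<le> ?n" using p by simp
      then have "l \<in> {- ?n..?n}" by auto
      moreover have "?x = ?c + l' * int p \<longleftrightarrow> l' = l" for l'
      proof -
        have "?x = ?c + l' * int p \<longleftrightarrow> int p * l = int p * l'" using l by (auto simp: algebra_simps)
        then show ?thesis using p by auto
      qed
      ultimately show ?thesis using True by (simp add: mod_ind_def)
    next
      case False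
      then have "?x \<noteq> ?c + l * int p" for l by (auto simp: dvd_def algebra_simps)
      then show ?thesis using False by (simp add: mod_ind_def)
    qed
  qed
  then show ?thesis
    unfolding central_count_def level_count_def box_sum_def by (subst sum.swap) simp
qed


text \<open>
  With \<open>a_i = \<lfloor>p/d_i\<rfloor>\<close> the argument of the binomial coefficient belonging to \<open>l\<close> and \<open>\<epsilon>\<close>, divided by \<open>p\<close>, tends to
  \<open>(\<Sum> 1/d_i)/2 + l - \<Sum>_{\<epsilon>_i = -1} 1/d_i = (\<Sum> \<epsilon>_i/d_i)/2 + l\<close>.
\<close>

lemma central_count_asymptotic:
  fixes d :: "'i \<Rightarrow> nat"
  assumes I: "finite I" "card I \<ge> 2" and d: "\<And>i. i \<in> I \<Longrightarrow> d i > 0"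
  shows "((\<lambda>p. central_count p I (\<lambda>i. p div d i) / real p ^ (card I - 1)) \<longlongrightarrow>
    (\<Sum>l\<in>{- int (card I)..int (card I)}. \<Sum>\<epsilon>\<in>signs I. (\<Prod>i\<in>I. \<epsilon> i)
      * (max ((\<Sum>i\<in>I. \<epsilon> i / real (d i)) / 2 + real_of_int l) 0 ^ (card I - 1) / fact (card I - 1)))) at_top"
    (is "(_ \<longlongrightarrow> ?L) at_top")
proof -
  let ?a = "\<lambda>p i. p div d i"
  \<comment> \<open>Since \<open>x / 0 = 0\<close> and \<open>x div 0 = 0\<close>, these hold for \<open>k = 0\<close> as well.\<close>
  have div_bounds: "real p / real k - 1 \<le> real (p div k)" "real (p div k) \<le> real p / real k" for p k
    using of_int_floor_le[of "real p / real k"] floor_correct[of "real p / real k"]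
    unfolding floor_divide_of_nat_eq by auto
  have a_lim: "((\<lambda>p. real (?a p i) / real p) \<longlongrightarrow> 1 / real (d i)) at_top" if "i \<in> I" for i
  proof (rule tendsto_sandwich)
    show "\<forall>\<^sub>F p in at_top. 1 / real (d i) - 1 / real p \<le> real (?a p i) / real p"
      using eventually_gt_at_top[of 0]
    proof eventually_elim
      case (elim p)
      show ?case
        using divide_right_mono[OF div_bounds(1)[of p "d i"], of "real p"] elim
        by (simp add: diff_divide_distrib)
    qed
    show "\<forall>\<^sub>F p in at_top. real (?a p i) / real p \<le> 1 / real (d i)"
      using eventually_gt_at_top[of 0]
    proof eventually_elim
      case (elim p)
      show ?case
        using divide_right_mono[OF div_bounds(2)[of p "d i"], of "real p"] elim
        by (simp add: diff_divide_distrib)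
    qed
    show "((\<lambda>p. 1 / real (d i) - 1 / real p) \<longlongrightarrow> 1 / real (d i)) at_top"
      using tendsto_diff[OF tendsto_const lim_const_over_n[of 1]] by auto
  qed auto
  have S_lim: "((\<lambda>p. real (\<Sum>i\<in>I. ?a p i) / real p) \<longlongrightarrow> (\<Sum>i\<in>I. 1 / real (d i))) at_top"
    using tendsto_sum[of I, OF a_lim] by (simp add: sum_divide_distrib)
  have c_lim: "((\<lambda>p. real_of_int (box_center I (?a p)) / real p) \<longlongrightarrow> (\<Sum>i\<in>I. 1 / real (d i)) / 2) at_top"
  proof (rule tendsto_sandwich)
    let ?S = "\<lambda>p. real (\<Sum>i\<in>I. ?a p i)" and ?n = "real (card I)"
    have c: "(?S p - ?n) / 2 - 1 \<le> real_of_int (box_center I (?a p))"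
      "real_of_int (box_center I (?a p)) \<le> (?S p - ?n) / 2" for p
    proof -
      let ?N = "int (\<Sum>i\<in>I. ?a p i) - int (card I)"
      have "2 * box_center I (?a p) \<le> ?N" "?N \<le> 2 * box_center I (?a p) + 1"
        unfolding box_center_def by linarith+
      then have "real_of_int (2 * box_center I (?a p)) \<le> real_of_int ?N" "real_of_int ?N \<le> real_of_int (2 * box_center I (?a p) + 1)"
        by (simp_all only: of_int_le_iff)
      then show "(?S p - ?n) / 2 - 1 \<le> real_of_int (box_center I (?a p))"
        "real_of_int (box_center I (?a p)) \<le> (?S p - ?n) / 2" by (simp_all add: field_simps)
    qed
    show "\<forall>\<^sub>F p in at_top. ?S p / real p / 2 - (?n / 2 + 1) / real p \<le> real_of_int (box_center I (?a p)) / real p"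
      using eventually_gt_at_top[of 0]
    proof eventually_elim
      case (elim p)
      have "((?S p - ?n) / 2 - 1) / real p \<le> real_of_int (box_center I (?a p)) / real p"
        by (rule divide_right_mono[OF c(1)]) simp
      then show ?case by (simp add: diff_divide_distrib add_divide_distrib)
    qed
    show "\<forall>\<^sub>F p in at_top. real_of_int (box_center I (?a p)) / real p \<le> ?S p / real p / 2 - (?n / 2) / real p"
      using eventually_gt_at_top[of 0]
    proof eventually_elim
      case (elim p)
      have "real_of_int (box_center I (?a p)) / real p \<le> ((?S p - ?n) / 2) / real p"
        by (rule divide_right_mono[OF c(2)]) simp
      then show ?case by (simp add: diff_divide_distrib)
    qed
    show "((\<lambda>p. ?S p / real p / 2 - (?n / 2 + 1) / real p) \<longlongrightarrow> (\<Sum>i\<in>I. 1 / real (d i)) / 2) at_top"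
      using tendsto_diff[OF tendsto_divide[OF S_lim tendsto_const[of 2]] lim_const_over_n[of "?n / 2 + 1"]] by simp
    show "((\<lambda>p. ?S p / real p / 2 - (?n / 2) / real p) \<longlongrightarrow> (\<Sum>i\<in>I. 1 / real (d i)) / 2) at_top"
      using tendsto_diff[OF tendsto_divide[OF S_lim tendsto_const[of 2]] lim_const_over_n[of "?n / 2"]] by simp
  qed
  have r_lim: "((\<lambda>p. real_of_int (removed I (?a p) \<epsilon>) / real p)
      \<longlongrightarrow> (\<Sum>i\<in>I. if \<epsilon> i = -1 then 1 / real (d i) else 0)) at_top" for \<epsilon>
  proof -
    have "((\<lambda>p. \<Sum>i\<in>I. (if \<epsilon> i = -1 then real (?a p i) / real p else 0))
      \<longlongrightarrow> (\<Sum>i\<in>I. if \<epsilon> i = -1 then 1 / real (d i) else 0)) at_top"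
      by (rule tendsto_sum) (use a_lim in auto)
    moreover have "real_of_int (removed I (?a p) \<epsilon>) / real p
        = (\<Sum>i\<in>I. (if \<epsilon> i = -1 then real (?a p i) / real p else 0))" for p
      unfolding removed_def of_int_sum sum_divide_distrib by (rule sum.cong) auto
    ultimately show ?thesis by simp
  qed
  have k: "card I - 1 > 0" "I \<noteq> {}" using I by auto
  have term_lim: "((\<lambda>p. simplex_count (card I - 1) (box_center I (?a p) + l * int p - removed I (?a p) \<epsilon>) / real p ^ (card I - 1))
      \<longlongrightarrow> max ((\<Sum>i\<in>I. \<epsilon> i / real (d i)) / 2 + real_of_int l) 0 ^ (card I - 1) / fact (card I - 1)) at_top"
    if \<epsilon>: "\<epsilon> \<in> signs I" for l \<epsilon>
  proof (rule simplex_count_asymptotic[OF k(1)])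
    have "(\<Sum>i\<in>I. 1 / real (d i)) / 2 + real_of_int l - (\<Sum>i\<in>I. if \<epsilon> i = -1 then 1 / real (d i) else 0)
        = (\<Sum>i\<in>I. \<epsilon> i / real (d i)) / 2 + real_of_int l"
    proof -
      have "(\<Sum>i\<in>I. 1 / real (d i)) / 2 - (\<Sum>i\<in>I. if \<epsilon> i = -1 then 1 / real (d i) else 0)
          = (\<Sum>i\<in>I. 1 / real (d i) / 2 - (if \<epsilon> i = -1 then 1 / real (d i) else 0))"
        by (simp add: sum_subtractf sum_divide_distrib)
      also have "\<dots> = (\<Sum>i\<in>I. \<epsilon> i / real (d i) / 2)"
      proof (rule sum.cong[OF refl])
        fix i assume "i \<in> I"
        then have "\<epsilon> i = -1 \<or> \<epsilon> i = 1" using \<epsilon> by auto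
        then show "1 / real (d i) / 2 - (if \<epsilon> i = -1 then 1 / real (d i) else 0) = \<epsilon> i / real (d i) / 2"
          by auto
      qed
      finally show ?thesis by (simp add: sum_divide_distrib)
    qed
    moreover have "((\<lambda>p. real_of_int (box_center I (?a p)) / real p + real_of_int l - real_of_int (removed I (?a p) \<epsilon>) / real p)
        \<longlongrightarrow> (\<Sum>i\<in>I. 1 / real (d i)) / 2 + real_of_int l - (\<Sum>i\<in>I. if \<epsilon> i = -1 then 1 / real (d i) else 0)) at_top"
      by (intro tendsto_intros c_lim r_lim)
    ultimately have *: "((\<lambda>p. real_of_int (box_center I (?a p)) / real p + real_of_int l - real_of_int (removed I (?a p) \<epsilon>) / real p)
        \<longlongrightarrow> (\<Sum>i\<in>I. \<epsilon> i / real (d i)) / 2 + real_of_int l) at_top" by (simp only:)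
    have ev: "\<forall>\<^sub>F p in at_top. real_of_int (box_center I (?a p)) / real p + real_of_int l - real_of_int (removed I (?a p) \<epsilon>) / real p
        = real_of_int (box_center I (?a p) + l * int p - removed I (?a p) \<epsilon>) / real p"
      using eventually_gt_at_top[of 0]
      by eventually_elim (simp add: add_divide_distrib diff_divide_distrib)
    show "((\<lambda>p. real_of_int (box_center I (?a p) + l * int p - removed I (?a p) \<epsilon>) / real p)
        \<longlongrightarrow> (\<Sum>i\<in>I. \<epsilon> i / real (d i)) / 2 + real_of_int l) at_top"
      by (rule Lim_transform_eventually[OF * ev])
  qed
  have "((\<lambda>p. \<Sum>l\<in>{- int (card I)..int (card I)}. \<Sum>\<epsilon>\<in>signs I. (\<Prod>i\<in>I. \<epsilon> i)
      * (simplex_count (card I - 1) (box_center I (?a p) + l * int p - removed I (?a p) \<epsilon>) / real p ^ (card I - 1)))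
      \<longlongrightarrow> ?L) at_top"
    by (intro tendsto_sum tendsto_mult tendsto_const term_lim)
  moreover have "\<forall>\<^sub>F p in at_top. (\<Sum>l\<in>{- int (card I)..int (card I)}. \<Sum>\<epsilon>\<in>signs I. (\<Prod>i\<in>I. \<epsilon> i)
      * (simplex_count (card I - 1) (box_center I (?a p) + l * int p - removed I (?a p) \<epsilon>) / real p ^ (card I - 1)))
      = central_count p I (?a p) / real p ^ (card I - 1)"
    using eventually_gt_at_top[of 0]
  proof eventually_elim
    case (elim p)
    show ?case
      using central_count_eq_sum_level_count[OF I(1), of "?a p" p] elim
      by (simp add: level_count_inclusion_exclusion[OF I(1) k(2)] sum_divide_distrib)
  qed
  ultimately show ?thesis by (rule Lim_transform_eventually)
qed

section \<open>The coefficients of the limit\<close>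

text \<open>
  Summation over the sign of one coordinate is a central difference, which lowers the degree of a
  polynomial; after as many differences as there are coordinates nothing is left.
\<close>

lemma signed_power_sum_eq_zero:
  assumes "finite I" "k < card I"
  shows "(\<Sum>\<epsilon>\<in>signs I. (\<Prod>i\<in>I. \<epsilon> i) * ((\<Sum>i\<in>I. \<epsilon> i * c i) + y) ^ k) = 0"
  using assms
proof (induction I arbitrary: k)
  case (insert j I)
  have upd: "(\<Prod>i\<in>I. (\<epsilon>(j := z)) i) = (\<Prod>i\<in>I. \<epsilon> i)"
    "(\<Sum>i\<in>I. (\<epsilon>(j := z)) i * c i) = (\<Sum>i\<in>I. \<epsilon> i * c i)" for \<epsilon> z
    by (rule prod.cong sum.cong; use insert(2) in auto)+
  let ?X = "\<lambda>\<epsilon>. (\<Sum>i\<in>I. \<epsilon> i * c i) + y"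
  have binom: "(x + c j) ^ k - (x - c j) ^ k
      = (\<Sum>i<k. (of_nat (k choose i) * (c j ^ (k - i) - (- c j) ^ (k - i))) * x ^ i)" for x :: real
  proof -
    have "(x + c j) ^ k - (x + (- c j)) ^ k
        = (\<Sum>i\<le>k. (of_nat (k choose i) * (c j ^ (k - i) - (- c j) ^ (k - i))) * x ^ i)"
      unfolding binomial_ring sum_subtractf[symmetric] by (rule sum.cong) (auto simp: algebra_simps)
    also have "\<dots> = (\<Sum>i<k. (of_nat (k choose i) * (c j ^ (k - i) - (- c j) ^ (k - i))) * x ^ i)"
      by (simp flip: lessThan_Suc_atMost)
    finally show ?thesis by simp
  qed
  have "(\<Sum>\<epsilon>\<in>signs (insert j I). (\<Prod>i\<in>insert j I. \<epsilon> i) * ((\<Sum>i\<in>insert j I. \<epsilon> i * c i) + y) ^ k)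
      = (\<Sum>\<epsilon>\<in>signs I. (\<Prod>i\<in>I. \<epsilon> i) * ((?X \<epsilon> + c j) ^ k - (?X \<epsilon> - c j) ^ k))"
    unfolding sum_signs_insert[OF insert(1,2)] prod.insert[OF insert(1,2)] sum.insert[OF insert(1,2)] upd
    by (simp add: algebra_simps)
  also have "\<dots> = (\<Sum>i<k. (of_nat (k choose i) * (c j ^ (k - i) - (- c j) ^ (k - i)))
      * (\<Sum>\<epsilon>\<in>signs I. (\<Prod>i\<in>I. \<epsilon> i) * ?X \<epsilon> ^ i))"
    unfolding binom sum_distrib_left by (subst sum.swap) (simp add: algebra_simps)
  also have "\<dots> = 0"
    using insert by (intro sum.neutral ballI) simp
  finally show ?case .
qed simp

text \<open>
  With the positive part in place of the restriction on \<open>\<epsilon>\<close>, all sums range over the same sign vectors. A term with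
  positive part 0 contributes 0 because the exponent \<open>s - 1\<close> is positive.
\<close>

lemma C_coeff_eq_max:
  assumes "s \<ge> 2"
  shows "C_coeff s d l = (\<Sum>\<epsilon>\<in>signs {1..s}. (\<Prod>i=1..s. \<epsilon> i)
    * max ((\<Sum>i=1..s. \<epsilon> i / real (d i)) - 2 * real_of_int l) 0 ^ (s - 1))"
proof -
  have "finite (signs {1..s})" by (intro finite_PiE) auto
  then show ?thesis
    unfolding C_coeff_def
    by (intro sum.mono_neutral_cong_left) (use assms in \<open>auto simp: max_def\<close>)
qed

text \<open>
  Replacing \<open>\<epsilon>\<close> by \<open>-\<epsilon>\<close> turns \<open>C_{-l}\<close> into minus the sum of \<open>\<Prod>\<epsilon> (x - 2 l)^{s-1}\<close> over the sign vectors with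
  \<open>x < 2 l\<close>, where \<open>x = \<Sum> \<epsilon>_i/d_i\<close>. So \<open>C_l - C_{-l}\<close> is the sum over all sign vectors, which is zero.
\<close>

lemma C_coeff_uminus:
  assumes "s \<ge> 2"
  shows "C_coeff s d (- l) = C_coeff s d l"
proof -
  let ?x = "\<lambda>\<epsilon>. \<Sum>i=1..s. \<epsilon> i / real (d i)"
  let ?y = "2 * real_of_int l"
  let ?neg = "\<lambda>\<epsilon>. \<lambda>i\<in>{1..s}. - \<epsilon> i :: real"
  have bij: "bij_betw ?neg (signs {1..s}) (signs {1..s})"
  proof (rule bij_betw_byWitness[where f' = ?neg])
    show "\<forall>\<epsilon>\<in>signs {1..s}. ?neg (?neg \<epsilon>) = \<epsilon>" by (auto simp: fun_eq_iff PiE_def extensional_def)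
    show "\<forall>\<epsilon>\<in>signs {1..s}. ?neg (?neg \<epsilon>) = \<epsilon>" by (auto simp: fun_eq_iff PiE_def extensional_def)
    show "?neg ` signs {1..s} \<subseteq> signs {1..s}" by fastforce
    show "?neg ` signs {1..s} \<subseteq> signs {1..s}" by fastforce
  qed
  have neg_x: "?x (?neg \<epsilon>) = - ?x \<epsilon>" for \<epsilon> by (simp add: sum_negf)
  have neg_prod: "(\<Prod>i=1..s. ?neg \<epsilon> i) = (-1) ^ s * (\<Prod>i=1..s. \<epsilon> i)" for \<epsilon>
    by (simp add: prod_uminus)
  have s: "(-1) ^ s = - ((-1) ^ (s - 1) :: real)" using assms by (cases s) auto
  have max: "max z 0 ^ (s - 1) - (-1) ^ s * max (- z) 0 ^ (s - 1) = z ^ (s - 1)" for z :: real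
  proof (cases "z \<ge> 0")
    case True
    then show ?thesis using assms by (simp add: max_def)
  next
    case False
    then have "- ((-1) ^ s * max (- z) 0 ^ (s - 1)) = ((-1) * (- z)) ^ (s - 1)"
      unfolding s power_mult_distrib by simp
    then show ?thesis using False assms by (simp add: zero_power)
  qed
  have "C_coeff s d (- l) = (\<Sum>\<epsilon>\<in>signs {1..s}. (\<Prod>i=1..s. ?neg \<epsilon> i) * max (?x (?neg \<epsilon>) + ?y) 0 ^ (s - 1))"
    unfolding C_coeff_eq_max[OF assms]
    using sum.reindex_bij_betw[OF bij, of "\<lambda>\<epsilon>. (\<Prod>i=1..s. \<epsilon> i) * max (?x \<epsilon> + ?y) 0 ^ (s - 1)"] by simp
  also have "\<dots> = (\<Sum>\<epsilon>\<in>signs {1..s}. (\<Prod>i=1..s. \<epsilon> i) * ((-1) ^ s * max (- (?x \<epsilon> - ?y)) 0 ^ (s - 1)))"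
    unfolding neg_x neg_prod by (simp add: algebra_simps)
  finally have neg: "C_coeff s d (- l) = \<dots>" .
  have "C_coeff s d l - C_coeff s d (- l) = (\<Sum>\<epsilon>\<in>signs {1..s}. (\<Prod>i=1..s. \<epsilon> i)
      * (max (?x \<epsilon> - ?y) 0 ^ (s - 1) - (-1) ^ s * max (- (?x \<epsilon> - ?y)) 0 ^ (s - 1)))"
    unfolding neg unfolding C_coeff_eq_max[OF assms] sum_subtractf[symmetric]
    by (simp only: right_diff_distrib)
  also have "\<dots> = (\<Sum>\<epsilon>\<in>signs {1..s}. (\<Prod>i=1..s. \<epsilon> i) * (?x \<epsilon> - ?y) ^ (s - 1))"
    unfolding max ..
  also have "\<dots> = 0"
    using signed_power_sum_eq_zero[of "{1..s}" "s - 1" "\<lambda>i. 1 / real (d i)" "- ?y"] assms by simp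
  finally show ?thesis by simp
qed

lemma C_coeff_eq_zero:
  assumes "s \<ge> 2" "\<bar>l\<bar> > int s"
  shows "C_coeff s d l = 0"
proof -
  have pos: "C_coeff s d l = 0" if "l > int s" for l
  proof -
    have "\<not> (\<Sum>i=1..s. \<epsilon> i / real (d i)) > 2 * real_of_int l" if "\<epsilon> \<in> signs {1..s}" for \<epsilon>
    proof -
      have "\<epsilon> i / real (d i) \<le> 1" if "i \<in> {1..s}" for i
      proof -
        have "\<epsilon> i = -1 \<or> \<epsilon> i = 1" using that \<open>\<epsilon> \<in> signs {1..s}\<close> by auto
        then show ?thesis by (cases "d i = 0") (auto simp: field_simps)
      qed
      then have "(\<Sum>i=1..s. \<epsilon> i / real (d i)) \<le> real s" using sum_bounded_above[of "{1..s}" _ "1::real"] by fastforce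
      then show ?thesis using \<open>l > int s\<close> by linarith
    qed
    then show ?thesis unfolding C_coeff_def by (intro sum.neutral) auto
  qed
  show ?thesis
  proof (cases "l > 0")
    case True
    then show ?thesis using pos assms by simp
  next
    case False
    then show ?thesis using pos[of "- l"] assms C_coeff_uminus[OF assms(1), of d l] by simp
  qed
qed

lemma infsum_C_coeff:
  assumes "s \<ge> 2"
  shows "(\<Sum>\<^sub>\<infinity>l\<in>UNIV. C_coeff s d l) = (\<Sum>l\<in>{- int s..int s}. C_coeff s d l)"
    and "(\<Sum>\<^sub>\<infinity>l\<in>UNIV. C_coeff s d l) = C_coeff s d 0 + 2 * (\<Sum>\<^sub>\<infinity>l\<in>{0<..}. C_coeff s d l)"
proof -
  have "(\<Sum>\<^sub>\<infinity>l\<in>UNIV. C_coeff s d l) = infsum (C_coeff s d) {- int s..int s}"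
    by (rule infsum_cong_neutral) (auto intro!: C_coeff_eq_zero[OF assms])
  then show 1: "(\<Sum>\<^sub>\<infinity>l\<in>UNIV. C_coeff s d l) = (\<Sum>l\<in>{- int s..int s}. C_coeff s d l)" by simp
  have "(\<Sum>\<^sub>\<infinity>l\<in>{0<..}. C_coeff s d l) = infsum (C_coeff s d) {1..int s}"
    by (rule infsum_cong_neutral) (auto intro!: C_coeff_eq_zero[OF assms])
  then have 2: "(\<Sum>\<^sub>\<infinity>l\<in>{0<..}. C_coeff s d l) = (\<Sum>l\<in>{1..int s}. C_coeff s d l)" by simp
  have "{- int s..int s} = insert 0 ({1..int s} \<union> uminus ` {1..int s})"
  proof -
    have "x \<in> uminus ` {1..int s} \<longleftrightarrow> - x \<in> {1..int s}" for x :: int by (auto simp: image_iff intro: bexI[of _ "- x"])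
    then show ?thesis by auto
  qed
  then have "(\<Sum>l\<in>{- int s..int s}. C_coeff s d l)
      = C_coeff s d 0 + ((\<Sum>l\<in>{1..int s}. C_coeff s d l) + (\<Sum>l\<in>uminus ` {1..int s}. C_coeff s d l))"
    by (simp add: sum.union_disjoint image_iff)
  also have "(\<Sum>l\<in>uminus ` {1..int s}. C_coeff s d l) = (\<Sum>l\<in>{1..int s}. C_coeff s d l)"
    by (subst sum.reindex) (auto simp: inj_on_def C_coeff_uminus[OF assms])
  finally show "(\<Sum>\<^sub>\<infinity>l\<in>UNIV. C_coeff s d l) = C_coeff s d 0 + 2 * (\<Sum>\<^sub>\<infinity>l\<in>{0<..}. C_coeff s d l)"
    using 1 2 by simp
qed

lemma central_count_limit_C_coeff:
  assumes s: "s \<ge> 2" and d: "\<And>i. i \<in> {1..s} \<Longrightarrow> d i > 0"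
  shows "((\<lambda>p. central_count p {1..s} (\<lambda>i. p div d i) / real p ^ (s - 1)) \<longlongrightarrow>
    2 powi (1 - int s) / fact (s - 1) * (\<Sum>\<^sub>\<infinity>l\<in>UNIV. C_coeff s d l)) at_top"
proof -
  let ?x = "\<lambda>\<epsilon>. \<Sum>i=1..s. \<epsilon> i / real (d i)"
  have pw: "2 powi (1 - int s) = (1 / 2 :: real) ^ (s - 1)"
  proof -
    have "1 - int s = - int (s - 1)" using s by simp
    then show ?thesis by (simp only: power_int_minus power_int_of_nat power_one_over inverse_eq_divide)
  qed
  have "max (x / 2 + real_of_int l) 0 = (1 / 2) * max (x - 2 * real_of_int (- l)) 0" for x l
    by (simp add: max_def)
  then have t: "max (?x \<epsilon> / 2 + real_of_int l) 0 ^ (s - 1)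
      = (1 / 2) ^ (s - 1) * max (?x \<epsilon> - 2 * real_of_int (- l)) 0 ^ (s - 1)" for \<epsilon> l
    by (simp only: power_mult_distrib)
  have "(\<Sum>l\<in>{- int s..int s}. \<Sum>\<epsilon>\<in>signs {1..s}. (\<Prod>i=1..s. \<epsilon> i)
      * (max (?x \<epsilon> / 2 + real_of_int l) 0 ^ (s - 1) / fact (s - 1)))
    = (\<Sum>l\<in>{- int s..int s}. 2 powi (1 - int s) / fact (s - 1) * C_coeff s d l)"
  proof (rule sum.cong[OF refl])
    fix l
    have "(\<Sum>\<epsilon>\<in>signs {1..s}. (\<Prod>i=1..s. \<epsilon> i) * (max (?x \<epsilon> / 2 + real_of_int l) 0 ^ (s - 1) / fact (s - 1)))
        = 2 powi (1 - int s) / fact (s - 1) * C_coeff s d (- l)"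
      unfolding t C_coeff_eq_max[OF s] pw sum_distrib_left by (rule sum.cong) auto
    then show "(\<Sum>\<epsilon>\<in>signs {1..s}. (\<Prod>i=1..s. \<epsilon> i) * (max (?x \<epsilon> / 2 + real_of_int l) 0 ^ (s - 1) / fact (s - 1)))
        = 2 powi (1 - int s) / fact (s - 1) * C_coeff s d l"
      by (simp only: C_coeff_uminus[OF s])
  qed
  then show ?thesis
    using central_count_asymptotic[of "{1..s}" d] s d
    by (simp add: infsum_C_coeff(1)[OF s] sum_distrib_left)
qed

section \<open>A commutative ring with p-torsion for every p\<close>

text \<open>
  The ring \<open>\<Prod>\<^sub>n \<int>/n\<close>. It is one type that contains a group of order \<open>p\<close> for every \<open>p\<close> simultaneously, which is what a
  statement quantifying over \<open>p\<close> needs.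
\<close>

quotient_type residue_family = "nat \<Rightarrow> int" / "\<lambda>f g. \<forall>n. f n mod int n = g n mod int n"
  by (auto intro!: equivpI simp: reflp_def symp_def transp_def)

instantiation residue_family :: comm_ring_1
begin

lift_definition zero_residue_family :: residue_family is "\<lambda>_. 0" .
lift_definition one_residue_family :: residue_family is "\<lambda>_. 1" .
lift_definition plus_residue_family :: "residue_family \<Rightarrow> residue_family \<Rightarrow> residue_family"
  is "\<lambda>f g n. f n + g n" by (auto intro: mod_add_cong)
lift_definition minus_residue_family :: "residue_family \<Rightarrow> residue_family \<Rightarrow> residue_family"
  is "\<lambda>f g n. f n - g n" by (auto intro: mod_diff_cong)
lift_definition uminus_residue_family :: "residue_family \<Rightarrow> residue_family"
  is "\<lambda>f n. - f n" by (auto intro: mod_minus_cong)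
lift_definition times_residue_family :: "residue_family \<Rightarrow> residue_family \<Rightarrow> residue_family"
  is "\<lambda>f g n. f n * g n" by (auto intro: mod_mult_cong)

instance
proof
  show "(0::residue_family) \<noteq> 1" by transfer (auto intro: exI[of _ 0])
qed (transfer; simp add: algebra_simps)+

end

lift_definition residue_at :: "nat \<Rightarrow> int \<Rightarrow> residue_family" is "\<lambda>p k n. if n = p then k else 0" .

lemma residue_at_add: "residue_at p (x + y) = residue_at p x + residue_at p y"
  by transfer auto

lemma residue_at_diff: "residue_at p (x - y) = residue_at p x - residue_at p y"
  by transfer auto

lemma residue_at_eq_0_iff: "residue_at p x = 0 \<longleftrightarrow> int p dvd x"
  by transfer (auto simp: dvd_eq_mod_eq_0)

lemma residue_at_0: "residue_at p 0 = 0"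
  by (simp add: residue_at_eq_0_iff)

lemma residue_at_mod: "residue_at p (x mod int p) = residue_at p x"
proof -
  have "int p dvd x mod int p - x" by (metis dvd_triv_left minus_mod_eq_mult_div dvd_minus_iff minus_diff_eq)
  then show ?thesis by (metis residue_at_diff residue_at_eq_0_iff right_minus_eq)
qed

lemma of_nat_times_residue_at: "of_nat c * residue_at p x = residue_at p (int c * x)"
  by (induction c) (auto simp: residue_at_0 residue_at_add algebra_simps)

lemma bij_residue_at: "p > 0 \<Longrightarrow> bij_betw (residue_at p) {0..int p - 1} (range (residue_at p))"
proof (rule bij_betwI')
  fix x y assume p: "p > 0" and "x \<in> {0..int p - 1}" "y \<in> {0..int p - 1}"
  then have b: "\<bar>x - y\<bar> < int p" by auto
  have "residue_at p x = residue_at p y \<longleftrightarrow> int p dvd x - y"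
    by (metis residue_at_diff residue_at_eq_0_iff right_minus_eq)
  also have "\<dots> \<longleftrightarrow> x = y"
  proof
    assume "int p dvd x - y"
    then have "int p dvd \<bar>x - y\<bar>" by simp
    then have "\<not> 0 < \<bar>x - y\<bar>" using b zdvd_imp_le by fastforce
    then show "x = y" by simp
  qed simp
  finally show "residue_at p x = residue_at p y \<longleftrightarrow> x = y" .
next
  fix z assume "p > 0" "z \<in> range (residue_at p)"
  then obtain x where "z = residue_at p x" by auto
  then show "\<exists>x\<in>{0..int p - 1}. z = residue_at p x"
    using \<open>p > 0\<close> by (intro bexI[of _ "x mod int p"]) (auto simp: residue_at_mod)
qed auto

lemma prime_torsion_residue_at:
  assumes "Factorial_Ring.prime p"
  shows "prime_torsion p (range (residue_at p))"
proof
  have p: "p > 0" using assms prime_gt_0_nat by blast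
  show "add_subgroup (range (residue_at p))"
    unfolding add_subgroup_def
  proof (intro conjI ballI)
    show "0 \<in> range (residue_at p)" by (metis rangeI residue_at_0)
    fix x y assume "x \<in> range (residue_at p)" "y \<in> range (residue_at p)"
    then show "x - y \<in> range (residue_at p)" by (auto simp flip: residue_at_diff)
  qed
  show "card (range (residue_at p)) = p"
    using bij_betw_same_card[OF bij_residue_at[OF p]] by simp
  show "of_nat p * g = 0" if "g \<in> range (residue_at p)" for g
    using that by (auto simp: of_nat_times_residue_at residue_at_eq_0_iff)
qed (rule assms)

section \<open>Lengths of finite modules\<close>

text \<open>
  If every proper submodule has index \<open>p\<close> in some larger one, a chain of length \<open>k\<close> exists. It cannot be
  longer, because by Lagrange's theorem the sizes in a chain are different powers of \<open>p\<close> dividing \<open>p^k\<close>.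
\<close>

lemma module_length_of_prime_power_card:
  assumes M: "module R M" and fin: "finite (carrier M)" and card: "card (carrier M) = p ^ k"
    and p: "Factorial_Ring.prime p"
    and step: "\<And>N. submodule N R M \<Longrightarrow> N \<noteq> carrier M \<Longrightarrow>
      \<exists>N'. submodule N' R M \<and> N \<subset> N' \<and> card N' = p * card N"
  shows "module_length R M = enat k"
proof -
  interpret module R M by fact
  have p1: "p > 1" using p prime_gt_1_nat by blast
  have sub: "N \<subseteq> carrier M" if "submodule N R M" for N by (rule submoduleE(1)[OF that])
  have fin_sub: "finite N" if "submodule N R M" for N using sub[OF that] fin finite_subset by blast
  have pow: "\<exists>e\<le>k. card N = p ^ e" if N: "submodule N R M" for N
  proof -
    interpret N: submodule N R M by fact
    have "card (rcosets\<^bsub>add_monoid M\<^esub> N) * card N = order (add_monoid M)"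
      by (rule M.add.lagrange) (rule N.subgroup_axioms)
    then have "card N dvd p ^ k" by (metis card dvd_triv_right order_def partial_object.select_convs(1))
    then show ?thesis using divides_primepow_nat[OF p] by auto
  qed
  have upper: "n \<le> k" if N: "\<forall>i\<le>n. submodule (N i) R M" "\<forall>i<n. N i \<subset> N (Suc i)" for n and N :: "nat \<Rightarrow> _ set"
  proof -
    have "p ^ i \<le> card (N i)" if "i \<le> n" for i
      using that
    proof (induction i)
      case 0
      have "N 0 \<noteq> {}" using N(1) submoduleE(2)[of "N 0"] by auto
      then show ?case using fin_sub N(1) by (simp add: Suc_le_eq card_gt_0_iff)
    next
      case (Suc i)
      obtain e e' where e: "card (N i) = p ^ e" "card (N (Suc i)) = p ^ e'"
        using pow N(1) Suc.prems by (meson Suc_leD)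
      have "card (N i) < card (N (Suc i))"
        using N Suc.prems fin_sub by (intro psubset_card_mono) auto
      then have "e < e'" unfolding e using p1 by simp
      moreover have "i \<le> e" using Suc unfolding e using p1 by simp
      ultimately show ?case unfolding e using p1 by (intro power_increasing) auto
    qed
    from this[of n] have "p ^ n \<le> card (N n)" by simp
    also have "\<dots> \<le> p ^ k" unfolding card[symmetric] by (rule card_mono[OF fin sub]) (use N(1) in auto)
    finally show ?thesis using p1 by simp
  qed
  have zero: "submodule {\<zero>\<^bsub>M\<^esub>} R M"
    by (rule submoduleI) auto
  have chain: "\<exists>N. (\<forall>i\<le>j. submodule (N i) R M \<and> card (N i) = p ^ i) \<and> (\<forall>i<j. N i \<subset> N (Suc i))"
    if "j \<le> k" for j
    using that
  proof (induction j)
    case 0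
    then show ?case using zero by (intro exI[of _ "\<lambda>_. {\<zero>\<^bsub>M\<^esub>}"]) auto
  next
    case (Suc j)
    then obtain N where N: "\<forall>i\<le>j. submodule (N i) R M \<and> card (N i) = p ^ i" "\<forall>i<j. N i \<subset> N (Suc i)"
      by auto
    have "N j \<noteq> carrier M" using N(1) card Suc.prems p1 by auto
    then obtain N' where N': "submodule N' R M" "N j \<subset> N'" "card N' = p * card (N j)"
      using step[of "N j"] N(1) by auto
    let ?N = "N(Suc j := N')"
    have "submodule (?N i) R M \<and> card (?N i) = p ^ i" if "i \<le> Suc j" for i
      using N(1) N'(1,3) that by (cases "i = Suc j") simp_all
    moreover have "?N i \<subset> ?N (Suc i)" if "i < Suc j" for i
      using N(2) N'(2) that by (cases "i = j") simp_all
    ultimately show ?case by blast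
  qed
  show ?thesis
    unfolding module_length_def
  proof (rule antisym)
    show "Sup {enat n |n. \<exists>N. (\<forall>i\<le>n. submodule (N i) R M) \<and> (\<forall>i<n. N i \<subset> N (Suc i))} \<le> enat k"
      by (rule Sup_least) (use upper in auto)
    show "enat k \<le> Sup {enat n |n. \<exists>N. (\<forall>i\<le>n. submodule (N i) R M) \<and> (\<forall>i<n. N i \<subset> N (Suc i))}"
      by (rule Sup_upper) (use chain[of k] in blast)
  qed
qed

section \<open>Multivariate polynomials\<close>

context cring
begin

abbreviation mpoly_carrier :: "'i set \<Rightarrow> ('i multiset \<Rightarrow> 'a) set"
  where "mpoly_carrier J \<equiv> indexed_pset J (carrier R)"

lemma mpoly_ring_simps:
  "carrier (mpoly_ring R J) = mpoly_carrier J"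
  "monoid.mult (mpoly_ring R J) = mpoly_mult R"
  "one (mpoly_ring R J) = indexed_const \<one>"
  "zero (mpoly_ring R J) = indexed_const \<zero>"
  "add (mpoly_ring R J) = indexed_padd"
  by (simp_all add: mpoly_ring_def)

lemma mpoly_carrier_coeff: "P \<in> mpoly_carrier J \<Longrightarrow> carrier_coeff P"
  by (rule indexed_pset_in_carrier[OF subset_refl])

lemma indexed_var_closed: "i \<in> J \<Longrightarrow> indexed_var i \<in> mpoly_carrier J"
  unfolding indexed_var_def by (intro indexed_pset.intros) auto

lemma indexed_pmult_eq_mult_var:
  assumes "P \<in> mpoly_carrier J" "i \<in> J"
  shows "P \<Otimes> i = P \<otimes>\<^bsub>mpoly_ring R J\<^esub> indexed_var i"
    and "P \<Otimes> i = indexed_var i \<otimes>\<^bsub>mpoly_ring R J\<^esub> P"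
proof -
  interpret A: cring "mpoly_ring R J" by (rule mpoly_ring_cring)
  have one: "indexed_const \<one> \<in> mpoly_carrier J" by (intro indexed_pset.intros) auto
  have "mpoly_mult R P (indexed_var i) = mpoly_mult R P (indexed_const \<one>) \<Otimes> i"
    unfolding indexed_var_def
    by (rule mpoly_mult_pmult_right[OF mpoly_carrier_coeff[OF assms(1)] mpoly_carrier_coeff[OF one]])
  also have "mpoly_mult R P (indexed_const \<one>) = P"
    using A.r_one[of P] assms by (simp add: mpoly_ring_simps)
  finally show "P \<Otimes> i = P \<otimes>\<^bsub>mpoly_ring R J\<^esub> indexed_var i" by (simp add: mpoly_ring_simps)
  also have "\<dots> = indexed_var i \<otimes>\<^bsub>mpoly_ring R J\<^esub> P"
    by (rule A.m_comm) (use assms indexed_var_closed in \<open>auto simp: mpoly_ring_simps\<close>)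
  finally show "P \<Otimes> i = indexed_var i \<otimes>\<^bsub>mpoly_ring R J\<^esub> P" .
qed

lemma var_pow_mult:
  assumes "P \<in> mpoly_carrier J" "i \<in> J"
  shows "(indexed_var i [^]\<^bsub>mpoly_ring R J\<^esub> (n::nat)) \<otimes>\<^bsub>mpoly_ring R J\<^esub> P = ((\<lambda>Q. Q \<Otimes> i) ^^ n) P"
    and "((\<lambda>Q. Q \<Otimes> i) ^^ n) P \<in> mpoly_carrier J"
proof -
  interpret A: cring "mpoly_ring R J" by (rule mpoly_ring_cring)
  have x: "indexed_var i \<in> carrier (mpoly_ring R J)" using indexed_var_closed assms by (simp add: mpoly_ring_simps)
  show c: "((\<lambda>Q. Q \<Otimes> i) ^^ n) P \<in> mpoly_carrier J" for n
    by (induction n) (auto simp: assms indexed_pset.indexed_pmult)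
  have P: "P \<in> carrier (mpoly_ring R J)" using assms by (simp add: mpoly_ring_simps)
  show "(indexed_var i [^]\<^bsub>mpoly_ring R J\<^esub> n) \<otimes>\<^bsub>mpoly_ring R J\<^esub> P = ((\<lambda>Q. Q \<Otimes> i) ^^ n) P"
  proof (induction n)
    case (Suc n)
    have "(indexed_var i [^]\<^bsub>mpoly_ring R J\<^esub> Suc n) \<otimes>\<^bsub>mpoly_ring R J\<^esub> P
        = indexed_var i \<otimes>\<^bsub>mpoly_ring R J\<^esub> ((indexed_var i [^]\<^bsub>mpoly_ring R J\<^esub> n) \<otimes>\<^bsub>mpoly_ring R J\<^esub> P)"
      using x P by (simp add: A.m_ac)
    then show ?case using Suc indexed_pmult_eq_mult_var(2)[OF c assms(2)] by simp
  qed (use P in simp)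
qed

definition monomial :: "'a \<Rightarrow> 'i multiset \<Rightarrow> 'i multiset \<Rightarrow> 'a"
  where "monomial k \<mu> = (\<lambda>\<nu>. if \<nu> = \<mu> then k else \<zero>)"

lemma monomial_add_mset: "monomial k (add_mset i \<mu>) = monomial k \<mu> \<Otimes> i"
proof
  fix \<nu>
  show "monomial k (add_mset i \<mu>) \<nu> = (monomial k \<mu> \<Otimes> i) \<nu>"
    by (cases "i \<in># \<nu>") (auto simp: monomial_def indexed_pmult_def dest!: multi_member_split)
qed

lemma monomial_closed:
  fixes J :: "'i set"
  shows "k \<in> carrier R \<Longrightarrow> set_mset \<mu> \<subseteq> J \<Longrightarrow> monomial k \<mu> \<in> mpoly_carrier J"
proof (induction \<mu>)
  case empty
  have "monomial k {#} = (indexed_const k :: 'i multiset \<Rightarrow> 'a)" by (auto simp: monomial_def indexed_const_def)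
  then show ?case using empty by (simp add: indexed_pset.indexed_const)
qed (auto simp: monomial_add_mset indexed_pset.indexed_pmult)

lemma monomial_replicate: "monomial k (replicate_mset n i + \<mu>) = ((\<lambda>Q. Q \<Otimes> i) ^^ n) (monomial k \<mu>)"
  by (induction n) (auto simp: monomial_add_mset)

text \<open>
  A polynomial is the sum of its terms, so a set that is closed under addition contains it as soon as it
  contains the terms.
\<close>

lemma finite_support_mem:
  assumes "finite {\<mu>. P \<mu> \<noteq> \<zero>}" "carrier_coeff P"
    and "indexed_const \<zero> \<in> T" "\<And>Q Q'. Q \<in> T \<Longrightarrow> Q' \<in> T \<Longrightarrow> Q \<Oplus> Q' \<in> T"
    and "\<And>\<mu>. P \<mu> \<noteq> \<zero> \<Longrightarrow> monomial (P \<mu>) \<mu> \<in> T"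
  shows "P \<in> T"
proof -
  have part: "(\<lambda>\<mu>. if \<mu> \<in> F then P \<mu> else \<zero>) \<in> T" if "finite F" "F \<subseteq> {\<mu>. P \<mu> \<noteq> \<zero>}" for F
    using that
  proof (induction F)
    case empty
    then show ?case using assms(3) by (simp add: indexed_zero_def)
  next
    case (insert \<mu> F)
    have "(\<lambda>\<nu>. if \<nu> \<in> insert \<mu> F then P \<nu> else \<zero>) = monomial (P \<mu>) \<mu> \<Oplus> (\<lambda>\<nu>. if \<nu> \<in> F then P \<nu> else \<zero>)"
    proof
      fix \<nu>
      have "P \<nu> \<in> carrier R" "P \<mu> \<in> carrier R" using assms(2) by (simp_all add: carrier_coeff_def)
      then show "(if \<nu> \<in> insert \<mu> F then P \<nu> else \<zero>) = (monomial (P \<mu>) \<mu> \<Oplus> (\<lambda>\<nu>. if \<nu> \<in> F then P \<nu> else \<zero>)) \<nu>"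
        using insert(2) by (simp add: monomial_def indexed_padd_def)
    qed
    moreover have "(\<lambda>\<nu>. if \<nu> \<in> F then P \<nu> else \<zero>) \<in> T" using insert by blast
    moreover have "monomial (P \<mu>) \<mu> \<in> T" using insert by (intro assms(5)) blast
    ultimately show ?case using assms(4) by metis
  qed
  have eq: "(\<lambda>\<mu>. if \<mu> \<in> {\<mu>. P \<mu> \<noteq> \<zero>} then P \<mu> else \<zero>) = P" by auto
  show ?thesis using part[OF assms(1) subset_refl] unfolding eq .
qed

lemma mpoly_carrier_support:
  assumes "P \<in> mpoly_carrier J"
  shows "finite {\<mu>. P \<mu> \<noteq> \<zero>}" "P \<mu> \<noteq> \<zero> \<Longrightarrow> set_mset \<mu> \<subseteq> J"
proof -
  have "finite {\<mu>. P \<mu> \<noteq> \<zero>} \<and> (\<forall>\<mu>. P \<mu> \<noteq> \<zero> \<longrightarrow> set_mset \<mu> \<subseteq> J)"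
    using assms
  proof induction
    case (indexed_const k)
    have "{\<mu>. indexed_const k \<mu> \<noteq> \<zero>} \<subseteq> {{#}}" by (auto simp: indexed_const_def split: if_splits)
    then show ?case using finite_subset by (auto simp: indexed_const_def split: if_splits)
  next
    case (indexed_padd P Q)
    have "{\<mu>. (P \<Oplus> Q) \<mu> \<noteq> \<zero>} \<subseteq> {\<mu>. P \<mu> \<noteq> \<zero>} \<union> {\<mu>. Q \<mu> \<noteq> \<zero>}"
      by (auto simp: indexed_padd_def)
    moreover have "finite ({\<mu>. P \<mu> \<noteq> \<zero>} \<union> {\<mu>. Q \<mu> \<noteq> \<zero>})" using indexed_padd.IH by blast
    ultimately have "finite {\<mu>. (P \<Oplus> Q) \<mu> \<noteq> \<zero>}" by (rule finite_subset)
    moreover have "set_mset \<mu> \<subseteq> J" if "(P \<Oplus> Q) \<mu> \<noteq> \<zero>" for \<mu>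
    proof -
      from that have "P \<mu> \<noteq> \<zero> \<or> Q \<mu> \<noteq> \<zero>" by (auto simp: indexed_padd_def)
      then show ?thesis using indexed_padd.IH by blast
    qed
    ultimately show ?case by blast
  next
    case (indexed_pmult P i)
    have "{\<mu>. (P \<Otimes> i) \<mu> \<noteq> \<zero>} \<subseteq> add_mset i ` {\<mu>. P \<mu> \<noteq> \<zero>}"
      by (auto simp: indexed_pmult_def image_iff split: if_splits dest!: multi_member_split)
    moreover have "finite (add_mset i ` {\<mu>. P \<mu> \<noteq> \<zero>})" using indexed_pmult.IH by blast
    moreover have "set_mset \<mu> \<subseteq> J" if "(P \<Otimes> i) \<mu> \<noteq> \<zero>" for \<mu>
    proof -
      from that have "i \<in># \<mu>" "P (\<mu> - {#i#}) \<noteq> \<zero>" by (auto simp: indexed_pmult_def split: if_splits)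
      then obtain \<nu> where "\<mu> = add_mset i \<nu>" "P \<nu> \<noteq> \<zero>" by (auto dest!: multi_member_split)
      then show ?thesis using indexed_pmult by simp
    qed
    ultimately show ?case using finite_subset by blast
  qed
  then show "finite {\<mu>. P \<mu> \<noteq> \<zero>}" "P \<mu> \<noteq> \<zero> \<Longrightarrow> set_mset \<mu> \<subseteq> J" by auto
qed

lemma mpoly_carrierI:
  assumes "finite {\<mu>. P \<mu> \<noteq> \<zero>}" "carrier_coeff P" "\<And>\<mu>. P \<mu> \<noteq> \<zero> \<Longrightarrow> set_mset \<mu> \<subseteq> J"
  shows "P \<in> mpoly_carrier J"
  using assms(1,2)
proof (rule finite_support_mem)
  show "indexed_const \<zero> \<in> mpoly_carrier J" by (intro indexed_pset.intros) auto
  show "Q \<Oplus> Q' \<in> mpoly_carrier J" if "Q \<in> mpoly_carrier J" "Q' \<in> mpoly_carrier J" for Q Q'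
    using that by (rule indexed_pset.intros)
  show "monomial (P \<mu>) \<mu> \<in> mpoly_carrier J" if "P \<mu> \<noteq> \<zero>" for \<mu>
    using that assms by (intro monomial_closed) (auto simp: carrier_coeff_def)
qed


lemma const_closed: "c \<in> carrier R \<Longrightarrow> indexed_const c \<in> mpoly_carrier J"
  by (rule indexed_pset.indexed_const)

lemma const_mult:
  "c \<in> carrier R \<Longrightarrow> c' \<in> carrier R \<Longrightarrow>
    indexed_const c \<otimes>\<^bsub>mpoly_ring R J\<^esub> indexed_const c' = indexed_const (c \<otimes> c')"
  using mpoly_mult_const_left[OF mpoly_carrier_coeff[OF const_closed[of c' J]], of c]
  by (auto simp: mpoly_ring_simps indexed_const_def)

end

text \<open>
  If the variables act nilpotently, then a proper submodule \<open>N\<close> misses an element \<open>m\<close> that all variables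
  multiply into \<open>N\<close>: start with any element outside \<open>N\<close> and, one variable after the other, multiply by the largest
  power that stays outside. The span of \<open>N\<close> and \<open>m\<close> over the field of constants is then a submodule.
\<close>

lemma (in field) submodule_extension:
  assumes M: "module (mpoly_ring R J) M" and J: "finite J"
    and nil: "\<And>i x. i \<in> J \<Longrightarrow> x \<in> carrier M \<Longrightarrow>
      \<exists>n::nat. (indexed_var i [^]\<^bsub>mpoly_ring R J\<^esub> n) \<odot>\<^bsub>M\<^esub> x = \<zero>\<^bsub>M\<^esub>"
    and N: "submodule N (mpoly_ring R J) M" "N \<noteq> carrier M"
  shows "\<exists>N'. submodule N' (mpoly_ring R J) M \<and> N \<subset> N' \<and> card N' = card (carrier R) * card N"
proof -
  let ?A = "mpoly_ring R J" and ?x = "indexed_var :: _ \<Rightarrow> _ \<Rightarrow> 'a"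
  interpret Mo: module ?A M by fact
  note NE = Mo.submoduleE[OF N(1)]
  note carrier_A = mpoly_ring_simps(1)
  have Nc: "x \<in> carrier M" if "x \<in> N" for x using NE(1) that by auto
  have zero: "\<zero>\<^bsub>M\<^esub> \<in> N"
  proof -
    obtain x where x: "x \<in> N" using NE(2) by blast
    then have "\<zero>\<^bsub>?A\<^esub> \<odot>\<^bsub>M\<^esub> x \<in> N" by (intro NE(4)) auto
    then show ?thesis using Mo.smult_l_null Nc[OF x] by simp
  qed
  have xA: "?x i \<in> carrier ?A" if "i \<in> J" for i
    using indexed_var_closed[OF that] by (simp add: carrier_A)
  have "\<exists>m. m \<in> carrier M \<and> m \<notin> N \<and> (\<forall>i\<in>J'. ?x i \<odot>\<^bsub>M\<^esub> m \<in> N)" if "finite J'" "J' \<subseteq> J" for J'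
    using that
  proof (induction J')
    case empty
    then show ?case using NE(1) N(2) by auto
  next
    case (insert j J')
    then obtain m where m: "m \<in> carrier M" "m \<notin> N" "\<forall>i\<in>J'. ?x i \<odot>\<^bsub>M\<^esub> m \<in> N" by auto
    have j: "j \<in> J" using insert by simp
    let ?P = "\<lambda>n::nat. (?x j [^]\<^bsub>?A\<^esub> n) \<odot>\<^bsub>M\<^esub> m \<in> N"
    define k where "k = (LEAST n. ?P n)"
    have "\<exists>n. ?P n" using nil[OF j m(1)] zero by metis
    then have k: "?P k" unfolding k_def by (rule LeastI_ex)
    have "k \<noteq> 0" using k m by (metis Mo.R.nat_pow_0 Mo.smult_one)
    then obtain k' where k': "k = Suc k'" by (cases k) auto
    have notk: "\<not> ?P k'" using not_less_Least[of k' ?P] k' unfolding k_def by simp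
    let ?m = "(?x j [^]\<^bsub>?A\<^esub> k') \<odot>\<^bsub>M\<^esub> m"
    have "?x i \<odot>\<^bsub>M\<^esub> ?m \<in> N" if i: "i \<in> insert j J'" for i
    proof (cases "i = j")
      case True
      have "?x j \<odot>\<^bsub>M\<^esub> ?m = (?x j \<otimes>\<^bsub>?A\<^esub> (?x j [^]\<^bsub>?A\<^esub> k')) \<odot>\<^bsub>M\<^esub> m"
        using xA[OF j] m(1) by (simp add: Mo.smult_assoc1)
      also have "?x j \<otimes>\<^bsub>?A\<^esub> (?x j [^]\<^bsub>?A\<^esub> k') = ?x j [^]\<^bsub>?A\<^esub> k"
        unfolding k' using xA[OF j] by (simp add: Mo.R.m_comm)
      finally show ?thesis using k True by simp
    next
      case False
      then have i': "i \<in> J'" "i \<in> J" using i insert by auto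
      have "?x i \<odot>\<^bsub>M\<^esub> ?m = (?x i \<otimes>\<^bsub>?A\<^esub> (?x j [^]\<^bsub>?A\<^esub> k')) \<odot>\<^bsub>M\<^esub> m"
        using xA[OF j] xA[OF i'(2)] m(1) by (simp add: Mo.smult_assoc1)
      also have "\<dots> = (?x j [^]\<^bsub>?A\<^esub> k') \<odot>\<^bsub>M\<^esub> (?x i \<odot>\<^bsub>M\<^esub> m)"
        using xA[OF j] xA[OF i'(2)] m(1) by (subst Mo.R.m_comm) (simp_all add: Mo.smult_assoc1)
      also have "\<dots> \<in> N" by (rule NE(4)) (use m(3) i'(1) xA[OF j] in auto)
      finally show ?thesis .
    qed
    moreover have "?m \<in> carrier M" using xA[OF j] m(1) by simp
    ultimately show ?case using notk by blast
  qed
  from this[OF J subset_refl] obtain m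
    where m: "m \<in> carrier M" "m \<notin> N" "\<And>i. i \<in> J \<Longrightarrow> ?x i \<odot>\<^bsub>M\<^esub> m \<in> N" by blast
  let ?c = "\<lambda>c. indexed_const c \<odot>\<^bsub>M\<^esub> m"
  have cA: "indexed_const c \<in> carrier ?A" if "c \<in> carrier R" for c
    using const_closed[OF that] by (simp add: carrier_A)
  have cM: "?c c \<in> carrier M" if "c \<in> carrier R" for c using cA[OF that] m(1) by simp
  have c_add: "?c (a \<oplus> b) = ?c a \<oplus>\<^bsub>M\<^esub> ?c b" if "a \<in> carrier R" "b \<in> carrier R" for a b
  proof -
    have "indexed_const (a \<oplus> b) = indexed_const a \<oplus>\<^bsub>?A\<^esub> indexed_const b"
      by (simp add: mpoly_ring_simps indexed_padd_const)
    then show ?thesis using cA that m(1) by (simp add: Mo.smult_l_distr)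
  qed
  have c_zero: "?c \<zero> = \<zero>\<^bsub>M\<^esub>"
    using Mo.smult_l_null[OF m(1)] by (simp add: mpoly_ring_simps)
  have c_one: "?c \<one> = m"
    using Mo.smult_one[OF m(1)] by (simp add: mpoly_ring_simps)
  have act: "\<exists>c\<in>carrier R. \<exists>n\<in>N. P \<odot>\<^bsub>M\<^esub> m = n \<oplus>\<^bsub>M\<^esub> ?c c" if "P \<in> mpoly_carrier J" for P
    using that
  proof induction
    case (indexed_const k)
    then show ?case using zero cM by (intro bexI[of _ k] bexI[of _ "\<zero>\<^bsub>M\<^esub>"]) auto
  next
    case (indexed_padd P Q)
    then obtain a n b n' where *: "a \<in> carrier R" "n \<in> N" "P \<odot>\<^bsub>M\<^esub> m = n \<oplus>\<^bsub>M\<^esub> ?c a"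
      "b \<in> carrier R" "n' \<in> N" "Q \<odot>\<^bsub>M\<^esub> m = n' \<oplus>\<^bsub>M\<^esub> ?c b" by auto
    have "(P \<Oplus> Q) \<odot>\<^bsub>M\<^esub> m = P \<odot>\<^bsub>M\<^esub> m \<oplus>\<^bsub>M\<^esub> Q \<odot>\<^bsub>M\<^esub> m"
      using Mo.smult_l_distr[of P Q m] indexed_padd m(1) by (simp add: mpoly_ring_simps)
    also have "\<dots> = (n \<oplus>\<^bsub>M\<^esub> n') \<oplus>\<^bsub>M\<^esub> ?c (a \<oplus> b)"
      using * Nc cM by (simp add: c_add Mo.M.a_ac)
    finally show ?case using * NE(5) by (intro bexI[of _ "a \<oplus> b"] bexI[of _ "n \<oplus>\<^bsub>M\<^esub> n'"]) auto
  next
    case (indexed_pmult P i)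
    have "(P \<Otimes> i) \<odot>\<^bsub>M\<^esub> m = P \<odot>\<^bsub>M\<^esub> (?x i \<odot>\<^bsub>M\<^esub> m)"
      unfolding indexed_pmult_eq_mult_var(1)[OF indexed_pmult(1,2)]
      using indexed_pmult(1) xA[OF indexed_pmult(2)] m(1) by (intro Mo.smult_assoc1) (auto simp: carrier_A)
    moreover have "P \<odot>\<^bsub>M\<^esub> (?x i \<odot>\<^bsub>M\<^esub> m) \<in> N"
      by (rule NE(4)) (use indexed_pmult(1) m(3)[OF indexed_pmult(2)] in \<open>auto simp: carrier_A\<close>)
    ultimately show ?case
      using Nc c_zero by (intro bexI[of _ \<zero>] bexI[of _ "(P \<Otimes> i) \<odot>\<^bsub>M\<^esub> m"]) auto
  qed
  define f where "f = (\<lambda>(c, n). n \<oplus>\<^bsub>M\<^esub> ?c c)"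
  define N' where "N' = f ` (carrier R \<times> N)"
  have inj: "inj_on f (carrier R \<times> N)"
  proof (rule inj_onI, clarify)
    fix c1 n1 c2 n2
    assume c: "c1 \<in> carrier R" "c2 \<in> carrier R" and n: "n1 \<in> N" "n2 \<in> N" and eq: "f (c1, n1) = f (c2, n2)"
    have "c1 = c2"
    proof (rule ccontr)
      assume "c1 \<noteq> c2"
      define e where "e = c1 \<ominus> c2"
      have e: "e \<in> carrier R" "e \<noteq> \<zero>" using c \<open>c1 \<noteq> c2\<close> by (auto simp: e_def r_right_minus_eq)
      have "c1 = e \<oplus> c2" using c by (simp add: e_def a_minus_def a_assoc l_neg)
      then have "(n1 \<oplus>\<^bsub>M\<^esub> ?c e) \<oplus>\<^bsub>M\<^esub> ?c c2 = n2 \<oplus>\<^bsub>M\<^esub> ?c c2"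
        using eq c e n Nc cM by (simp add: f_def c_add Mo.M.a_assoc)
      then have "n1 \<oplus>\<^bsub>M\<^esub> ?c e = n2" using c e n Nc cM by simp
      then have "?c e = \<ominus>\<^bsub>M\<^esub> n1 \<oplus>\<^bsub>M\<^esub> n2"
        using e n Nc cM by (metis Mo.M.a_inv_closed Mo.M.a_assoc Mo.M.l_neg Mo.M.l_zero)
      then have "?c e \<in> N" using NE(3,5) n by simp
      have "indexed_const (inv e) \<odot>\<^bsub>M\<^esub> ?c e \<in> N"
        by (rule NE(4)) (use e cA \<open>?c e \<in> N\<close> in \<open>auto simp: field_Units\<close>)
      moreover have "indexed_const (inv e) \<odot>\<^bsub>M\<^esub> ?c e = m"
      proof -
        have ie: "inv e \<in> carrier R" "inv e \<otimes> e = \<one>" using e by (simp_all add: field_Units)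
        have "indexed_const (inv e) \<odot>\<^bsub>M\<^esub> ?c e = (indexed_const (inv e) \<otimes>\<^bsub>?A\<^esub> indexed_const e) \<odot>\<^bsub>M\<^esub> m"
          by (rule Mo.smult_assoc1[symmetric]) (use ie e cA m(1) in auto)
        then show ?thesis unfolding const_mult[OF ie(1) e(1)] ie(2) c_one .
      qed
      ultimately show False using m(2) by simp
    qed
    moreover have "n1 = n2"
      using eq c n Nc cM calculation by (simp add: f_def)
    ultimately show "c1 = c2 \<and> n1 = n2" by simp
  qed
  have "card N' = card (carrier R) * card N"
    unfolding N'_def card_image[OF inj] by (rule card_cartesian_product)
  moreover have "N \<subseteq> N'"
  proof
    fix n assume n: "n \<in> N"
    then have "n = f (\<zero>, n)" using Nc c_zero by (simp add: f_def)
    then show "n \<in> N'" using n by (auto simp: N'_def)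
  qed
  moreover have "m \<in> N'"
  proof -
    have "m = f (\<one>, \<zero>\<^bsub>M\<^esub>)" using c_one m(1) by (simp add: f_def)
    then show ?thesis using zero by (auto simp: N'_def)
  qed
  moreover have "submodule N' ?A M"
  proof (rule Mo.submoduleI)
    show sub: "N' \<subseteq> carrier M" using Nc cM by (auto simp: N'_def f_def)
    show "\<zero>\<^bsub>M\<^esub> \<in> N'" using \<open>N \<subseteq> N'\<close> zero by auto
    show smult: "P \<odot>\<^bsub>M\<^esub> x \<in> N'" if P: "P \<in> carrier ?A" and x: "x \<in> N'" for P x
    proof -
      obtain c n where cn: "c \<in> carrier R" "n \<in> N" "x = n \<oplus>\<^bsub>M\<^esub> ?c c" using x by (auto simp: N'_def f_def)
      have "P \<otimes>\<^bsub>?A\<^esub> indexed_const c \<in> mpoly_carrier J"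
        using Mo.R.m_closed[OF P cA[OF cn(1)]] by (simp only: carrier_A)
      then obtain c' n' where c': "c' \<in> carrier R" "n' \<in> N"
        "(P \<otimes>\<^bsub>?A\<^esub> indexed_const c) \<odot>\<^bsub>M\<^esub> m = n' \<oplus>\<^bsub>M\<^esub> ?c c'" using act by blast
      have Pn: "P \<odot>\<^bsub>M\<^esub> n \<in> N" using NE(4) P cn by blast
      have "P \<odot>\<^bsub>M\<^esub> x = P \<odot>\<^bsub>M\<^esub> n \<oplus>\<^bsub>M\<^esub> (n' \<oplus>\<^bsub>M\<^esub> ?c c')"
        unfolding c'(3)[symmetric] cn(3) using P cn Nc cA m(1) by (simp add: Mo.smult_r_distr Mo.smult_assoc1)
      also have "\<dots> = f (c', P \<odot>\<^bsub>M\<^esub> n \<oplus>\<^bsub>M\<^esub> n')"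
        using Pn c' Nc cM by (simp add: f_def Mo.M.a_assoc)
      finally show ?thesis using c' Pn NE(5) by (auto simp: N'_def)
    qed
    show "\<ominus>\<^bsub>M\<^esub> x \<in> N'" if x: "x \<in> N'" for x
    proof -
      have "x \<in> carrier M" using x sub by auto
      then have "\<ominus>\<^bsub>M\<^esub> x = (\<ominus>\<^bsub>?A\<^esub> \<one>\<^bsub>?A\<^esub>) \<odot>\<^bsub>M\<^esub> x" by (simp add: Mo.smult_l_minus)
      then show ?thesis using smult x by simp
    qed
    show "x \<oplus>\<^bsub>M\<^esub> y \<in> N'" if xy: "x \<in> N'" "y \<in> N'" for x y
    proof -
      obtain c n c' n' where *: "c \<in> carrier R" "n \<in> N" "x = n \<oplus>\<^bsub>M\<^esub> ?c c"
        "c' \<in> carrier R" "n' \<in> N" "y = n' \<oplus>\<^bsub>M\<^esub> ?c c'" using xy by (auto simp: N'_def f_def)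
      have "x \<oplus>\<^bsub>M\<^esub> y = f (c \<oplus> c', n \<oplus>\<^bsub>M\<^esub> n')"
        using * Nc cM by (simp add: f_def c_add Mo.M.a_ac)
      then show ?thesis using * NE(5) by (auto simp: N'_def)
    qed
  qed
  ultimately show ?thesis using m(2) by blast
qed


section \<open>Reducing the colength to a kernel of shift operators\<close>

text \<open>
  Reversing the exponents in the cube of side \<open>q\<close> turns multiplication by a variable into the lowering
  shift.
\<close>

definition reverse_monomial :: "'i set \<Rightarrow> nat \<Rightarrow> ('i \<Rightarrow> nat) \<Rightarrow> 'i multiset"
  where "reverse_monomial J q m = (\<Sum>i\<in>J. replicate_mset (q - 1 - m i) i)"

lemma count_reverse_monomial:
  "finite J \<Longrightarrow> count (reverse_monomial J q m) i = (if i \<in> J then q - 1 - m i else 0)"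
  unfolding reverse_monomial_def by (simp add: count_sum)

lemma (in ring) pmult_pow_apply:
  "((\<lambda>Q. Q \<Otimes> i) ^^ n) P \<mu> = (if count \<mu> i \<ge> n then P (\<mu> - replicate_mset n i) else \<zero>)"
proof (induction n arbitrary: \<mu>)
  case (Suc n)
  show ?case
  proof (cases "i \<in># \<mu>")
    case True
    then obtain \<nu> where \<mu>: "\<mu> = add_mset i \<nu>" by (auto dest: multi_member_split)
    have "((\<lambda>Q. Q \<Otimes> i) ^^ Suc n) P \<mu> = ((\<lambda>Q. Q \<Otimes> i) ^^ n) P \<nu>"
      by (simp add: indexed_pmult_def \<mu>)
    then show ?thesis unfolding Suc.IH by (simp add: \<mu>)
  next
    case False
    then have "count \<mu> i = 0" by (simp add: not_in_iff)
    then show ?thesis using False by (simp add: indexed_pmult_def[of _ i])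
  qed
qed simp

locale residue_polynomials =
  fixes p :: nat and J :: "'i set" and q :: nat
  assumes prime_p: "Factorial_Ring.prime p" and finite_J: "finite J"
begin

abbreviation "K \<equiv> residue_ring (int p)"
abbreviation "A \<equiv> mpoly_ring K J"

sublocale K: residues_prime p K
  by unfold_locales (rule prime_p)

sublocale G: prime_torsion p "range (residue_at p)"
  by (rule prime_torsion_residue_at) (rule prime_p)

sublocale A: cring A
  by (rule K.mpoly_ring_cring)

lemma coeff_range: "P \<in> carrier A \<Longrightarrow> 0 \<le> P \<mu> \<and> P \<mu> < int p"
  using K.mpoly_carrier_coeff[of P J] K.res_carrier_eq
  by (auto simp: K.mpoly_ring_simps K.carrier_coeff_def)

text \<open>
  This map identifies the ring modulo \<open>(x\<^sub>i^q)\<close> with the functions supported in the cube: \<open>dual_image\<close> gives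
  surjectivity, \<open>dual_eq_zero_imp_mem\<close> determines the kernel, and \<open>dual_var_pow\<close> translates the multiplication.
\<close>

definition dual :: "('i multiset \<Rightarrow> int) \<Rightarrow> ('i \<Rightarrow> nat) \<Rightarrow> residue_family"
  where "dual P = (\<lambda>m. if m \<in> box J (\<lambda>_. q) then residue_at p (P (reverse_monomial J q m)) else 0)"

lemma dual_zero: "dual \<zero>\<^bsub>A\<^esub> = 0"
  by (auto simp: dual_def K.mpoly_ring_simps K.indexed_const_def K.res_zero_eq residue_at_0)

lemma dual_add: "dual (P \<oplus>\<^bsub>A\<^esub> Q) = dual P + dual Q"
  by (auto simp: dual_def K.mpoly_ring_simps K.indexed_padd_def K.res_add_eq residue_at_mod residue_at_add)

lemma dual_uminus:
  assumes "P \<in> carrier A"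
  shows "dual (\<ominus>\<^bsub>A\<^esub> P) = - dual P"
proof -
  have "dual (\<ominus>\<^bsub>A\<^esub> P) + dual P = 0"
    using assms by (simp flip: dual_add add: A.l_neg dual_zero)
  then show ?thesis by (simp add: eq_neg_iff_add_eq_0)
qed

lemma dual_minus: "P \<in> carrier A \<Longrightarrow> Q \<in> carrier A \<Longrightarrow> dual (P \<ominus>\<^bsub>A\<^esub> Q) = dual P - dual Q"
  by (simp add: a_minus_def dual_add dual_uminus)

lemma dual_var_pow:
  assumes "P \<in> carrier A" "i \<in> J"
  shows "dual ((K.indexed_var i [^]\<^bsub>A\<^esub> (n::nat)) \<otimes>\<^bsub>A\<^esub> P) = (\<lambda>m. dual P (m(i := m i + n)))"
proof
  fix m
  have P: "P \<in> K.mpoly_carrier J" using assms by (simp add: K.mpoly_ring_simps)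
  have cm: "count (reverse_monomial J q m) i = q - 1 - m i" using assms(2) finite_J by (simp add: count_reverse_monomial)
  show "dual ((K.indexed_var i [^]\<^bsub>A\<^esub> n) \<otimes>\<^bsub>A\<^esub> P) m = dual P (m(i := m i + n))"
  proof (cases "m \<in> box J (\<lambda>_. q)")
    case True
    then have mi: "m i < q" using assms(2) by (auto simp: box_def)
    show ?thesis
    proof (cases "m i + n < q")
      case t: True
      have "m(i := m i + n) \<in> box J (\<lambda>_. q)" using True t assms(2) by (auto simp: box_def)
      moreover have "reverse_monomial J q m - replicate_mset n i = reverse_monomial J q (m(i := m i + n))"
        using finite_J by (auto simp: multiset_eq_iff count_reverse_monomial)
      moreover have "n \<le> count (reverse_monomial J q m) i" unfolding cm using t by simp
      ultimately show ?thesis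
        unfolding K.var_pow_mult(1)[OF P assms(2)] dual_def K.pmult_pow_apply using True by simp
    next
      case f: False
      have "m(i := m i + n) \<notin> box J (\<lambda>_. q)" using f assms(2) by (auto simp: box_def)
      moreover have "\<not> n \<le> count (reverse_monomial J q m) i" unfolding cm using f mi by simp
      ultimately show ?thesis
        unfolding K.var_pow_mult(1)[OF P assms(2)] dual_def K.pmult_pow_apply using True
        by (simp add: K.res_zero_eq residue_at_0)
    qed
  next
    case False
    have "m(i := m i + n) \<notin> box J (\<lambda>_. q)"
    proof
      assume h: "m(i := m i + n) \<in> box J (\<lambda>_. q)"
      have "m k < q" if "k \<in> J" for k
      proof -
        have "(m(i := m i + n)) k < q" using h that by (auto simp: box_def)
        then show ?thesis by (auto split: if_splits)
      qed
      moreover have "m k = 0" if "k \<notin> J" for k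
      proof -
        have "(m(i := m i + n)) k = 0" using h that by (auto simp: box_def)
        then show ?thesis by (auto split: if_splits)
      qed
      ultimately show False using False by (auto simp: box_def)
    qed
    with False show ?thesis by (simp add: dual_def)
  qed
qed

lemma var_closed: "i \<in> J \<Longrightarrow> K.indexed_var i \<in> carrier A"
  using K.indexed_var_closed by (simp add: K.mpoly_ring_simps)

lemma dual_diagonal:
  assumes P: "P \<in> carrier A"
  shows "dual (finsum A (\<lambda>i. K.indexed_var i [^]\<^bsub>A\<^esub> d i) J \<otimes>\<^bsub>A\<^esub> P) = shift_sum d J (dual P)"
proof -
  have "dual (finsum A (\<lambda>i. K.indexed_var i [^]\<^bsub>A\<^esub> d i) I \<otimes>\<^bsub>A\<^esub> P) = shift_sum d I (dual P)"
    if "finite I" "I \<subseteq> J" for I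
    using that
  proof (induction I)
    case empty
    then show ?case using P by (simp add: dual_zero shift_sum_def zero_fun_def)
  next
    case (insert i I)
    have i: "i \<in> J" using insert by simp
    have closed: "(\<lambda>i. K.indexed_var i [^]\<^bsub>A\<^esub> d i) \<in> I \<rightarrow> carrier A" using insert var_closed by auto
    have "finsum A (\<lambda>i. K.indexed_var i [^]\<^bsub>A\<^esub> d i) (insert i I) \<otimes>\<^bsub>A\<^esub> P
        = (K.indexed_var i [^]\<^bsub>A\<^esub> d i) \<otimes>\<^bsub>A\<^esub> P \<oplus>\<^bsub>A\<^esub> finsum A (\<lambda>i. K.indexed_var i [^]\<^bsub>A\<^esub> d i) I \<otimes>\<^bsub>A\<^esub> P"
      using insert(1,2) closed var_closed[OF i] P by (simp add: A.l_distr)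
    then have "dual (finsum A (\<lambda>i. K.indexed_var i [^]\<^bsub>A\<^esub> d i) (insert i I) \<otimes>\<^bsub>A\<^esub> P)
        = (\<lambda>m. dual P (m(i := m i + d i))) + shift_sum d I (dual P)"
      using insert by (simp only: dual_add dual_var_pow[OF P i]) simp
    then show ?case using insert(1,2) by (auto simp: shift_sum_def)
  qed
  from this[OF finite_J subset_refl] show ?thesis .
qed

lemma dual_image: "dual ` carrier A = G.V J (\<lambda>_. q)"
proof
  show "dual ` carrier A \<subseteq> G.V J (\<lambda>_. q)"
    by (auto simp: dual_def G.V_def G.G_simps)
  show "G.V J (\<lambda>_. q) \<subseteq> dual ` carrier A"
  proof
    fix v assume v: "v \<in> G.V J (\<lambda>_. q)"
    have "\<exists>k\<in>{0..int p - 1}. residue_at p k = v m" for m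
    proof -
      have "v m \<in> range (residue_at p)" using v by (simp add: G.V_def)
      then show ?thesis
        using bij_residue_at[of p] G.p_gt_1 unfolding bij_betw_def by (metis imageE less_trans zero_less_one)
    qed
    then obtain c where c: "\<And>m. c m \<in> {0..int p - 1}" "\<And>m. residue_at p (c m) = v m" by metis
    let ?B = "reverse_monomial J q ` box J (\<lambda>_. q)"
    define P where "P = (\<lambda>\<mu>. if \<mu> \<in> ?B then c (\<lambda>i. if i \<in> J then q - 1 - count \<mu> i else 0) else 0)"
    have "P \<in> K.mpoly_carrier J"
    proof (rule K.mpoly_carrierI)
      show "finite {\<mu>. P \<mu> \<noteq> \<zero>\<^bsub>K\<^esub>}"
        by (rule finite_subset[of _ ?B]) (auto simp: P_def K.res_zero_eq finite_box finite_J)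
      show "K.carrier_coeff P"
        using c(1) G.p_gt_1 by (auto simp: K.carrier_coeff_def P_def K.res_carrier_eq)
      show "set_mset \<mu> \<subseteq> J" if "P \<mu> \<noteq> \<zero>\<^bsub>K\<^esub>" for \<mu>
      proof -
        have "\<mu> \<in> ?B" using that by (auto simp: P_def K.res_zero_eq split: if_splits)
        then have "count \<mu> i = 0" if "i \<notin> J" for i
          using that finite_J by (auto simp: count_reverse_monomial)
        then show ?thesis by (auto simp flip: count_greater_zero_iff) (metis less_numeral_extra(3))
      qed
    qed
    moreover have "dual P = v"
    proof
      fix m
      show "dual P m = v m"
      proof (cases "m \<in> box J (\<lambda>_. q)")
        case True
        then have "(\<lambda>i. if i \<in> J then q - 1 - count (reverse_monomial J q m) i else 0) = m"
          using finite_J by (fastforce simp: count_reverse_monomial box_def fun_eq_iff)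
        then show ?thesis using True c(2) by (simp add: dual_def P_def)
      next
        case False
        then show ?thesis using v by (simp add: dual_def G.V_def)
      qed
    qed
    ultimately show "v \<in> dual ` carrier A" by (auto simp: K.mpoly_ring_simps)
  qed
qed

text \<open>
  The coefficients of all monomials in the cube vanish, so each term of \<open>P\<close> is divisible by some \<open>x\<^sub>i^q\<close>.
\<close>

lemma dual_eq_zero_imp_mem:
  assumes I: "ideal I A" "\<And>i. i \<in> J \<Longrightarrow> K.indexed_var i [^]\<^bsub>A\<^esub> q \<in> I"
    and P: "P \<in> carrier A" "dual P = 0"
  shows "P \<in> I"
proof -
  interpret I: ideal I A by fact
  have P': "P \<in> K.mpoly_carrier J" using P by (simp add: K.mpoly_ring_simps)
  show ?thesis
  proof (rule K.finite_support_mem)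
    show "finite {\<mu>. P \<mu> \<noteq> \<zero>\<^bsub>K\<^esub>}" by (rule K.mpoly_carrier_support(1)[OF P'])
    show "K.carrier_coeff P" by (rule K.mpoly_carrier_coeff[OF P'])
    show "K.indexed_const \<zero>\<^bsub>K\<^esub> \<in> I" using I.zero_closed by (simp add: K.mpoly_ring_simps)
    show "K.indexed_padd Q Q' \<in> I" if "Q \<in> I" "Q' \<in> I" for Q Q'
      using I.a_closed[OF that] by (simp add: K.mpoly_ring_simps)
    fix \<mu> assume nz: "P \<mu> \<noteq> \<zero>\<^bsub>K\<^esub>"
    have sub: "set_mset \<mu> \<subseteq> J" by (rule K.mpoly_carrier_support(2)[OF P' nz])
    have "\<exists>i\<in>J. count \<mu> i \<ge> q"
    proof (rule ccontr)
      assume "\<not> (\<exists>i\<in>J. count \<mu> i \<ge> q)"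
      then have lt: "count \<mu> i < q" if "i \<in> J" for i using that by force
      define m where "m = (\<lambda>i. if i \<in> J then q - 1 - count \<mu> i else 0)"
      have "m \<in> box J (\<lambda>_. q)" using lt by (force simp: m_def box_def)
      moreover have "reverse_monomial J q m = \<mu>"
      proof (rule multiset_eqI)
        fix i
        show "count (reverse_monomial J q m) i = count \<mu> i"
          using lt[of i] sub finite_J
          by (cases "i \<in> J") (auto simp: count_reverse_monomial m_def not_in_iff)
      qed
      ultimately have "residue_at p (P \<mu>) = 0" using fun_cong[OF P(2), of m] by (simp add: dual_def)
      then have "int p dvd P \<mu>" by (simp add: residue_at_eq_0_iff)
      then have "P \<mu> = 0" using coeff_range[OF P(1), of \<mu>] zdvd_imp_le[of "int p" "P \<mu>"] by linarith
      then show False using nz by (simp add: K.res_zero_eq)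
    qed
    then obtain i where i: "i \<in> J" "count \<mu> i \<ge> q" by blast
    define \<nu> where "\<nu> = \<mu> - replicate_mset q i"
    have \<mu>: "\<mu> = replicate_mset q i + \<nu>"
      unfolding \<nu>_def using i(2) by (simp add: count_le_replicate_mset_subset_eq)
    have "P \<mu> \<in> carrier K" using K.mpoly_carrier_coeff[OF P'] by (simp add: K.carrier_coeff_def)
    moreover have "set_mset \<nu> \<subseteq> J" using sub \<mu> by auto
    ultimately have \<nu>: "K.monomial (P \<mu>) \<nu> \<in> K.mpoly_carrier J" by (rule K.monomial_closed)
    have "K.monomial (P \<mu>) \<mu> = (K.indexed_var i [^]\<^bsub>A\<^esub> q) \<otimes>\<^bsub>A\<^esub> K.monomial (P \<mu>) \<nu>"
      unfolding K.var_pow_mult(1)[OF \<nu> i(1)] by (subst (2) \<mu>) (rule K.monomial_replicate)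
    also have "\<dots> \<in> I"
      using \<nu> by (intro I.I_r_closed I(2) i(1)) (simp add: K.mpoly_ring_simps)
    finally show "K.monomial (P \<mu>) \<mu> \<in> I" .
  qed
qed

definition diag :: "('i \<Rightarrow> nat) \<Rightarrow> 'i multiset \<Rightarrow> int"
  where "diag d = finsum A (\<lambda>i. K.indexed_var i [^]\<^bsub>A\<^esub> d i) J"

definition diag_ideal :: "('i \<Rightarrow> nat) \<Rightarrow> ('i multiset \<Rightarrow> int) set"
  where "diag_ideal d = Idl\<^bsub>A\<^esub> (insert (diag d) ((\<lambda>i. K.indexed_var i [^]\<^bsub>A\<^esub> q) ` J))"

lemma diag_closed: "diag d \<in> carrier A"
  unfolding diag_def using var_closed by (intro A.finsum_closed) auto

lemma diag_gens: "insert (diag d) ((\<lambda>i. K.indexed_var i [^]\<^bsub>A\<^esub> q) ` J) \<subseteq> carrier A"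
  using diag_closed var_closed by auto

lemma diag_ideal: "ideal (diag_ideal d) A"
  unfolding diag_ideal_def by (rule A.genideal_ideal[OF diag_gens])

lemma gens_mem_diag_ideal:
  "diag d \<in> diag_ideal d" "i \<in> J \<Longrightarrow> K.indexed_var i [^]\<^bsub>A\<^esub> q \<in> diag_ideal d"
  using A.genideal_self[OF diag_gens, of d] by (auto simp: diag_ideal_def)

lemma dual_one_mult_pow_q:
  assumes "P \<in> carrier A" "i \<in> J"
  shows "dual ((K.indexed_var i [^]\<^bsub>A\<^esub> q) \<otimes>\<^bsub>A\<^esub> P) = 0"
proof
  fix m
  have "m(i := m i + q) \<notin> box J (\<lambda>_. q)" using assms(2) by (auto simp: box_def)
  then show "dual ((K.indexed_var i [^]\<^bsub>A\<^esub> q) \<otimes>\<^bsub>A\<^esub> P) m = 0 m"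
    unfolding dual_var_pow[OF assms] by (simp add: dual_def)
qed

text \<open>
  If \<open>P\<close> corresponds to \<open>h Q\<close>, then \<open>P - h Q\<close> lies in \<open>(x\<^sub>i^q)\<close>. Conversely, the polynomials all of whose multiples
  correspond to multiples of \<open>h\<close> form an ideal containing the generators.
\<close>

lemma mem_diag_ideal_iff:
  assumes P: "P \<in> carrier A"
  shows "P \<in> diag_ideal d \<longleftrightarrow> dual P \<in> shift_sum d J ` G.V J (\<lambda>_. q)"
proof
  assume "dual P \<in> shift_sum d J ` G.V J (\<lambda>_. q)"
  then obtain Q where Q: "Q \<in> carrier A" "dual P = shift_sum d J (dual Q)"
    unfolding dual_image[symmetric] by auto
  interpret I: ideal "diag_ideal d" A by (rule diag_ideal)
  have hQ: "diag d \<otimes>\<^bsub>A\<^esub> Q \<in> diag_ideal d" by (rule I.I_r_closed[OF gens_mem_diag_ideal(1) Q(1)])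
  have hQc: "diag d \<otimes>\<^bsub>A\<^esub> Q \<in> carrier A" using diag_closed Q by simp
  have "dual (P \<ominus>\<^bsub>A\<^esub> diag d \<otimes>\<^bsub>A\<^esub> Q) = 0"
    unfolding dual_minus[OF P hQc] Q(2) unfolding diag_def dual_diagonal[OF Q(1)] by simp
  then have "P \<ominus>\<^bsub>A\<^esub> diag d \<otimes>\<^bsub>A\<^esub> Q \<in> diag_ideal d"
    using P hQc by (intro dual_eq_zero_imp_mem[OF diag_ideal gens_mem_diag_ideal(2)]) auto
  then have "(P \<ominus>\<^bsub>A\<^esub> diag d \<otimes>\<^bsub>A\<^esub> Q) \<oplus>\<^bsub>A\<^esub> diag d \<otimes>\<^bsub>A\<^esub> Q \<in> diag_ideal d"
    using hQ by (rule I.a_closed)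
  also have "(P \<ominus>\<^bsub>A\<^esub> diag d \<otimes>\<^bsub>A\<^esub> Q) \<oplus>\<^bsub>A\<^esub> diag d \<otimes>\<^bsub>A\<^esub> Q = P"
    using P hQc by (simp add: a_minus_def A.a_assoc A.l_neg)
  finally show "P \<in> diag_ideal d" .
next
  let ?W = "shift_sum d J ` G.V J (\<lambda>_. q)"
  let ?T = "{P \<in> carrier A. \<forall>Q\<in>carrier A. dual (P \<otimes>\<^bsub>A\<^esub> Q) \<in> ?W}"
  have W: "add_subgroup ?W" by (rule add_subgroup_image[OF G.V_subgroup]) (rule shift_sum_diff)
  have "ideal ?T A"
  proof (rule idealI)
    show "ring A" by (rule A.ring_axioms)
    show "subgroup ?T (add_monoid A)"
    proof (rule A.add.subgroupI)
      show "?T \<subseteq> carrier A" by auto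
      have "\<zero>\<^bsub>A\<^esub> \<in> ?T" using add_subgroupD(1)[OF W] by (simp add: dual_zero)
      then show "?T \<noteq> {}" by blast
      show "\<ominus>\<^bsub>A\<^esub> a \<in> ?T" if "a \<in> ?T" for a
        using that add_subgroupD(3)[OF W] by (auto simp: A.l_minus dual_uminus)
      show "a \<oplus>\<^bsub>A\<^esub> b \<in> ?T" if "a \<in> ?T" "b \<in> ?T" for a b
        using that add_subgroupD(4)[OF W] by (auto simp: A.l_distr dual_add)
    qed
    show "x \<otimes>\<^bsub>A\<^esub> a \<in> ?T" if "a \<in> ?T" "x \<in> carrier A" for a x
    proof -
      have "(x \<otimes>\<^bsub>A\<^esub> a) \<otimes>\<^bsub>A\<^esub> Q = a \<otimes>\<^bsub>A\<^esub> (x \<otimes>\<^bsub>A\<^esub> Q)" if "Q \<in> carrier A" for Q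
        using that \<open>a \<in> ?T\<close> \<open>x \<in> carrier A\<close> by (simp add: A.m_ac)
      then show ?thesis using that by simp
    qed
    show "a \<otimes>\<^bsub>A\<^esub> x \<in> ?T" if "a \<in> ?T" "x \<in> carrier A" for a x
      using that by (auto simp: A.m_assoc)
  qed
  moreover have "insert (diag d) ((\<lambda>i. K.indexed_var i [^]\<^bsub>A\<^esub> q) ` J) \<subseteq> ?T"
  proof -
    have "diag d \<in> ?T"
    proof (intro CollectI conjI ballI diag_closed)
      fix Q assume Q: "Q \<in> carrier A"
      then have "dual Q \<in> G.V J (\<lambda>_. q)" using dual_image by blast
      then show "dual (diag d \<otimes>\<^bsub>A\<^esub> Q) \<in> ?W" unfolding diag_def dual_diagonal[OF Q] by (rule imageI)
    qed
    moreover have "K.indexed_var i [^]\<^bsub>A\<^esub> q \<in> ?T" if "i \<in> J" for i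
      using that var_closed add_subgroupD(1)[OF W] by (simp add: dual_one_mult_pow_q)
    ultimately show ?thesis by blast
  qed
  ultimately have "diag_ideal d \<subseteq> ?T" unfolding diag_ideal_def by (rule A.genideal_minimal)
  moreover assume "P \<in> diag_ideal d"
  ultimately have "dual (P \<otimes>\<^bsub>A\<^esub> \<one>\<^bsub>A\<^esub>) \<in> ?W" by blast
  then show "dual P \<in> ?W" using P by simp
qed

lemma card_ker_mult_card_image:
  "card (G.ker_pow d J (\<lambda>_. q) 1) * card (shift_sum d J ` G.V J (\<lambda>_. q)) = card (G.V J (\<lambda>_. q))"
proof -
  have "card {v \<in> G.V J (\<lambda>_. q). shift_sum d J v = 0} * card (shift_sum d J ` G.V J (\<lambda>_. q))
      = card (G.V J (\<lambda>_. q))"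
    by (rule card_kernel_mult_card_image[OF G.finite_V[OF finite_J] G.V_subgroup]) (rule shift_sum_diff)
  then show ?thesis by (simp add: G.ker_pow_def)
qed

text \<open>
  The quotient is in bijection with the cokernel of the operator \<open>h\<close> on the functions supported in the cube,
  and a kernel and a cokernel of an endomorphism of a finite group have the same size.
\<close>

lemma card_quotient:
  "card (carrier (A Quot diag_ideal d)) = card (G.ker_pow d J (\<lambda>_. q) 1)"
proof -
  let ?V = "G.V J (\<lambda>_. q)" and ?I = "diag_ideal d"
  let ?W = "shift_sum d J ` ?V"
  interpret I: ideal ?I A by (rule diag_ideal)
  have W: "add_subgroup ?W" by (rule add_subgroup_image[OF G.V_subgroup]) (rule shift_sum_diff)
  note WD = add_subgroupD[OF W]
  have WV: "?W \<subseteq> ?V" using G.shift_sum_V[OF subset_refl] by auto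
  have fV: "finite ?V" by (rule G.finite_V[OF finite_J])
  have "carrier (A Quot ?I) = (+>\<^bsub>A\<^esub>) ?I ` carrier A"
    by (auto simp: FactRing_def A_RCOSETS_def')
  also have "card \<dots> = card ((\<lambda>P. {w \<in> ?V. w - dual P \<in> ?W}) ` carrier A)"
  proof (rule card_same_fibers)
    fix P Q assume PQ: "P \<in> carrier A" "Q \<in> carrier A"
    have PV: "dual P \<in> ?V" using PQ dual_image by blast
    have "?I +>\<^bsub>A\<^esub> P = ?I +>\<^bsub>A\<^esub> Q \<longleftrightarrow> P \<ominus>\<^bsub>A\<^esub> Q \<in> ?I"
      using A.quotient_eq_iff_same_a_r_cos[OF I.ideal_axioms PQ] by simp
    also have "\<dots> \<longleftrightarrow> dual P - dual Q \<in> ?W"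
      using mem_diag_ideal_iff[of "P \<ominus>\<^bsub>A\<^esub> Q"] PQ by (simp add: dual_minus)
    also have "\<dots> \<longleftrightarrow> {w \<in> ?V. w - dual P \<in> ?W} = {w \<in> ?V. w - dual Q \<in> ?W}"
    proof
      assume d: "dual P - dual Q \<in> ?W"
      have "w - dual P \<in> ?W \<longleftrightarrow> w - dual Q \<in> ?W" for w
        using WD(4)[OF _ d, of "w - dual P"] WD(2)[OF _ d, of "w - dual Q"] by auto
      then show "{w \<in> ?V. w - dual P \<in> ?W} = {w \<in> ?V. w - dual Q \<in> ?W}" by simp
    next
      assume "{w \<in> ?V. w - dual P \<in> ?W} = {w \<in> ?V. w - dual Q \<in> ?W}"
      moreover have "dual P \<in> {w \<in> ?V. w - dual P \<in> ?W}" using PV WD(1) by simp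
      ultimately show "dual P - dual Q \<in> ?W" by blast
    qed
    finally show "?I +>\<^bsub>A\<^esub> P = ?I +>\<^bsub>A\<^esub> Q \<longleftrightarrow> {w \<in> ?V. w - dual P \<in> ?W} = {w \<in> ?V. w - dual Q \<in> ?W}" .
  qed
  also have "(\<lambda>P. {w \<in> ?V. w - dual P \<in> ?W}) ` carrier A = (\<lambda>v. {w \<in> ?V. w - v \<in> ?W}) ` ?V"
    unfolding dual_image[symmetric] image_image ..
  finally have "card (carrier (A Quot ?I)) * card ?W = card ?V"
    using card_cosets_mult_card[OF fV G.V_subgroup W WV] by simp
  also have "\<dots> = card (G.ker_pow d J (\<lambda>_. q) 1) * card ?W"
    by (rule card_ker_mult_card_image[symmetric])
  finally have eq: "card (carrier (A Quot ?I)) * card ?W = card (G.ker_pow d J (\<lambda>_. q) 1) * card ?W" .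
  have "card ?W > 0" using fV WD(1) by (auto simp: card_gt_0_iff)
  with eq show ?thesis by simp
qed

text \<open>
  The only simple module involved is \<open>\<int>/p\<close>, so the length is the logarithm of the number of elements.
\<close>

lemma colength_diag_ideal:
  "\<exists>k. colength A (diag_ideal d) = enat k \<and> real k = log p (card (G.ker_pow d J (\<lambda>_. q) 1))"
proof -
  let ?I = "diag_ideal d" and ?ker = "G.ker_pow d J (\<lambda>_. q) 1"
  interpret I: ideal ?I A by (rule diag_ideal)
  have "card ?ker * card (shift_sum d J ` G.V J (\<lambda>_. q)) = p ^ (\<Prod>i\<in>J. q)"
    unfolding card_ker_mult_card_image by (rule G.card_V[OF finite_J])
  then have "card ?ker dvd p ^ (\<Prod>i\<in>J. q)" by (metis dvd_triv_left)
  then obtain k where k: "card ?ker = p ^ k" using divides_primepow_nat[OF prime_p] by auto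
  let ?M = "quot_module A ?I"
  have sel: "carrier ?M = carrier (A Quot ?I)" "zero ?M = zero (A Quot ?I)"
    "smult ?M = (\<lambda>r x. (?I +>\<^bsub>A\<^esub> r) \<otimes>\<^bsub>A Quot ?I\<^esub> x)"
    by (simp_all add: quot_module_def ring.defs module.defs)
  have M: "module A ?M" by (rule quot_module_module[OF A.is_cring I.ideal_axioms])
  have card: "card (carrier ?M) = p ^ k" unfolding sel card_quotient k ..
  have fin: "finite (carrier ?M)" using card G.p_gt_1 by (simp add: card_ge_0_finite)
  have hom: "(+>\<^bsub>A\<^esub>) ?I \<in> ring_hom A (A Quot ?I)" by (rule I.rcos_ring_hom)
  interpret Q: cring "A Quot ?I" by (rule I.quotient_is_cring) (rule A.is_cring)
  have "module_length A ?M = enat k"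
  proof (rule module_length_of_prime_power_card[OF M fin card prime_p])
    fix N assume N: "submodule N A ?M" "N \<noteq> carrier ?M"
    have "\<exists>N'. submodule N' A ?M \<and> N \<subset> N' \<and> card N' = card (carrier K) * card N"
    proof (rule K.submodule_extension[OF M finite_J _ N])
      fix i x assume i: "i \<in> J" and x: "x \<in> carrier ?M"
      have "?I +>\<^bsub>A\<^esub> (K.indexed_var i [^]\<^bsub>A\<^esub> q) = ?I"
        by (rule I.a_rcos_const) (rule gens_mem_diag_ideal(2)[OF i])
      then have "?I +>\<^bsub>A\<^esub> (K.indexed_var i [^]\<^bsub>A\<^esub> q) = \<zero>\<^bsub>A Quot ?I\<^esub>" by (simp add: FactRing_def)
      then show "\<exists>n::nat. (K.indexed_var i [^]\<^bsub>A\<^esub> n) \<odot>\<^bsub>?M\<^esub> x = \<zero>\<^bsub>?M\<^esub>"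
        using x by (intro exI[of _ q]) (simp add: sel)
    qed
    moreover have "card (carrier K) = p" by (simp add: residue_ring_def)
    ultimately show "\<exists>N'. submodule N' A ?M \<and> N \<subset> N' \<and> card N' = p * card N" by simp
  qed
  moreover have "real k = log p (card ?ker)" unfolding k by (rule G.log_p_power[symmetric])
  ultimately show ?thesis by (auto simp: colength_def)
qed

end

section \<open>Passing to the limit\<close>

context prime_torsion
begin

lemma residue_bound_estimate:
  assumes "0 < q" "r < d"
  shows "\<bar>real ((q + d - 1 - r) div d) - real (q div d)\<bar> \<le> 1" "(q + d - 1 - r) div d \<le> q"
proof -
  have "q div d \<le> (q + d - 1 - r) div d" using assms by (intro div_le_mono) simp
  moreover have "(q + d - 1 - r) div d \<le> (q + d) div d" by (intro div_le_mono) simp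
  moreover have "(q + d) div d = q div d + 1" using assms by simp
  ultimately show "\<bar>real ((q + d - 1 - r) div d) - real (q div d)\<bar> \<le> 1" by simp
  have "q + d - 1 - r < Suc q * d"
    using assms by (cases d) (auto simp: less_Suc_eq_le trans_le_add1)
  then show "(q + d - 1 - r) div d \<le> q" using assms by (metis less_Suc_eq_le less_mult_imp_div_less)
qed

text \<open>
  Each of the \<open>d_1 \<cdots> d_s\<close> summands of \<open>e_n\<close> belongs to a box whose sides differ by at most 1 from
  \<open>\<lfloor>q/d_i\<rfloor>\<close>.
\<close>

lemma sum_D_estimate:
  assumes I: "finite I" "card I \<ge> 2" and d: "\<And>i. i \<in> I \<Longrightarrow> d i > 0" and q: "q > 0"
  shows "\<bar>(\<Sum>r\<in>box I d. D I (residue_bound d (\<lambda>_. q) r)) / real q ^ (card I - 1)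
      - real (\<Prod>i\<in>I. d i) * (D I (\<lambda>i. q div d i) / real q ^ (card I - 1))\<bar>
    \<le> real (\<Prod>i\<in>I. d i) * (real (card I) / real q)"
proof -
  have each: "\<bar>D I (residue_bound d (\<lambda>_. q) r) - D I (\<lambda>i. q div d i)\<bar> \<le> real q ^ (card I - 2) * real (card I)"
    if r: "r \<in> box I d" for r
  proof -
    have rd: "r i < d i" if "i \<in> I" for i using r that by (auto simp: box_def)
    have "\<bar>D I (residue_bound d (\<lambda>_. q) r) - D I (\<lambda>i. q div d i)\<bar>
        \<le> real q ^ (card I - 2) * (\<Sum>i\<in>I. \<bar>real (residue_bound d (\<lambda>_. q) r i) - real (q div d i)\<bar>)"
      using residue_bound_estimate(2)[OF q rd]
      by (intro D_lipschitz I) (auto simp: residue_bound_def)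
    also have "\<dots> \<le> real q ^ (card I - 2) * (\<Sum>i\<in>I. 1)"
      using residue_bound_estimate(1)[OF q rd]
      by (intro mult_left_mono sum_mono) (auto simp: residue_bound_def)
    finally show ?thesis by simp
  qed
  have "\<bar>(\<Sum>r\<in>box I d. D I (residue_bound d (\<lambda>_. q) r)) - real (\<Prod>i\<in>I. d i) * D I (\<lambda>i. q div d i)\<bar>
      = \<bar>\<Sum>r\<in>box I d. D I (residue_bound d (\<lambda>_. q) r) - D I (\<lambda>i. q div d i)\<bar>"
    by (simp add: sum_subtractf card_box[OF I(1)])
  also have "\<dots> \<le> (\<Sum>r\<in>box I d. real q ^ (card I - 2) * real (card I))"
    by (rule order_trans[OF sum_abs]) (intro sum_mono each)
  also have "\<dots> = real (\<Prod>i\<in>I. d i) * (real q ^ (card I - 2) * real (card I))"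
    by (simp add: card_box[OF I(1)])
  finally have *: "\<bar>(\<Sum>r\<in>box I d. D I (residue_bound d (\<lambda>_. q) r)) - real (\<Prod>i\<in>I. d i) * D I (\<lambda>i. q div d i)\<bar>
      \<le> real (\<Prod>i\<in>I. d i) * (real q ^ (card I - 2) * real (card I))" .
  have pow: "real q ^ (card I - 1) = real q ^ (card I - 2) * real q"
    using I(2) by (metis Suc_diff_Suc Suc_1 Suc_le_eq mult.commute power_Suc diff_Suc_1 diff_diff_left plus_1_eq_Suc)
  have "\<bar>(\<Sum>r\<in>box I d. D I (residue_bound d (\<lambda>_. q) r)) / real q ^ (card I - 1)
      - real (\<Prod>i\<in>I. d i) * (D I (\<lambda>i. q div d i) / real q ^ (card I - 1))\<bar>
    = \<bar>(\<Sum>r\<in>box I d. D I (residue_bound d (\<lambda>_. q) r)) - real (\<Prod>i\<in>I. d i) * D I (\<lambda>i. q div d i)\<bar> / real q ^ (card I - 1)"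
    by (simp add: diff_divide_distrib[symmetric])
  also have "\<dots> \<le> real (\<Prod>i\<in>I. d i) * (real q ^ (card I - 2) * real (card I)) / real q ^ (card I - 1)"
    by (rule divide_right_mono[OF *]) simp
  also have "\<dots> = real (\<Prod>i\<in>I. d i) * (real (card I) / real q)"
    using q unfolding pow by simp
  finally show ?thesis .
qed

definition density :: "'i set \<Rightarrow> ('i \<Rightarrow> nat) \<Rightarrow> nat \<Rightarrow> real"
  where "density I d n = D I (\<lambda>i. p ^ n div d i) / real (p ^ n) ^ (card I - 1)"

text \<open>
  Scaling the box with sides \<open>\<lfloor>p^m/d_i\<rfloor>\<close> by \<open>p^k\<close> does not change the density, and it changes the sides by at
  most \<open>p^k\<close> compared with \<open>\<lfloor>p^{m+k}/d_i\<rfloor>\<close>.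
\<close>

lemma density_estimate:
  assumes I: "finite I" "card I \<ge> 2" and d: "\<And>i. i \<in> I \<Longrightarrow> d i > 0"
  shows "\<bar>density I d (m + k) - density I d m\<bar> \<le> real (card I) / real (p ^ m)"
proof -
  let ?Q = "real (p ^ (m + k))"
  have Q: "?Q > 0" "real (p ^ k) > 0" "real (p ^ m) > 0" using p_gt_1 by simp_all
  have ne: "I \<noteq> {}" using I by auto
  have coord: "\<bar>real (p ^ (m + k) div d i) - real (p ^ k * (p ^ m div d i))\<bar> \<le> real (p ^ k)"
    if "i \<in> I" for i
  proof -
    have "p ^ k * (p ^ m div d i) \<le> p ^ (m + k) div d i"
      by (metis div_mult1_eq le_add1 mult.commute power_add div_times_less_eq_dividend less_eq_div_iff_mult_less_eq d[OF that] mult.assoc mult_le_mono2)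
    moreover have "p ^ (m + k) div d i \<le> p ^ k * (p ^ m div d i) + p ^ k"
    proof -
      have "p ^ m < d i * (p ^ m div d i + 1)" using d[OF that]
        by (metis dividend_less_div_times mult.commute add.commute distrib_left mult.right_neutral Suc_eq_plus1)
      then have "p ^ k * p ^ m \<le> p ^ k * (d i * (p ^ m div d i + 1))"
        by (intro mult_le_mono2 less_imp_le_nat)
      then have "p ^ (m + k) \<le> (p ^ k * (p ^ m div d i + 1)) * d i"
        by (simp only: power_add mult_ac)
      then have "p ^ (m + k) div d i \<le> p ^ k * (p ^ m div d i + 1)"
        using d[OF that] by (metis div_le_mono nonzero_mult_div_cancel_right less_not_refl)
      then show ?thesis by simp
    qed
    ultimately show ?thesis by linarith
  qed
  have le: "p ^ k * (p ^ m div d i) \<le> p ^ (m + k)" for i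
    by (simp add: power_add mult.commute)
  have "\<bar>D I (\<lambda>i. p ^ (m + k) div d i) - D I (\<lambda>i. p ^ k * (p ^ m div d i))\<bar>
      \<le> real (p ^ (m + k)) ^ (card I - 2) * (\<Sum>i\<in>I. \<bar>real (p ^ (m + k) div d i) - real (p ^ k * (p ^ m div d i))\<bar>)"
    by (rule D_lipschitz[OF I]) (use le in auto)
  also have "\<dots> \<le> ?Q ^ (card I - 2) * (\<Sum>i\<in>I. real (p ^ k))"
    by (intro mult_left_mono sum_mono coord) auto
  finally have *: "\<bar>D I (\<lambda>i. p ^ (m + k) div d i) - D I (\<lambda>i. p ^ k * (p ^ m div d i))\<bar>
      \<le> ?Q ^ (card I - 2) * (real (card I) * real (p ^ k))" by simp
  have pow: "?Q ^ (card I - 1) = ?Q ^ (card I - 2) * ?Q"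
    using I(2) by (metis Suc_diff_Suc Suc_1 Suc_le_eq mult.commute power_Suc diff_Suc_1 diff_diff_left plus_1_eq_Suc)
  have Qmk: "?Q = real (p ^ m) * real (p ^ k)" by (simp add: power_add)
  have "density I d m = D I (\<lambda>i. p ^ k * (p ^ m div d i)) / ?Q ^ (card I - 1)"
    unfolding density_def D_times_p_pow[OF I(1) ne] Qmk power_mult_distrib using p_gt_1 by simp
  then have "\<bar>density I d (m + k) - density I d m\<bar>
      = \<bar>D I (\<lambda>i. p ^ (m + k) div d i) - D I (\<lambda>i. p ^ k * (p ^ m div d i))\<bar> / ?Q ^ (card I - 1)"
    using Q by (simp add: density_def diff_divide_distrib[symmetric])
  also have "\<dots> \<le> ?Q ^ (card I - 2) * (real (card I) * real (p ^ k)) / ?Q ^ (card I - 1)"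
    by (rule divide_right_mono[OF *]) simp
  also have "\<dots> = real (card I) / real (p ^ m)"
    unfolding pow using p_gt_1 by (simp add: field_simps power_add)
  finally show ?thesis .
qed

text \<open>
  The bound is independent of \<open>n\<close> and explicit in \<open>p\<close>, so that the limit over \<open>n\<close> can be followed by the limit
  over \<open>p\<close>. The existence of the limit over \<open>n\<close>, that is, of the Hilbert-Kunz multiplicity, is part of the argument.
\<close>

lemma limit_estimate:
  assumes I: "finite I" "card I \<ge> 2" and d: "\<And>i. i \<in> I \<Longrightarrow> d i > 0"
  defines "E \<equiv> \<lambda>n. (\<Sum>r\<in>box I d. D I (residue_bound d (\<lambda>_. p ^ n) r)) / real (p ^ n) ^ (card I - 1)"
  shows "\<bar>lim E - real (\<Prod>i\<in>I. d i) * density I d 1\<bar> \<le> real (\<Prod>i\<in>I. d i) * (real (card I) / real p)"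
proof -
  let ?P = "real (\<Prod>i\<in>I. d i)"
  have small: "((\<lambda>n. c / real (p ^ n)) \<longlongrightarrow> 0) at_top" for c
  proof -
    have "((\<lambda>n. c * (1 / real p) ^ n) \<longlongrightarrow> c * 0) at_top"
      using p_gt_1 by (intro tendsto_mult tendsto_const LIMSEQ_realpow_zero) auto
    then show ?thesis by (simp add: divide_inverse power_inverse)
  qed
  have "Cauchy (density I d)"
  proof (rule CauchyI)
    fix e :: real assume "e > 0"
    then have "\<forall>\<^sub>F n in at_top. real (card I) / real (p ^ n) < e / 2"
      using small[of "real (card I)"] by (intro order_tendstoD) auto
    then obtain M where M: "real (card I) / real (p ^ M) < e / 2"
      by (auto simp: eventually_at_top_linorder)
    have "\<bar>density I d n - density I d M\<bar> < e / 2" if "n \<ge> M" for n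
    proof -
      have "\<bar>density I d n - density I d M\<bar> \<le> real (card I) / real (p ^ M)"
        using density_estimate[where I = I and d = d and m = M and k = "n - M", OF I d] that by simp
      then show ?thesis using M by (rule le_less_trans)
    qed
    then have "norm (density I d m - density I d n) < e" if "m \<ge> M" "n \<ge> M" for m n
      using that by (smt (verit) field_sum_of_halves real_norm_def)
    then show "\<exists>M. \<forall>m\<ge>M. \<forall>n\<ge>M. norm (density I d m - density I d n) < e" by blast
  qed
  then obtain L where L: "(density I d \<longlongrightarrow> L) at_top"
    using Cauchy_convergent convergent_def by blast
  have "((\<lambda>n. E n - ?P * density I d n) \<longlongrightarrow> 0) at_top"
  proof (rule tendsto_0_le[OF small[of "?P * real (card I)"] always_eventually, where K = 1], rule allI)
    fix n
    have q: "p ^ n > 0" using p_gt_1 by simp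
    have "norm (E n - ?P * density I d n) \<le> ?P * (real (card I) / real (p ^ n))"
      using sum_D_estimate[where I = I and d = d and q = "p ^ n", OF I d q]
      by (simp only: E_def density_def real_norm_def)
    also have "\<dots> = ?P * real (card I) / real (p ^ n)" by simp
    also have "\<dots> \<le> norm (?P * real (card I) / real (p ^ n)) * 1"
      unfolding real_norm_def mult_1_right by (rule abs_ge_self)
    finally show "norm (E n - ?P * density I d n) \<le> norm (?P * real (card I) / real (p ^ n)) * 1" .
  qed
  then have "((\<lambda>n. (E n - ?P * density I d n) + ?P * density I d n) \<longlongrightarrow> 0 + ?P * L) at_top"
    by (intro tendsto_intros L)
  then have "lim E = ?P * L" by (intro limI) simp
  moreover have "\<bar>L - density I d 1\<bar> \<le> real (card I) / real p"
  proof (rule tendsto_upperbound)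
    show "((\<lambda>n. \<bar>density I d n - density I d 1\<bar>) \<longlongrightarrow> \<bar>L - density I d 1\<bar>) at_top"
      by (intro tendsto_intros L)
    show "\<forall>\<^sub>F n in at_top. \<bar>density I d n - density I d 1\<bar> \<le> real (card I) / real p"
      using eventually_ge_at_top[of 1]
    proof eventually_elim
      case (elim n)
      then show ?case using density_estimate[where I = I and d = d and m = 1 and k = "n - 1", OF I d] by simp
    qed
  qed simp
  then have "?P * \<bar>L - density I d 1\<bar> \<le> ?P * (real (card I) / real p)"
    by (rule mult_left_mono) (rule of_nat_0_le_iff)
  moreover have "\<bar>?P * L - ?P * density I d 1\<bar> = ?P * \<bar>L - density I d 1\<bar>"
    unfolding right_diff_distrib[symmetric] abs_mult by (simp only: abs_of_nat)
  ultimately show ?thesis by simp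
qed

end

lemma real_hk_colength:
  assumes "Factorial_Ring.prime p" and d: "\<And>i. i \<in> {1..s} \<Longrightarrow> d i > 0"
  shows "real (hk_colength p s (diagonal_form p s d) n)
    = (\<Sum>r\<in>box {1..s} d. prime_torsion.D p (range (residue_at p)) {1..s} (residue_bound d (\<lambda>_. p ^ n) r))"
proof -
  interpret residue_polynomials p "{1..s}" "p ^ n"
    by unfold_locales (use assms in auto)
  let ?J = "{1..s}" and ?d = "\<lambda>i. if i \<in> {1..s} then d i else 1"
  have A: "poly_Zp p s = A" by (simp add: poly_Zp_def)
  have h: "diagonal_form p s d = diag d" unfolding diagonal_form_def diag_def A var_Zp_def ..
  obtain k where k: "colength A (diag_ideal d) = enat k"
    "real k = log p (card (G.ker_pow d ?J (\<lambda>_. p ^ n) 1))"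
    using colength_diag_ideal by blast
  have "hk_colength p s (diagonal_form p s d) n = k"
    using k(1) unfolding hk_colength_def h A var_Zp_def diag_ideal_def by simp
  moreover have "G.ker_pow d ?J (\<lambda>_. p ^ n) 1 = G.ker_pow ?d ?J (\<lambda>_. p ^ n) 1"
  proof -
    have "shift_sum d ?J f = shift_sum ?d ?J f" for f :: "(nat \<Rightarrow> nat) \<Rightarrow> residue_family"
      unfolding shift_sum_def by (intro ext sum.cong) auto
    then show ?thesis by (simp add: G.ker_pow_def)
  qed
  moreover have "log p (card (G.ker_pow ?d ?J (\<lambda>_. p ^ n) 1))
      = (\<Sum>r\<in>box ?J ?d. G.D ?J (residue_bound ?d (\<lambda>_. p ^ n) r))"
    by (rule G.log_card_ker_split) (use d in auto)
  moreover have "\<dots> = (\<Sum>r\<in>box ?J d. G.D ?J (residue_bound d (\<lambda>_. p ^ n) r))"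
  proof (rule sum.cong)
    show "box ?J ?d = box ?J d" by (rule box_cong) simp
    show "G.D ?J (residue_bound ?d (\<lambda>_. p ^ n) r) = G.D ?J (residue_bound d (\<lambda>_. p ^ n) r)" for r
      by (rule G.D_cong) (simp add: residue_bound_def)
  qed
  ultimately show ?thesis using k(2) by simp
qed

lemma hk_multiplicity_estimate:
  assumes p: "Factorial_Ring.prime p" and s: "s \<ge> 2" and d: "\<And>i. i \<in> {1..s} \<Longrightarrow> d i > 0"
  shows "\<bar>hk_multiplicity p s (diagonal_form p s d)
      - real (\<Prod>i=1..s. d i) * (central_count p {1..s} (\<lambda>i. p div d i) / real p ^ (s - 1))\<bar>
    \<le> real (\<Prod>i=1..s. d i) * (real s / real p)"
proof -
  interpret G: prime_torsion p "range (residue_at p)" by (rule prime_torsion_residue_at[OF p])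
  have "G.D {1..s} (\<lambda>i. p div d i) = central_count p {1..s} (\<lambda>i. p div d i)"
    by (rule G.D_eq_central_count) auto
  then have density: "G.density {1..s} d 1 = central_count p {1..s} (\<lambda>i. p div d i) / real p ^ (s - 1)"
    by (simp add: G.density_def)
  have hk: "hk_multiplicity p s (diagonal_form p s d)
      = lim (\<lambda>n. (\<Sum>r\<in>box {1..s} d. G.D {1..s} (residue_bound d (\<lambda>_. p ^ n) r))
          / real (p ^ n) ^ (card {1..s} - 1))"
  proof -
    have "real (hk_colength p s (diagonal_form p s d) n)
        = (\<Sum>r\<in>box {1..s} d. G.D {1..s} (residue_bound d (\<lambda>_. p ^ n) r))" for n
      by (rule real_hk_colength[OF p d])
    then show ?thesis by (simp only: hk_multiplicity_def card_atLeastAtMost diff_Suc_1)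
  qed
  have "finite {1..s}" "card {1..s} \<ge> 2" using s by auto
  from G.limit_estimate[where I = "{1..s}" and d = d, OF this d]
  show ?thesis unfolding hk[symmetric] density by simp
qed

theorem theorem2p4:
  fixes s :: nat and d :: "nat \<Rightarrow> nat"
  assumes "s \<ge> 2"
    and "\<And>i. i \<in> {1..s} \<Longrightarrow> d i > 1"
  shows "((\<lambda>p. hk_multiplicity p s (diagonal_form p s d)) \<longlongrightarrow>
      real (\<Prod>i=1..s. d i) * 2 powi (1 - int s) / fact (s - 1)
        * (\<Sum>\<^sub>\<infinity>l\<in>UNIV. C_coeff s d l))
      (inf at_top (principal {p :: nat. Factorial_Ring.prime p}))
    \<and> real (\<Prod>i=1..s. d i) * 2 powi (1 - int s) / fact (s - 1)
        * (\<Sum>\<^sub>\<infinity>l\<in>UNIV. C_coeff s d l)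
      = real (\<Prod>i=1..s. d i) * 2 powi (1 - int s) / fact (s - 1)
        * (C_coeff s d 0 + 2 * (\<Sum>\<^sub>\<infinity>l\<in>{0<..}. C_coeff s d l))"
proof
  let ?F = "inf at_top (principal {p :: nat. Factorial_Ring.prime p})"
  let ?P = "real (\<Prod>i=1..s. d i)"
  let ?\<mu> = "\<lambda>p. hk_multiplicity p s (diagonal_form p s d)"
  let ?g = "\<lambda>p. ?P * (central_count p {1..s} (\<lambda>i. p div d i) / real p ^ (s - 1))"
  have d: "d i > 0" if "i \<in> {1..s}" for i using assms(2)[OF that] by simp
  have "((\<lambda>p. ?\<mu> p - ?g p) \<longlongrightarrow> 0) ?F"
  proof (rule tendsto_0_le)
    have "((\<lambda>p. ?P * (real s / real p)) \<longlongrightarrow> ?P * 0) at_top"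
      by (intro tendsto_mult tendsto_const lim_const_over_n)
    then show "((\<lambda>p. ?P * (real s / real p)) \<longlongrightarrow> 0) ?F"
      using tendsto_mono[OF inf_le1] by simp
    have "norm (?\<mu> p - ?g p) \<le> norm (?P * (real s / real p)) * 1" if "Factorial_Ring.prime p" for p
    proof -
      have "norm (?\<mu> p - ?g p) \<le> ?P * (real s / real p)"
        unfolding real_norm_def by (rule hk_multiplicity_estimate[OF that assms(1) d])
      also have "\<dots> \<le> norm (?P * (real s / real p)) * 1"
        unfolding real_norm_def mult_1_right by (rule abs_ge_self)
      finally show ?thesis .
    qed
    then show "\<forall>\<^sub>F p in ?F. norm (?\<mu> p - ?g p) \<le> norm (?P * (real s / real p)) * 1"
      unfolding eventually_inf_principal by (intro always_eventually) auto
  qed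
  moreover have "(?g \<longlongrightarrow> ?P * (2 powi (1 - int s) / fact (s - 1) * (\<Sum>\<^sub>\<infinity>l\<in>UNIV. C_coeff s d l))) ?F"
    by (intro tendsto_mult tendsto_const tendsto_mono[OF inf_le1 central_count_limit_C_coeff[OF assms(1) d]])
  ultimately have "((\<lambda>p. (?\<mu> p - ?g p) + ?g p) \<longlongrightarrow>
      0 + ?P * (2 powi (1 - int s) / fact (s - 1) * (\<Sum>\<^sub>\<infinity>l\<in>UNIV. C_coeff s d l))) ?F"
    by (rule tendsto_add)
  then show "(?\<mu> \<longlongrightarrow> ?P * 2 powi (1 - int s) / fact (s - 1) * (\<Sum>\<^sub>\<infinity>l\<in>UNIV. C_coeff s d l)) ?F"
    by (simp add: mult.assoc)
qed (simp only: infsum_C_coeff(2)[OF assms(1)])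

end
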